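(* There is an algorithm that, given positive weights $w_1, w_2, \ldots, w_n$, constructs an optimal skeleton tree for $w_1, \ldots, w_n$ in $O(n^2 \log n)$ time.
   Context: All trees are rooted and binary. A tree is full if every node has zero or two children; a perfect tree is a full tree all of whose leaves have the same depth. A perfect subtree (a node together with all its descendants, forming a perfect tree) is maximal if it is not a subtree of another perfect subtree. A prefix-free code for $n$ symbols with positive weights $w_1,\ldots,w_n$ is a sequence of $n$ binary codewords none of which is a prefix of another; with codeword lengths $\ell_1,\ldots,\ell_n$ it is optimal if $\sum_i \ell_i w_i$ is minimal among all prefix-free codes for these weights. Each prefix-free code forms a binary tree (left edges labelled 0, right edges labelled 1) whose $n$ leaves correspond to the codewords and are labelled with $w_1,\ldots,w_n$. The skeleton tree of such a tree is obtained by choosing all (pairwise disjoint) maximal perfect subtrees and shrinking each of them into its root (removing all its nodes except its root). An optimal skeleton tree for $w_1,\ldots,w_n$ is a skeleton tree with the least number of nodes among the skeleton trees of all trees formed by optimal prefix-free codes for $w_1,\ldots,w_n$. *)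

theory Defs
  imports Complex_Main "HOL-Library.Sublist" "HOL-Library.Landau_Symbols"
begin

section \<open>Trees, codes and skeleton trees\<close>

text \<open>
  A node of a rooted binary tree is identified with the edge labels on the path from the root to it
  (\<open>False\<close> = 0 = left, \<open>True\<close> = 1 = right), and an unlabelled tree with its set of nodes.
\<close>

type_synonym node = "bool list"

definition leaves :: "node set \<Rightarrow> node set" where
  "leaves V = {v \<in> V. \<forall>b. v @ [b] \<notin> V}"

definition full :: "node set \<Rightarrow> bool" where
  "full V \<longleftrightarrow> (\<forall>v\<in>V. v @ [False] \<in> V \<longleftrightarrow> v @ [True] \<in> V)"

definition perfect :: "node set \<Rightarrow> bool" where
  "perfect V \<longleftrightarrow> full V \<and> (\<forall>u\<in>leaves V. \<forall>v\<in>leaves V. length u = length v)"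

definition subtree :: "node set \<Rightarrow> node \<Rightarrow> node set" where
  "subtree V v = {u. v @ u \<in> V}"

definition maximal_perfect :: "node set \<Rightarrow> node \<Rightarrow> bool" where
  "maximal_perfect V v \<longleftrightarrow> v \<in> V \<and> perfect (subtree V v) \<and>
     \<not> (\<exists>u\<in>V. strict_prefix u v \<and> perfect (subtree V u))"

text \<open>A labelled tree: its nodes, and the labels of those nodes that carry one.\<close>

type_synonym ltree = "node set \<times> (node \<rightharpoonup> real)"

text \<open>Leaves that are not absorbed by a larger perfect subtree keep their label; the root of a
  shrunk subtree with more than one node had no label and gets none.\<close>

definition skeleton :: "ltree \<Rightarrow> ltree" where
  "skeleton = (\<lambda>(V, lab).
     let V' = V - {u. \<exists>v. maximal_perfect V v \<and> strict_prefix v u} in (V', lab |` V'))"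

definition num_nodes :: "ltree \<Rightarrow> nat" where
  "num_nodes t = card (fst t)"

definition prefix_free :: "bool list list \<Rightarrow> bool" where
  "prefix_free cs \<longleftrightarrow> (\<forall>i<length cs. \<forall>j<length cs. i \<noteq> j \<longrightarrow> \<not> prefix (cs ! i) (cs ! j))"

definition code_cost :: "real list \<Rightarrow> bool list list \<Rightarrow> real" where
  "code_cost ws cs = (\<Sum>i<length ws. real (length (cs ! i)) * ws ! i)"

definition code_for :: "real list \<Rightarrow> bool list list \<Rightarrow> bool" where
  "code_for ws cs \<longleftrightarrow> length cs = length ws \<and> prefix_free cs"

definition optimal_code :: "real list \<Rightarrow> bool list list \<Rightarrow> bool" where
  "optimal_code ws cs \<longleftrightarrow> code_for ws cs \<and>
     (\<forall>cs'. code_for ws cs' \<longrightarrow> code_cost ws cs \<le> code_cost ws cs')"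

definition code_tree :: "real list \<Rightarrow> bool list list \<Rightarrow> ltree" where
  "code_tree ws cs = ({v. \<exists>c\<in>set cs. prefix v c}, map_of (zip cs ws))"

definition optimal_skeleton_tree :: "real list \<Rightarrow> ltree \<Rightarrow> bool" where
  "optimal_skeleton_tree ws S \<longleftrightarrow>
     (\<exists>cs. optimal_code ws cs \<and> S = skeleton (code_tree ws cs)) \<and>
     (\<forall>cs. optimal_code ws cs \<longrightarrow> num_nodes S \<le> num_nodes (skeleton (code_tree ws cs)))"


section \<open>The machine model\<close>

text \<open>
  Algorithms are programs of a small imperative language executed on a unit-cost random access
  machine. There are finitely many integer variables, integer arrays and weight arrays in a program.
  Integers are machine words: a computation is stuck as soon as it evaluates an integer expression
  to a value above the bound \<open>B\<close>, which will be polynomial in the input size, so that words have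
  \<open>O(log n)\<close> bits. Weights are real numbers that can only be moved, added and compared.
\<close>

type_synonym vname = string

record state =
  ivar :: "vname \<Rightarrow> nat"
  iarr :: "vname \<Rightarrow> nat \<Rightarrow> nat"
  warr :: "vname \<Rightarrow> nat \<Rightarrow> real"

datatype iexp =
    Num nat | Var vname | Cell vname iexp
  | Plus iexp iexp | Minus iexp iexp | Times iexp iexp | Div iexp iexp

datatype wexp = WCell vname iexp | WPlus wexp wexp

datatype bexp =
    ILess iexp iexp | IEq iexp iexp | WLess wexp wexp | BNot bexp | BAnd bexp bexp

datatype com =
    Skip
  | Assign vname iexp
  | Store vname iexp iexp
  | WStore vname iexp wexp
  | Seq com com
  | Cond bexp com com
  | While bexp com

primrec ival :: "state \<Rightarrow> iexp \<Rightarrow> nat" where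
  "ival s (Num k) = k"
| "ival s (Var x) = ivar s x"
| "ival s (Cell a e) = iarr s a (ival s e)"
| "ival s (Plus e f) = ival s e + ival s f"
| "ival s (Minus e f) = ival s e - ival s f"
| "ival s (Times e f) = ival s e * ival s f"
| "ival s (Div e f) = ival s e div ival s f"

primrec wval :: "state \<Rightarrow> wexp \<Rightarrow> real" where
  "wval s (WCell a e) = warr s a (ival s e)"
| "wval s (WPlus e f) = wval s e + wval s f"

primrec bval :: "state \<Rightarrow> bexp \<Rightarrow> bool" where
  "bval s (ILess e f) \<longleftrightarrow> ival s e < ival s f"
| "bval s (IEq e f) \<longleftrightarrow> ival s e = ival s f"
| "bval s (WLess e f) \<longleftrightarrow> wval s e < wval s f"
| "bval s (BNot b) \<longleftrightarrow> \<not> bval s b"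
| "bval s (BAnd b c) \<longleftrightarrow> bval s b \<and> bval s c"

text \<open>All integers arising in the evaluation, including array indices, are at most \<open>B\<close>.\<close>

primrec ifits :: "nat \<Rightarrow> state \<Rightarrow> iexp \<Rightarrow> bool" where
  "ifits B s (Num k) \<longleftrightarrow> k \<le> B"
| "ifits B s (Var x) \<longleftrightarrow> ivar s x \<le> B"
| "ifits B s (Cell a e) \<longleftrightarrow> ifits B s e \<and> ival s (Cell a e) \<le> B"
| "ifits B s (Plus e f) \<longleftrightarrow> ifits B s e \<and> ifits B s f \<and> ival s (Plus e f) \<le> B"
| "ifits B s (Minus e f) \<longleftrightarrow> ifits B s e \<and> ifits B s f"
| "ifits B s (Times e f) \<longleftrightarrow> ifits B s e \<and> ifits B s f \<and> ival s (Times e f) \<le> B"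
| "ifits B s (Div e f) \<longleftrightarrow> ifits B s e \<and> ifits B s f"

primrec wfits :: "nat \<Rightarrow> state \<Rightarrow> wexp \<Rightarrow> bool" where
  "wfits B s (WCell a e) \<longleftrightarrow> ifits B s e"
| "wfits B s (WPlus e f) \<longleftrightarrow> wfits B s e \<and> wfits B s f"

primrec bfits :: "nat \<Rightarrow> state \<Rightarrow> bexp \<Rightarrow> bool" where
  "bfits B s (ILess e f) \<longleftrightarrow> ifits B s e \<and> ifits B s f"
| "bfits B s (IEq e f) \<longleftrightarrow> ifits B s e \<and> ifits B s f"
| "bfits B s (WLess e f) \<longleftrightarrow> wfits B s e \<and> wfits B s f"
| "bfits B s (BNot b) \<longleftrightarrow> bfits B s b"
| "bfits B s (BAnd b c) \<longleftrightarrow> bfits B s b \<and> bfits B s c"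

text \<open>Evaluating an expression costs one step per operator and operand.\<close>

primrec icost :: "iexp \<Rightarrow> nat" where
  "icost (Num k) = 1"
| "icost (Var x) = 1"
| "icost (Cell a e) = icost e + 1"
| "icost (Plus e f) = icost e + icost f + 1"
| "icost (Minus e f) = icost e + icost f + 1"
| "icost (Times e f) = icost e + icost f + 1"
| "icost (Div e f) = icost e + icost f + 1"

primrec wcost :: "wexp \<Rightarrow> nat" where
  "wcost (WCell a e) = icost e + 1"
| "wcost (WPlus e f) = wcost e + wcost f + 1"

primrec bcost :: "bexp \<Rightarrow> nat" where
  "bcost (ILess e f) = icost e + icost f + 1"
| "bcost (IEq e f) = icost e + icost f + 1"
| "bcost (WLess e f) = wcost e + wcost f + 1"
| "bcost (BNot b) = bcost b + 1"
| "bcost (BAnd b c) = bcost b + bcost c + 1"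

text \<open>\<open>exec B c s t s'\<close>: with word bound \<open>B\<close>, the program \<open>c\<close> started in state \<open>s\<close> terminates after
  \<open>t\<close> steps in state \<open>s'\<close>.\<close>

inductive exec :: "nat \<Rightarrow> com \<Rightarrow> state \<Rightarrow> nat \<Rightarrow> state \<Rightarrow> bool" for B :: nat where
  Skip: "exec B Skip s 1 s"
| Assign: "ifits B s e \<Longrightarrow>
    exec B (Assign x e) s (icost e + 1) (s\<lparr>ivar := (ivar s)(x := ival s e)\<rparr>)"
| Store: "ifits B s i \<Longrightarrow> ifits B s e \<Longrightarrow>
    exec B (Store a i e) s (icost i + icost e + 1)
      (s\<lparr>iarr := (iarr s)(a := (iarr s a)(ival s i := ival s e))\<rparr>)"
| WStore: "ifits B s i \<Longrightarrow> wfits B s e \<Longrightarrow>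
    exec B (WStore a i e) s (icost i + wcost e + 1)
      (s\<lparr>warr := (warr s)(a := (warr s a)(ival s i := wval s e))\<rparr>)"
| Seq: "exec B c s t s' \<Longrightarrow> exec B d s' t' s'' \<Longrightarrow> exec B (Seq c d) s (t + t' + 1) s''"
| CondTrue: "bfits B s b \<Longrightarrow> bval s b \<Longrightarrow> exec B c s t s' \<Longrightarrow>
    exec B (Cond b c d) s (bcost b + t + 1) s'"
| CondFalse: "bfits B s b \<Longrightarrow> \<not> bval s b \<Longrightarrow> exec B d s t s' \<Longrightarrow>
    exec B (Cond b c d) s (bcost b + t + 1) s'"
| WhileFalse: "bfits B s b \<Longrightarrow> \<not> bval s b \<Longrightarrow> exec B (While b c) s (bcost b + 1) s"
| WhileTrue: "bfits B s b \<Longrightarrow> bval s b \<Longrightarrow> exec B c s t s' \<Longrightarrow> exec B (While b c) s' t' s'' \<Longrightarrow>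
    exec B (While b c) s (bcost b + t + t' + 1) s''"

text \<open>Input: the variable \<open>n\<close> and the weight array \<open>w\<close> hold the number of weights and the weights
  (counted from 0); everything else is 0.\<close>

definition input_state :: "real list \<Rightarrow> state" where
  "input_state ws =
     \<lparr>ivar = (\<lambda>_. 0)(''n'' := length ws),
      iarr = (\<lambda>_ _. 0),
      warr = (\<lambda>_ _. 0)(''w'' := (\<lambda>i. if i < length ws then ws ! i else 0))\<rparr>"

text \<open>Output: a linked tree whose nodes are nonzero pointers, with child pointers in the arrays
  \<open>left\<close> and \<open>right\<close> (0 if there is no such child) and labels in the weight array \<open>label\<close>; as
  weights are positive, 0 stands for an absent label. Injectivity rules out shared subtrees.\<close>

primrec follow :: "state \<Rightarrow> nat \<Rightarrow> node \<Rightarrow> nat" where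
  "follow s p [] = p"
| "follow s p (b # v) =
     (if p = 0 then 0 else follow s (iarr s (if b then ''right'' else ''left'') p) v)"

definition outputs_tree :: "state \<Rightarrow> ltree \<Rightarrow> bool" where
  "outputs_tree s = (\<lambda>(V, lab).
     let ptr = follow s (ivar s ''root'') in
       V = {v. ptr v \<noteq> 0} \<and> inj_on ptr V \<and>
       (\<forall>v\<in>V. warr s ''label'' (ptr v) = (case lab v of None \<Rightarrow> 0 | Some w \<Rightarrow> w)))"

end

theory Submission
  imports Defs "HOL-Library.Multiset" "HOL-Real_Asymp.Real_Asymp"
begin

text \<open>
  A minimal skeleton depends only on the numbers \<open>c\<^sub>d\<close> of leaves of depth \<open>d\<close>: for each \<open>d\<close> the leaves
  of depth \<open>d\<close> are partitioned by perfect subtrees whose sizes are powers of two, so the skeleton has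
  at least \<open>\<Sum>\<^sub>d popcount c\<^sub>d\<close> leaves, and by Kraft's equality this bound is attained. The cost of an
  optimal assignment of the weights to such a full tree is \<open>\<Sum>\<^sub>d W (i\<^sub>d)\<close>, where \<open>i\<^sub>d\<close> is the number of leaves
  of depth at most \<open>d\<close> and \<open>W i\<close> is the sum of all but the \<open>i\<close> largest weights. Hence it suffices to
  find the lexicographic minimum of cost and popcount sum over all sequences \<open>c\<close>, without any tie
  analysis of Huffman's algorithm.
  With \<open>J\<close> inner nodes of depth at most \<open>d\<close>, \<open>I\<close> of them of depth \<open>d\<close>, and \<open>x\<close> inner nodes of depth
  \<open>d + 1\<close>, the recurrence is
  \<open>F (J, I) = (W (J + 1 - 2 I), 0) + min\<^sub>x ((0, popcount (2 I - x)) + F (J + x, x))\<close>.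
  For fixed \<open>J\<close> this is a (min,+) convolution with \<open>popcount\<close>, which is computed for all \<open>I\<close> in
  \<open>O(n log n)\<close> steps by treating the bits of the second argument one after the other.
\<close>

section \<open>Code trees and skeleton trees\<close>

text \<open>The level counts of any full tree bound its cost and its skeleton size from below at the
  same time, so the two criteria can be compared lexicographically without ever trading one for the
  other. Codes whose tree has a node with a single child drop out because positive weights make
  contraction strictly cheaper. A choice \<open>x > 0\<close> leads from row \<open>J\<close> to row
  \<open>J + x\<close>, so rows are filled in order of decreasing \<open>J\<close>. Each bit of
  \<open>popcount\<close> costs one in-place pass over a row, as in a knapsack with one item per
  power of two. The full tree exists only in the proof. The program allocates one cell per perfect
  subtree and pairs cells level by level, from the deepest level upwards. This yields the skeleton
  only if pairing never creates a new perfect tree. The reason is that the perfect trees emitted at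
  one depth have pairwise different heights, one for each leaf depth, while every tree that results
  from pairing is imperfect and stays so.\<close>

datatype ctree = Lf real | Nd ctree ctree

primrec codewords :: "ctree \<Rightarrow> (node \<times> real) list" where
  "codewords (Lf w) = [([], w)]"
| "codewords (Nd l r) =
     map (apfst ((#) False)) (codewords l) @ map (apfst ((#) True)) (codewords r)"

primrec height :: "ctree \<Rightarrow> nat" where
  "height (Lf w) = 0"
| "height (Nd l r) = Suc (max (height l) (height r))"

primrec balanced :: "ctree \<Rightarrow> bool" where
  "balanced (Lf w) \<longleftrightarrow> True"
| "balanced (Nd l r) \<longleftrightarrow> balanced l \<and> balanced r \<and> height l = height r"

primrec tnodes :: "ctree \<Rightarrow> node set" where
  "tnodes (Lf w) = {[]}"
| "tnodes (Nd l r) = insert [] ((#) False ` tnodes l \<union> (#) True ` tnodes r)"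

datatype stree = SLf "real option" | SNd stree stree

text \<open>Descending from the root meets the topmost balanced node of each path first, and this is
  the maximal one. \<open>SLf None\<close> stands for a collapsed subtree with more than one
  node.\<close>

primrec shrink :: "ctree \<Rightarrow> stree" where
  "shrink (Lf w) = SLf (Some w)"
| "shrink (Nd l r) = (if balanced (Nd l r) then SLf None else SNd (shrink l) (shrink r))"

primrec snodes :: "stree \<Rightarrow> node set" where
  "snodes (SLf x) = {[]}"
| "snodes (SNd l r) = insert [] ((#) False ` snodes l \<union> (#) True ` snodes r)"

primrec slabel :: "stree \<Rightarrow> node \<rightharpoonup> real" where
  "slabel (SLf x) = (\<lambda>v. if v = [] then x else None)"
| "slabel (SNd l r) =
     (\<lambda>v. case v of [] \<Rightarrow> None | b # u \<Rightarrow> if b then slabel r u else slabel l u)"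

primrec sleaves :: "stree \<Rightarrow> nat" where
  "sleaves (SLf x) = 1"
| "sleaves (SNd l r) = sleaves l + sleaves r"

lemma Nil_in_tnodes [simp]: "[] \<in> tnodes t"
  by (cases t) auto

lemma codewords_not_Nil [simp]: "codewords t \<noteq> []"
  by (induction t) auto

lemma finite_snodes [simp]: "finite (snodes t)"
  by (induction t) auto

lemma sleaves_pos: "sleaves t > 0"
  by (induction t) auto

text \<open>This lets the rest of the proof minimise the leaves of the skeleton instead of its
  nodes.\<close>

lemma card_snodes: "card (snodes t) = 2 * sleaves t - 1"
proof (induction t)
  case (SNd l r)
  have "card ((#) False ` snodes l \<union> (#) True ` snodes r) = card (snodes l) + card (snodes r)"
    by (subst card_Un_disjoint) (auto simp: card_image)
  moreover have "[] \<notin> (#) False ` snodes l \<union> (#) True ` snodes r" by auto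
  ultimately show ?case using SNd sleaves_pos[of l] sleaves_pos[of r] by simp
qed simp

lemma tnodes_eq_prefixes: "tnodes t = {v. \<exists>c\<in>fst ` set (codewords t). prefix v c}"
proof (induction t)
  case (Lf w)
  then show ?case by auto
next
  case (Nd l r)
  show ?case
  proof (rule set_eqI)
    fix v
    show "v \<in> tnodes (Nd l r) \<longleftrightarrow> v \<in> {v. \<exists>c\<in>fst ` set (codewords (Nd l r)). prefix v c}"
    proof (cases v)
      case Nil
      obtain a b where "(a, b) \<in> set (codewords (Nd l r))"
        using codewords_not_Nil[of "Nd l r"] hd_in_set by (metis surj_pair)
      then show ?thesis using Nil by (auto simp del: codewords.simps)
    next
      case (Cons b u)
      let ?c = "if b then r else l"
      have "v \<in> tnodes (Nd l r) \<longleftrightarrow> u \<in> tnodes ?c" using Cons by (auto simp: image_iff)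
      also have "\<dots> \<longleftrightarrow> (\<exists>c\<in>fst ` set (codewords ?c). prefix u c)" using Nd by simp
      also have "\<dots> \<longleftrightarrow> v \<in> {v. \<exists>c\<in>fst ` set (codewords (Nd l r)). prefix v c}"
        using Cons by (simp add: bex_Un)
      finally show ?thesis .
    qed
  qed
qed

lemma leaves_tnodes_Nd:
  "leaves (tnodes (Nd l r)) = (#) False ` leaves (tnodes l) \<union> (#) True ` leaves (tnodes r)"
proof (intro set_eqI)
  fix v
  show "v \<in> leaves (tnodes (Nd l r)) \<longleftrightarrow>
    v \<in> (#) False ` leaves (tnodes l) \<union> (#) True ` leaves (tnodes r)"
  proof (cases v)
    case Nil
    then show ?thesis by (auto simp: leaves_def image_iff)
  next
    case (Cons b u)
    then show ?thesis by (cases b) (auto simp: leaves_def image_iff)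
  qed
qed

lemma leaf_of_height: "\<exists>v\<in>leaves (tnodes t). length v = height t"
proof (induction t)
  case (Lf w)
  then show ?case by (auto simp: leaves_def)
next
  case (Nd l r)
  then obtain v u where "v\<in>leaves (tnodes l)" "length v = height l"
     "u\<in>leaves (tnodes r)" "length u = height r" by blast
  then have "(False # v) \<in> leaves (tnodes (Nd l r))" "length (False # v) = Suc (height l)"
    "(True # u) \<in> leaves (tnodes (Nd l r))" "length (True # u) = Suc (height r)" 
    unfolding leaves_tnodes_Nd by auto
  then show ?case
    by (intro bexI[of _ "if height l \<le> height r then True # u else False # v"]) auto
qed

lemma full_tnodes: "full (tnodes t)"
proof (induction t)
  case (Nd l r)
  show ?case unfolding full_def
  proof
    fix v assume "v \<in> tnodes (Nd l r)"
    with Nd show "v @ [False] \<in> tnodes (Nd l r) \<longleftrightarrow> v @ [True] \<in> tnodes (Nd l r)"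
      by (cases v) (auto simp: full_def image_iff)
  qed
qed (simp add: full_def)

lemma complete_leaves: "balanced t \<Longrightarrow> v \<in> leaves (tnodes t) \<Longrightarrow> length v = height t"
proof (induction t arbitrary: v)
  case (Nd l r)
  then show ?case unfolding leaves_tnodes_Nd by auto
qed (simp add: leaves_def)

text \<open>For the nontrivial direction, both halves contain a leaf whose depth is the height of
  that half; comparing these two leaves forces the heights to agree.\<close>

lemma perfect_tnodes_iff: "perfect (tnodes t) \<longleftrightarrow> balanced t"
proof
  assume "balanced t"
  then show "perfect (tnodes t)" by (auto simp: perfect_def full_tnodes complete_leaves)
next
  assume "perfect (tnodes t)"
  then have "\<forall>u\<in>leaves (tnodes t). \<forall>v\<in>leaves (tnodes t). length u = length v"
    unfolding perfect_def by blast
  then show "balanced t"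
  proof (induction t)
    case (Nd l r)
    obtain v u where "v\<in>leaves (tnodes l)" "length v = height l"
     "u\<in>leaves (tnodes r)" "length u = height r" using leaf_of_height by blast
    note vu = this
    have eq: "length x = length y" if "x \<in> leaves (tnodes (Nd l r))"
      "y \<in> leaves (tnodes (Nd l r))" for x y
      using Nd.prems that by blast
    have "length x = length y" if "x \<in> leaves (tnodes l)" "y \<in> leaves (tnodes l)" for x y
      using eq[of "False # x" "False # y"] that unfolding leaves_tnodes_Nd by simp
    moreover have "length x = length y" if "x \<in> leaves (tnodes r)" "y \<in> leaves (tnodes r)" for x y
      using eq[of "True # x" "True # y"] that unfolding leaves_tnodes_Nd by simp
    moreover have "height l = height r"
      using eq[of "False # v" "True # u"] vu unfolding leaves_tnodes_Nd by simp
    ultimately show ?case using Nd.IH by (simp only: balanced.simps) blast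
  qed simp
qed

lemma subtree_Nil [simp]: "subtree V [] = V"
  by (simp add: subtree_def)

lemma subtree_Cons_Nd [simp]:
  "subtree (tnodes (Nd l r)) (b # v) = subtree (tnodes (if b then r else l)) v"
  by (auto simp: subtree_def image_iff)

text \<open>\<open>shrink\<close> cuts below the first perfect node of a path, so maximality does
  not occur in this description; \<open>not_below_maximal_perfect_iff\<close> brings it
  back.\<close>

lemma snodes_shrink:
  "snodes (shrink t) =
    {u \<in> tnodes t. \<forall>v. strict_prefix v u \<longrightarrow> \<not> perfect (subtree (tnodes t) v)}"
proof (induction t)
  case (Lf w)
  then show ?case by auto
next
  case (Nd l r)
  show ?case
  proof (rule set_eqI)
    fix u
    show "u \<in> snodes (shrink (Nd l r)) \<longleftrightarrow> u \<in> {u \<in> tnodes (Nd l r).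
      \<forall>v. strict_prefix v u \<longrightarrow> \<not> perfect (subtree (tnodes (Nd l r)) v)}"
    proof (cases u)
      case Nil
      then show ?thesis by auto
    next
      case (Cons b u')
      let ?c = "if b then r else l"
      have "(\<forall>v. strict_prefix v (b # u') \<longrightarrow> \<not> perfect (subtree (tnodes (Nd l r)) v)) \<longleftrightarrow>
        \<not> balanced (Nd l r) \<and> (\<forall>v. strict_prefix v u' \<longrightarrow> \<not> perfect (subtree (tnodes ?c) v))"
        (is "?A \<longleftrightarrow> ?B")
      proof
        assume A: ?A
        from A have "\<not> balanced (Nd l r)" 
          by (metis perfect_tnodes_iff subtree_Nil list.distinct(1) Nil_prefix prefix_order.le_neq_trans)
        moreover have "\<not> perfect (subtree (tnodes ?c) v)" if "strict_prefix v u'" for v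
        proof -
          have "strict_prefix (b # v) (b # u')" using that by (simp add: strict_prefix_def)
          then show ?thesis using A by (metis subtree_Cons_Nd)
        qed
        ultimately show ?B by blast
      next
        assume B: ?B
        show ?A
        proof (intro allI impI)
          fix v assume v: "strict_prefix v (b # u')"
          show "\<not> perfect (subtree (tnodes (Nd l r)) v)"
          proof (cases v)
            case Nil
            then show ?thesis using B perfect_tnodes_iff[of "Nd l r"] by simp
          next
            case (Cons a v')
            with v have "a = b" "strict_prefix v' u'" by (auto simp: strict_prefix_def)
            then show ?thesis using B Cons by (simp del: tnodes.simps)
          qed
        qed
      qed
      moreover have "b # u' \<in> tnodes (Nd l r) \<longleftrightarrow> u' \<in> tnodes ?c" by (auto simp: image_iff)
      moreover have "b # u' \<in> snodes (shrink (Nd l r)) \<longleftrightarrow>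
         \<not> balanced (Nd l r) \<and> u' \<in> snodes (shrink ?c)" by (auto simp: image_iff)
      ultimately show ?thesis using Nd Cons
        by (cases b) (simp_all del: tnodes.simps shrink.simps, blast+)
    qed
  qed
qed

text \<open>The topmost perfect node above \<open>u\<close> is maximal.\<close>

lemma not_below_maximal_perfect_iff:
  assumes closed: "\<And>u v. u \<in> V \<Longrightarrow> prefix v u \<Longrightarrow> v \<in> V" and "u \<in> V"
  shows "(\<exists>v. maximal_perfect V v \<and> strict_prefix v u) \<longleftrightarrow>
    (\<exists>v. strict_prefix v u \<and> perfect (subtree V v))"
proof
  assume "\<exists>v. strict_prefix v u \<and> perfect (subtree V v)"
  then obtain v0 where v0: "strict_prefix v0 u \<and> perfect (subtree V v0)" ..
  obtain v where v: "strict_prefix v u \<and> perfect (subtree V v)"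
    and min: "\<And>x. strict_prefix x u \<and> perfect (subtree V x) \<Longrightarrow> length v \<le> length x"
    using ex_has_least_nat[where P = "\<lambda>v. strict_prefix v u \<and> perfect (subtree V v)"
        and m = length, OF v0] by auto
  have "maximal_perfect V v" unfolding maximal_perfect_def
  proof (intro conjI notI)
    show "v \<in> V" using closed[OF \<open>u \<in> V\<close>] v by (simp add: strict_prefix_def)
    show "perfect (subtree V v)" using v by simp
    assume "\<exists>x\<in>V. strict_prefix x v \<and> perfect (subtree V x)"
    then obtain x where "strict_prefix x v" "perfect (subtree V x)" by blast
    then show False using min[of x] v prefix_length_less[of x v]
      prefix_order.less_trans[of x v u] by auto
  qed
  then show "\<exists>v. maximal_perfect V v \<and> strict_prefix v u" using v by blast
qed (auto simp: maximal_perfect_def)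

lemma map_of_apfst_Cons:
  "map_of (map (apfst ((#) b)) xs) v = (case v of [] \<Rightarrow> None | a # u \<Rightarrow> if a = b then map_of xs u else None)"
  by (induction xs) (auto split: list.splits)

lemma map_of_codewords_Nd: "map_of (codewords (Nd l r)) =
     (\<lambda>v. case v of [] \<Rightarrow> None | b # u \<Rightarrow> map_of (codewords (if b then r else l)) u)"
  by (rule ext) (auto simp: map_of_append map_add_def map_of_apfst_Cons split: list.splits option.splits)

text \<open>The root of a collapsed subtree with several nodes is an inner node of the full tree,
  hence not a codeword, so restricting the original labelling already gives it no label.\<close>

lemma slabel_shrink: "slabel (shrink t) = map_of (codewords t) |` snodes (shrink t)"
proof (induction t)
  case (Lf w)
  then show ?case by (auto simp: restrict_map_def)
next
  case (Nd l r)
  show ?case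
  proof (rule ext)
    fix v
    show "slabel (shrink (Nd l r)) v =
      (map_of (codewords (Nd l r)) |` snodes (shrink (Nd l r))) v"
      using Nd unfolding map_of_codewords_Nd
      by (cases v) (auto simp: restrict_map_def image_iff)
  qed
qed

lemma distinct_codewords: "distinct (map fst (codewords t))"
proof (induction t)
  case (Nd l r)
  have "map fst (map (apfst ((#) b)) xs) = map ((#) b) (map fst xs)" for b and xs :: "(node \<times> real) list"
    by simp
  then show ?case using Nd 
    by (simp only: codewords.simps map_append distinct_append distinct_map[of _ "map fst _"]) auto
qed simp

lemma codewords_prefix:
  "x \<in> set (codewords t) \<Longrightarrow> y \<in> set (codewords t) \<Longrightarrow> prefix (fst x) (fst y) \<Longrightarrow> x = y"
  by (induction t arbitrary: x y) (auto simp: apfst_def map_prod_def)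

text \<open>Multisets are compared because a code lists its words in the order of the given weights,
  whereas \<open>codewords\<close> lists them from left to right.\<close>

theorem skeleton_code_tree:
  assumes "mset xs = mset (codewords t)"
  shows "skeleton (code_tree (map snd xs) (map fst xs)) = (snodes (shrink t), slabel (shrink t))"
proof -
  have set: "set xs = set (codewords t)" using assms by (metis set_mset_mset)
  have dist: "distinct (map fst xs)"
    using distinct_codewords[of t] assms mset_eq_imp_distinct_iff[of "map fst xs" "map fst (codewords t)"]
    by simp
  have ct: "code_tree (map snd xs) (map fst xs) = (tnodes t, map_of (codewords t))"
    using set map_of_inject_set[OF dist distinct_codewords[of t]]
    by (simp add: code_tree_def tnodes_eq_prefixes zip_map_fst_snd)
  have closed: "v \<in> tnodes t" if "u \<in> tnodes t" "prefix v u" for u v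
    using that by (auto simp: tnodes_eq_prefixes dest: prefix_order.trans)
  have "tnodes t - {u. \<exists>v. maximal_perfect (tnodes t) v \<and> strict_prefix v u} = snodes (shrink t)"
    unfolding snodes_shrink using not_below_maximal_perfect_iff[of "tnodes t"] closed by blast
  then show ?thesis unfolding ct skeleton_def by (simp add: slabel_shrink Let_def)
qed

section \<open>Codes and full trees: cost, prefix-freeness, contraction\<close>

definition tree_cost :: "(node \<times> real) list \<Rightarrow> real" where
  "tree_cost xs = (\<Sum>(v, w)\<leftarrow>xs. real (length v) * w)"

lemma tree_cost_Cons: "tree_cost (map (apfst ((#) b)) xs) = tree_cost xs + sum_list (map snd xs)"
  by (induction xs) (auto simp: tree_cost_def algebra_simps)

lemma tree_cost_append: "tree_cost (xs @ ys) = tree_cost xs + tree_cost ys"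
  by (simp add: tree_cost_def)

lemma sum_list_mset_eq:
  fixes f :: "'a \<Rightarrow> 'b :: comm_monoid_add"
  shows "mset xs = mset ys \<Longrightarrow> sum_list (map f xs) = sum_list (map f ys)"
  by (simp only: sum_mset_sum_list[symmetric] mset_map)

lemma tree_cost_mset: "mset xs = mset ys \<Longrightarrow> tree_cost xs = tree_cost ys"
  unfolding tree_cost_def by (rule sum_list_mset_eq)

lemma code_cost_eq: "code_cost (map snd xs) (map fst xs) = tree_cost xs"
  unfolding code_cost_def tree_cost_def
  by (simp add: sum_list_sum_nth atLeast0LessThan case_prod_beta)

text \<open>Replaces indices by elements; distinctness accounts for equal words at different
  positions. In this form the property passes to sublists and permutations.\<close>

lemma prefix_free_iff:
  "prefix_free (map fst xs) \<longleftrightarrow>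
     distinct (map fst xs) \<and> (\<forall>x\<in>set xs. \<forall>y\<in>set xs. prefix (fst x) (fst y) \<longrightarrow> fst x = fst y)"
  (is "?L \<longleftrightarrow> ?R")
proof
  assume L: ?L
  then have "distinct (map fst xs)"
    unfolding prefix_free_def distinct_conv_nth by force
  moreover have "fst x = fst y" if xy: "x \<in> set xs" "y \<in> set xs" "prefix (fst x) (fst y)" for x y
  proof -
    obtain i j where "i < length xs" "x = xs ! i" "j < length xs" "y = xs ! j"
      using xy(1,2) by (auto simp: in_set_conv_nth)
    then show ?thesis using L xy(3) unfolding prefix_free_def by (cases "i = j") auto
  qed
  ultimately show ?R by blast
next
  assume R: ?R
  show ?L unfolding prefix_free_def
  proof (intro allI impI notI)
    fix i j
    assume "i < length (map fst xs)" "j < length (map fst xs)" "i \<noteq> j"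
      "prefix (map fst xs ! i) (map fst xs ! j)"
    moreover from this have "fst (xs ! i) = fst (xs ! j)" using R by simp
    ultimately show False using R by (simp add: distinct_conv_nth)
  qed
qed

lemma prefix_free_codewords: "mset xs = mset (codewords t) \<Longrightarrow> prefix_free (map fst xs)"
proof -
  assume a: "mset xs = mset (codewords t)"
  then have "set xs = set (codewords t)" by (metis set_mset_mset)
  moreover have "distinct (map fst xs)" using a distinct_codewords[of t]
    mset_eq_imp_distinct_iff[of "map fst xs" "map fst (codewords t)"] by simp
  ultimately show ?thesis unfolding prefix_free_iff using codewords_prefix by blast
qed

text \<open>The half of the code below the child \<open>b\<close> of the root, with the leading bit
  removed.\<close>

definition descend :: "bool \<Rightarrow> (node \<times> real) list \<Rightarrow> (node \<times> real) list" where
  "descend b xs = map (apfst tl) (filter (\<lambda>x. fst x \<noteq> [] \<and> hd (fst x) = b) xs)"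

lemma mset_descend:
  assumes "[] \<notin> fst ` set xs"
  shows "mset xs = mset (map (apfst ((#) False)) (descend False xs))
    + mset (map (apfst ((#) True)) (descend True xs))"
  using assms
proof (induction xs)
  case (Cons x xs)
  then obtain b v w where "x = (b # v, w)" by (cases x; cases "fst x") auto
  with Cons show ?case by (cases b) (simp_all add: descend_def)
qed (simp add: descend_def)

lemma set_descend: "(v, w) \<in> set (descend b xs) \<longleftrightarrow> (b # v, w) \<in> set xs"
  unfolding descend_def by (force simp: image_iff neq_Nil_conv)

lemma prefix_free_descend:
  assumes "prefix_free (map fst xs)" shows "prefix_free (map fst (descend b xs))"
proof -
  have "distinct (map fst (descend b xs))"
  proof -
    have "map ((#) b) (map fst (descend b xs)) =
       filter (\<lambda>v. v \<noteq> [] \<and> hd v = b) (map fst xs)"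
      unfolding descend_def by (induction xs) (auto simp: neq_Nil_conv)
    moreover have "distinct (filter (\<lambda>v. v \<noteq> [] \<and> hd v = b) (map fst xs))"
      using assms unfolding prefix_free_iff by simp
    ultimately show ?thesis by (metis distinct_map)
  qed
  moreover have "fst x = fst y" 
    if "x \<in> set (descend b xs)" "y \<in> set (descend b xs)" "prefix (fst x) (fst y)" for x y
  proof -
    have "(b # fst x, snd x) \<in> set xs" "(b # fst y, snd y) \<in> set xs"
      using that(1,2) set_descend[of "fst x" "snd x"] set_descend[of "fst y" "snd y"] by simp_all
    then show ?thesis using assms that(3) unfolding prefix_free_iff by fastforce
  qed
  ultimately show ?thesis unfolding prefix_free_iff by blast
qed

text \<open>Contracting the nodes with a single child turns a code into a full tree and makes the code
  cheaper.\<close>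

lemma full_tree_of_code:
  assumes "prefix_free (map fst xs)" "xs \<noteq> []" "\<forall>x\<in>set xs. snd x > 0"
  shows "\<exists>t. mset (map snd (codewords t)) = mset (map snd xs) \<and>
    (tree_cost (codewords t) < tree_cost xs \<or> mset (codewords t) = mset xs)"
  using assms
proof (induction "sum_list (map (length \<circ> fst) xs)" arbitrary: xs rule: less_induct)
  case less
  show ?case
  proof (cases "[] \<in> fst ` set xs")
    \<comment> \<open>The empty word is a prefix of every word, so it can only occur in a code with
      a single word.\<close>
    case True
    then obtain w where w: "([], w) \<in> set xs" by force
    have "fst x = []" if "x \<in> set xs" for x
      using that w less.prems(1) unfolding prefix_free_iff by force
    moreover have "distinct (map fst xs)" using less.prems(1) unfolding prefix_free_iff by simp
    ultimately have "length xs \<le> 1" 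
    proof -
      assume "\<And>x. x \<in> set xs \<Longrightarrow> fst x = []" "distinct (map fst xs)"
      then show ?thesis by (cases xs; cases "tl xs") auto
    qed
    then have "xs = [([], w)]" using w by (cases xs) auto
    then have "mset (codewords (Lf w)) = mset xs" by simp
    then show ?thesis by (metis mset_map)
  next
    case False
    let ?A = "descend False xs" and ?B = "descend True xs"
    have m: "mset xs = mset (map (apfst ((#) False)) ?A @ map (apfst ((#) True)) ?B)"
      using mset_descend[OF False] by simp
    have len: "sum_list (map (length \<circ> fst) xs) = 
       (sum_list (map (length \<circ> fst) ?A) + length ?A) + (sum_list (map (length \<circ> fst) ?B) + length ?B)"
    proof -
      have *: "sum_list (map (length \<circ> fst) (map (apfst ((#) b)) ys)) = 
         sum_list (map (length \<circ> fst) ys) + length ys" for b and ys :: "(node \<times> real) list"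
        by (induction ys) auto
      have "sum_list (map (length \<circ> fst) xs) = sum_mset (image_mset (length \<circ> fst) (mset xs))"
        by (metis mset_map sum_mset_sum_list)
      also have "\<dots> = sum_list (map (length \<circ> fst) (map (apfst ((#) False)) ?A @ map (apfst ((#) True)) ?B))"
        unfolding m by (metis mset_map sum_mset_sum_list)
      finally show ?thesis by (simp only: map_append sum_list_append *)
    qed
    have cost: "tree_cost xs = (tree_cost ?A + sum_list (map snd ?A)) + (tree_cost ?B + sum_list (map snd ?B))"
      using tree_cost_mset[OF m] by (simp add: tree_cost_append tree_cost_Cons)
    have ms: "mset (map snd xs) = mset (map snd ?A) + mset (map snd ?B)"
    proof -
      have "mset (map snd xs) = image_mset snd (mset xs)" by simp
      also have "\<dots> = mset (map snd ?A) + mset (map snd ?B)" unfolding m 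
        by (simp add: image_mset.compositionality comp_def)
      finally show ?thesis .
    qed
    have pos: "\<forall>x\<in>set (descend b xs). snd x > 0" for b
      using less.prems(3) by (fastforce simp: set_descend)
    have IH: "\<exists>t. mset (map snd (codewords t)) = mset (map snd (descend b xs)) \<and>
      (tree_cost (codewords t) < tree_cost (descend b xs) \<or> mset (codewords t) = mset (descend b xs))"
      if "descend b xs \<noteq> []" for b
    proof (rule less.hyps)
      show "sum_list (map (length \<circ> fst) (descend b xs)) < sum_list (map (length \<circ> fst) xs)"
        using len that by (cases b) (simp_all add: length_greater_0_conv[symmetric] del: length_greater_0_conv)
    qed (use that pos prefix_free_descend[OF less.prems(1)] in auto)
    have ne: "?A \<noteq> [] \<or> ?B \<noteq> []" using m less.prems(2) by auto
    have sumpos: "sum_list (map snd (descend b xs)) > 0" if "descend b xs \<noteq> []" for b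
    proof -
      have "0 < sum_list ys" if "ys \<noteq> []" "\<forall>y\<in>set ys. y > 0" for ys :: "real list"
        using that by (induction ys rule: list_nonempty_induct) auto
      from this[of "map snd (descend b xs)"] show ?thesis using that pos[of b] by simp
    qed
    \<comment> \<open>The root has only one child: dropping the common first bit saves the total
      weight, which is positive, so the strict alternative holds.\<close>
    have single: "\<exists>t. mset (map snd (codewords t)) = mset (map snd xs) \<and>
      (tree_cost (codewords t) < tree_cost xs \<or> mset (codewords t) = mset xs)"
      if ne: "descend b xs \<noteq> []" and e: "descend (\<not> b) xs = []" for b
    proof -
      obtain t where t: "mset (map snd (codewords t)) = mset (map snd (descend b xs))"
        and "tree_cost (codewords t) < tree_cost (descend b xs) \<or>
          mset (codewords t) = mset (descend b xs)"
        using IH[OF ne] by blast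
      then have c: "tree_cost (codewords t) \<le> tree_cost (descend b xs)"
        using tree_cost_mset[of "codewords t" "descend b xs"] by auto
      have "mset (map snd (codewords t)) = mset (map snd xs)" using t ms e by (cases b) auto
      moreover have "tree_cost xs = tree_cost (descend b xs) + sum_list (map snd (descend b xs))"
        using cost e by (cases b) (auto simp: tree_cost_def)
      ultimately show ?thesis using c sumpos[OF ne] by (intro exI[of _ t]) simp
    qed
    show ?thesis
    proof (cases "?A = [] \<or> ?B = []")
      case True
      then show ?thesis using single[of True] single[of False] ne by auto
    next
      case F: False
      obtain l where l: "mset (map snd (codewords l)) = mset (map snd ?A)"
        "tree_cost (codewords l) < tree_cost ?A \<or> mset (codewords l) = mset ?A"
        using IH[of False] F by blast
      obtain r where r: "mset (map snd (codewords r)) = mset (map snd ?B)"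
        "tree_cost (codewords r) < tree_cost ?B \<or> mset (codewords r) = mset ?B"
        using IH[of True] F by blast
      have "mset (map snd (codewords (Nd l r))) = mset (map snd xs)"
        using l(1) r(1) ms by (simp add: image_mset.compositionality comp_def)
      moreover have "tree_cost (codewords (Nd l r)) < tree_cost xs \<or> mset (codewords (Nd l r)) = mset xs"
      proof (cases "mset (codewords l) = mset ?A \<and> mset (codewords r) = mset ?B")
        case True
        then show ?thesis unfolding m by simp
      next
        case F: False
        have "sum_list (map snd (codewords l)) = sum_list (map snd ?A)"
          using l(1) by (metis sum_mset_sum_list)
        moreover have "sum_list (map snd (codewords r)) = sum_list (map snd ?B)"
          using r(1) by (metis sum_mset_sum_list)
        ultimately have "tree_cost (codewords (Nd l r)) = tree_cost (codewords l) + sum_list (map snd ?A)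
           + (tree_cost (codewords r) + sum_list (map snd ?B))"
          by (simp add: tree_cost_append tree_cost_Cons)
        then show ?thesis using cost F l(2) r(2) tree_cost_mset[of "codewords l" ?A]
          tree_cost_mset[of "codewords r" ?B] by force
      qed
      ultimately show ?thesis by blast
    qed
  qed
qed

text \<open>Used to arrange the codewords of a tree so that their weights appear exactly in the
  input order.\<close>

lemma mset_map_eq_ex:
  "mset (map f ys) = mset zs \<Longrightarrow> \<exists>xs. mset xs = mset ys \<and> map f xs = zs"
proof (induction zs arbitrary: ys)
  case (Cons z zs)
  have "set (map f ys) = set (z # zs)" using mset_eq_setD[OF Cons.prems] .
  then have "z \<in> set (map f ys)" by simp
  then obtain y where y: "y \<in> set ys" "f y = z" by auto
  then have "mset ys = mset (y # remove1 y ys)" by simp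
  then have "image_mset f (mset ys) = image_mset f (mset (y # remove1 y ys))" by (rule arg_cong)
  then have "mset (map f ys) = add_mset z (mset (map f (remove1 y ys)))"
    unfolding mset_map using y(2) by simp
  then have "mset (map f (remove1 y ys)) = mset zs"
    using Cons.prems by simp
  from Cons.IH[OF this] obtain xs where "mset xs = mset (remove1 y ys)" "map f xs = zs" by blast
  then have "mset (y # xs) = mset ys" "map f (y # xs) = z # zs" using y by auto
  then show ?case by (intro exI[of _ "y # xs"] conjI)
qed simp

text \<open>Reduces optimality among all prefix-free codes to lexicographic optimality among full
  trees, because every code is either the code of a full tree or strictly more expensive than
  one.\<close>

theorem optimal_skeleton_treeI:
  assumes ne: "ws \<noteq> []" and pos: "\<forall>w\<in>set ws. w > 0"
    and t: "mset (map snd (codewords t)) = mset ws"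
    and opt: "\<And>t'. mset (map snd (codewords t')) = mset ws \<Longrightarrow>
      tree_cost (codewords t) < tree_cost (codewords t') \<or>
      tree_cost (codewords t) = tree_cost (codewords t') \<and>
      sleaves (shrink t) \<le> sleaves (shrink t')"
  shows "optimal_skeleton_tree ws (snodes (shrink t), slabel (shrink t))"
proof -
  obtain xs where xs: "mset xs = mset (codewords t)" "map snd xs = ws"
    using mset_map_eq_ex[OF t] by blast
  let ?cs = "map fst xs"
  have skel: "skeleton (code_tree ws ?cs) = (snodes (shrink t), slabel (shrink t))"
    using skeleton_code_tree[OF xs(1)] xs(2) by simp
  have code: "code_for ws ?cs" unfolding code_for_def
    using prefix_free_codewords[OF xs(1)] xs(2) by auto
  have cost: "code_cost ws ?cs = tree_cost (codewords t)"
    using code_cost_eq[of xs] xs(2) tree_cost_mset[OF xs(1)] by simp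
  have other: "\<exists>t' ys. ys = zip cs ws \<and> mset (map snd (codewords t')) = mset ws \<and>
      (tree_cost (codewords t') < code_cost ws cs \<or>
       tree_cost (codewords t') = code_cost ws cs \<and> mset (codewords t') = mset ys)"
    if c: "code_for ws cs" for cs
  proof -
    let ?ys = "zip cs ws"
    have l: "length cs = length ws" using c by (simp add: code_for_def)
    then have "prefix_free (map fst ?ys)" "?ys \<noteq> []" "\<forall>x\<in>set ?ys. snd x > 0" "map snd ?ys = ws"
      "map fst ?ys = cs"
      using c ne pos by (auto simp: code_for_def dest: set_zip_rightD)
    note ys = this
    then have cc: "code_cost ws cs = tree_cost ?ys" using code_cost_eq[of ?ys] by simp
    obtain t' where t': "mset (map snd (codewords t')) = mset (map snd ?ys)"
      "tree_cost (codewords t') < tree_cost ?ys \<or> mset (codewords t') = mset ?ys"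
      using full_tree_of_code[OF ys(1-3)] by blast
    then have "tree_cost (codewords t') < tree_cost ?ys \<or>
      tree_cost (codewords t') = tree_cost ?ys \<and> mset (codewords t') = mset ?ys"
      using tree_cost_mset[of "codewords t'" ?ys] by blast
    moreover have "mset (map snd (codewords t')) = mset ws" using t'(1) ys(4) by simp
    ultimately show ?thesis unfolding cc by blast
  qed
  have best: "code_cost ws ?cs \<le> code_cost ws cs" if cf: "code_for ws cs" for cs
  proof -
    obtain t' where "mset (map snd (codewords t')) = mset ws"
       "tree_cost (codewords t') \<le> code_cost ws cs"
      using other[OF cf] by (metis order.order_iff_strict)
    then show ?thesis using opt[of t'] unfolding cost by linarith
  qed
  then have oc: "optimal_code ws ?cs" using code by (simp add: optimal_code_def)
  have "num_nodes (snodes (shrink t), slabel (shrink t)) \<le> num_nodes (skeleton (code_tree ws cs))"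
    if o: "optimal_code ws cs" for cs
  proof -
    have c: "code_for ws cs" and l: "code_cost ws cs \<le> code_cost ws ?cs"
      using o code by (auto simp: optimal_code_def)
    obtain t' where t': "mset (map snd (codewords t')) = mset ws"
       "tree_cost (codewords t') < code_cost ws cs \<or>
       tree_cost (codewords t') = code_cost ws cs \<and> mset (codewords t') = mset (zip cs ws)"
      using other[OF c] by blast
    \<comment> \<open>An optimal code cannot cost more than its contraction \<open>t'\<close>, so it
      consists of exactly the codewords of \<open>t'\<close>.\<close>
    then have eq: "mset (codewords t') = mset (zip cs ws)" and le: "sleaves (shrink t) \<le> sleaves (shrink t')"
      using opt[OF t'(1)] l unfolding cost by argo+
    have "length cs = length ws" using c by (simp add: code_for_def)
    then have "skeleton (code_tree ws cs) = (snodes (shrink t'), slabel (shrink t'))"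
      using skeleton_code_tree[OF eq[symmetric]] by simp
    then show ?thesis using le by (simp add: num_nodes_def card_snodes)
  qed
  then show ?thesis unfolding optimal_skeleton_tree_def using oc skel[symmetric] by blast
qed

section \<open>Numbers of leaves per level\<close>

fun popcount :: "nat \<Rightarrow> nat" where
  "popcount n = (if n = 0 then 0 else n mod 2 + popcount (n div 2))"

declare popcount.simps [simp del]

lemma popcount_0 [simp]: "popcount 0 = 0"
  by (simp add: popcount.simps)

lemma popcount_rec: "popcount n = n mod 2 + popcount (n div 2)"
  by (cases "n = 0") (simp_all add: popcount.simps[of n])

lemma popcount_1 [simp]: "popcount (Suc 0) = 1"
  by (subst popcount_rec) simp

lemma popcount_power2: "popcount (2 ^ k) = 1"
proof (induction k)
  case 0
  then show ?case by simp
next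
  case (Suc k)
  then show ?case by (subst popcount_rec) simp
qed

lemma popcount_le: "popcount n \<le> n"
proof (induction n rule: less_induct)
  case (less n)
  show ?case
  proof (cases "n = 0")
    case False
    then have "popcount (n div 2) \<le> n div 2" by (intro less) simp
    then show ?thesis by (subst popcount_rec) (use False in presburger)
  qed simp
qed

lemma popcount_add_power2: "z < 2 ^ k \<Longrightarrow> popcount (z + 2 ^ k) = popcount z + 1"
proof (induction k arbitrary: z)
  case 0
  then show ?case using popcount_power2[of 0] by simp
next
  case (Suc k)
  have 1: "(z + 2 ^ Suc k) mod 2 = z mod 2" by (simp add: mod_add_eq[symmetric, of z])
  have 2: "(z + 2 ^ Suc k) div 2 = z div 2 + 2 ^ k" by simp
  have "z div 2 < 2 ^ k" using Suc.prems by simp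
  from Suc.IH[OF this] show ?case
    using popcount_rec[of "z + 2 ^ Suc k"] popcount_rec[of z] unfolding 1 2 by linarith
qed

text \<open>The carry \<open>c\<close> is what makes the induction over binary digits go through;
  subadditivity of \<open>popcount\<close> is the case \<open>c = 0\<close>.\<close>

lemma popcount_add_carry_le: "c \<le> 1 \<Longrightarrow> popcount (a + b + c) \<le> popcount a + popcount b + c"
proof (induction "a + b" arbitrary: a b c rule: less_induct)
  case less
  show ?case
  proof (cases "a + b = 0")
    case True
    then show ?thesis using popcount_le[of c] by simp
  next
    case False
    let ?x = "a mod 2 + b mod 2 + c"
    define c' where "c' = ?x div 2"
    have e: "a + b + c = ?x + (a div 2 + b div 2) * 2" by simp
    have d: "(a + b + c) div 2 = a div 2 + b div 2 + c'"
      unfolding e c'_def by (rule div_mult_self1) simp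
    have m: "(a + b + c) mod 2 + 2 * c' = ?x"
      unfolding e mod_mult_self1 c'_def by (rule mod_mult_div_eq)
    have c': "c' \<le> 1" using less.prems unfolding c'_def by linarith
    have "popcount (a div 2 + b div 2 + c') \<le> popcount (a div 2) + popcount (b div 2) + c'"
      using False c' by (intro less) linarith+
    then show ?thesis
      using popcount_rec[of a] popcount_rec[of b] popcount_rec[of "a + b + c"] m unfolding d by linarith
  qed
qed

lemma popcount_add_le: "popcount (a + b) \<le> popcount a + popcount b"
  using popcount_add_carry_le[of 0 a b] by simp

section \<open>Level counts of a tree and Kraft's equality\<close>

primrec leaves_at :: "ctree \<Rightarrow> nat \<Rightarrow> nat" where
  "leaves_at (Lf w) d = (if d = 0 then 1 else 0)"
| "leaves_at (Nd l r) d = (case d of 0 \<Rightarrow> 0 | Suc e \<Rightarrow> leaves_at l e + leaves_at r e)"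

primrec inner_at :: "ctree \<Rightarrow> nat \<Rightarrow> nat" where
  "inner_at (Lf w) d = 0"
| "inner_at (Nd l r) d = (case d of 0 \<Rightarrow> 1 | Suc e \<Rightarrow> inner_at l e + inner_at r e)"

lemma nodes_at_0: "leaves_at t 0 + inner_at t 0 = 1"
  by (cases t) auto

lemma nodes_at_Suc: "leaves_at t (Suc d) + inner_at t (Suc d) = 2 * inner_at t d"
proof (induction t arbitrary: d)
  case (Nd l r)
  show ?case
  proof (cases d)
    case 0
    then show ?thesis using nodes_at_0[of l] nodes_at_0[of r] by simp
  next
    case (Suc e)
    then show ?thesis using Nd.IH(1)[of e] Nd.IH(2)[of e] by simp
  qed
qed simp

lemma inner_at_pos_iff: "inner_at t d > 0 \<longleftrightarrow> d < height t"
proof (induction t arbitrary: d)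
  case (Nd l r)
  show ?case
  proof (cases d)
    case (Suc e)
    have "inner_at (Nd l r) d > 0 \<longleftrightarrow> inner_at l e > 0 \<or> inner_at r e > 0" using Suc by simp
    also have "\<dots> \<longleftrightarrow> d < height (Nd l r)"
      unfolding Nd Suc by (simp add: less_max_iff_disj)
    finally show ?thesis .
  qed simp
qed simp

text \<open>Kraft's equality for the tree truncated below depth \<open>d\<close>. It is the origin
  of the expression \<open>J + 1 - 2 * I\<close> for the number of leaves of depth at most
  \<open>d\<close>.\<close>

lemma leaves_upto: "(\<Sum>e\<le>d. leaves_at t e) + 2 * inner_at t d = (\<Sum>e\<le>d. inner_at t e) + 1"
proof (induction d)
  case 0
  then show ?case using nodes_at_0[of t] by simp
next
  case (Suc d)
  then show ?case using nodes_at_Suc[of t d] by simp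
qed

lemma leaves_at_eq: "leaves_at t d = length (filter (\<lambda>x. length (fst x) = d) (codewords t))"
proof (induction t arbitrary: d)
  case (Nd l r)
  have "length (filter (\<lambda>x. length (fst x) = d) (map (apfst ((#) b)) xs)) =
     (case d of 0 \<Rightarrow> 0 | Suc e \<Rightarrow> length (filter (\<lambda>x. length (fst x) = e) xs))"
    for b and xs :: "(node \<times> real) list"
    by (induction xs) (auto split: nat.splits)
  then show ?case using Nd by (auto split: nat.splits)
qed simp

lemma length_codeword_le: "x \<in> set (codewords t) \<Longrightarrow> length (fst x) \<le> height t"
  by (induction t arbitrary: x) (auto simp: le_max_iff_disj)

lemma leaves_upto_eq:
  "(\<Sum>e\<le>d. leaves_at t e) = length (filter (\<lambda>x. length (fst x) \<le> d) (codewords t))"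
proof (induction d)
  case 0
  then show ?case by (simp add: leaves_at_eq)
next
  case (Suc d)
  have "length (filter (\<lambda>x. length (fst x) \<le> Suc d) xs) =
    length (filter (\<lambda>x. length (fst x) \<le> d) xs) + length (filter (\<lambda>x. length (fst x) = Suc d) xs)"
    for xs :: "(node \<times> real) list"
    by (induction xs) auto
  then show ?case using Suc by (simp add: leaves_at_eq)
qed

lemma leaves_at_balanced:
  "balanced t \<Longrightarrow> leaves_at t d = (if d = height t then 2 ^ height t else 0)"
  by (induction t arbitrary: d) (auto split: nat.splits)

text \<open>A balanced tree has a single nonempty leaf level, of size a power of two, so the sum is
  at most 1. Otherwise the skeleton splits at the root, and subadditivity of \<open>popcount\<close>
  applies level by level, shifted by one.\<close>

lemma popcount_le_sleaves: "(\<Sum>d<D. popcount (leaves_at t d)) \<le> sleaves (shrink t)"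
proof (induction t arbitrary: D)
  case (Lf w)
  then show ?case by (cases D) (auto simp: sum.lessThan_Suc_shift simp del: sum.lessThan_Suc)
next
  case (Nd l r)
  show ?case
  proof (cases "balanced (Nd l r)")
    case True
    then show ?thesis unfolding leaves_at_balanced[OF True]
      by (simp add: if_distrib[of popcount] popcount_power2 del: power.simps cong: if_cong)
  next
    case False
    have "(\<Sum>d<D. popcount (leaves_at (Nd l r) d)) \<le> (\<Sum>d<D - 1. popcount (leaves_at l d) + popcount (leaves_at r d))"
    proof (cases D)
      case (Suc E)
      then show ?thesis unfolding Suc sum.lessThan_Suc_shift
        by (auto intro!: sum_mono popcount_add_le)
    qed simp
    also have "\<dots> \<le> sleaves (shrink l) + sleaves (shrink r)"
      unfolding sum.distrib using Nd by (intro add_mono)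
    also have "\<dots> = sleaves (shrink (Nd l r))"
      unfolding shrink.simps if_not_P[OF False] by simp
    finally show ?thesis .
  qed
qed

text \<open>A state is given by the number \<open>J\<close> of internal nodes of depth at most \<open>d\<close> and the number
  \<open>I\<close> of internal nodes of depth exactly \<open>d\<close>; then \<open>J + 1 - 2 I\<close> leaves have depth at most \<open>d\<close>.
  The list contains the numbers of leaves of depth \<open>d + 1, d + 2, \<dots>\<close>.\<close>

fun profile :: "nat \<Rightarrow> nat \<Rightarrow> nat \<Rightarrow> nat list \<Rightarrow> bool" where
  "profile n J I [] \<longleftrightarrow> I = 0 \<and> J + 1 = n"
| "profile n J I (c # cs) \<longleftrightarrow> 0 < I \<and> c \<le> 2 * I \<and> profile n (J + (2 * I - c)) (2 * I - c) cs"

definition tail_sum :: "real list \<Rightarrow> nat \<Rightarrow> real" where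
  "tail_sum sw i = sum_list (drop i sw)"

text \<open>Charges one unit of depth at a time: every leaf deeper than the current level pays its
  weight once. If \<open>sw\<close> is decreasing and the heaviest weights sit highest, the weights
  still to pay form the tail after the first \<open>J + 1 - 2 * I\<close> entries.\<close>

fun profile_cost :: "real list \<Rightarrow> nat \<Rightarrow> nat \<Rightarrow> nat list \<Rightarrow> real" where
  "profile_cost sw J I [] = 0"
| "profile_cost sw J I (c # cs) =
     tail_sum sw (J + 1 - 2 * I) + profile_cost sw (J + (2 * I - c)) (2 * I - c) cs"

definition popcounts :: "nat list \<Rightarrow> nat" where
  "popcounts cs = sum_list (map popcount cs)"

lemma popcounts_simps [simp]: "popcounts [] = 0" "popcounts (c # cs) = popcount c + popcounts cs"
  by (simp_all add: popcounts_def)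

section \<open>The profile of a given tree and the lower bound it yields\<close>

lemma leaves_at_Suc: "2 * inner_at t d - leaves_at t (Suc d) = inner_at t (Suc d)"
  using nodes_at_Suc[of t d] by simp

lemma sum_inner_upto:
  assumes "height t \<le> Suc d" shows "(\<Sum>e\<le>d. inner_at t e) + 1 = length (codewords t)"
proof -
  have "inner_at t (Suc d) = 0" using assms inner_at_pos_iff[of t "Suc d"] by simp
  moreover have "(\<Sum>e\<le>Suc d. leaves_at t e) = length (codewords t)"
  proof -
    have "filter (\<lambda>x. length (fst x) \<le> Suc d) (codewords t) = codewords t"
      using length_codeword_le assms by (intro filter_True) (meson le_trans)
    then show ?thesis unfolding leaves_upto_eq by simp
  qed
  ultimately show ?thesis using leaves_upto[of t "Suc d"] by simp
qed

lemma profile_of_levels: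
  assumes "d \<le> height t"
  shows "profile (length (codewords t)) (\<Sum>e\<le>d. inner_at t e) (inner_at t d)
    (map (leaves_at t) [Suc d..<Suc (height t)])"
  using assms
proof (induction rule: inc_induct)
  case base
  show ?case using sum_inner_upto[of t "height t"] inner_at_pos_iff[of t "height t"] by simp
next
  case (step d)
  then have "[Suc d..<Suc (height t)] = Suc d # [Suc (Suc d)..<Suc (height t)]"
    by (simp add: upt_rec)
  moreover have "leaves_at t (Suc d) \<le> 2 * inner_at t d" using nodes_at_Suc[of t d] by simp
  ultimately show ?case
    using step inner_at_pos_iff[of t d] by (simp add: leaves_at_Suc del: upt_Suc)
qed

lemma profile_cost_of_levels:
  assumes "d \<le> height t"
  shows "profile_cost sw (\<Sum>e\<le>d. inner_at t e) (inner_at t d)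
    (map (leaves_at t) [Suc d..<Suc (height t)]) =
    (\<Sum>k=d..<height t. tail_sum sw (\<Sum>e\<le>k. leaves_at t e))"
  using assms
proof (induction rule: inc_induct)
  case base
  show ?case by simp
next
  case (step d)
  then have "[Suc d..<Suc (height t)] = Suc d # [Suc (Suc d)..<Suc (height t)]"
    by (simp add: upt_rec)
  moreover have "(\<Sum>e\<le>d. inner_at t e) + 1 - 2 * inner_at t d = (\<Sum>e\<le>d. leaves_at t e)"
    using leaves_upto[of t d] by simp
  ultimately show ?case
    using step by (simp add: leaves_at_Suc sum.atLeast_Suc_lessThan[of d "height t"] del: upt_Suc)
qed

text \<open>Induction removes the last, hence smallest, weight \<open>x\<close>. The multiset gives
  up \<open>x\<close> itself if it contains it and otherwise an arbitrary element, which is at least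
  \<open>x\<close>.\<close>

lemma tail_sum_le_submultiset:
  assumes "sorted_wrt (\<ge>) sw" "M \<subseteq># mset sw"
  shows "tail_sum sw (length sw - size M) \<le> sum_mset M"
  using assms
proof (induction sw arbitrary: M rule: rev_induct)
  case Nil
  then show ?case by (simp add: tail_sum_def)
next
  case (snoc x xs)
  have sorted: "sorted_wrt (\<ge>) xs" and x: "\<And>y. y \<in> set xs \<Longrightarrow> x \<le> y"
    using snoc.prems(1) by (auto simp: sorted_wrt_append)
  have sub: "M \<subseteq># add_mset x (mset xs)" using snoc.prems(2) by simp
  show ?case
  proof (cases "M = {#}")
    case True
    then show ?thesis by (simp add: tail_sum_def)
  next
    case False
    obtain y where y: "y \<in># M" "x \<le> y" "M - {#y#} \<subseteq># mset xs"
    proof (cases "x \<in># M")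
      case True
      show ?thesis
        by (rule that[of x]) (use True sub in \<open>auto simp: subset_eq_diff_conv\<close>)
    next
      case F: False
      obtain y where yM: "y \<in># M" using False by blast
      have "M \<subseteq># mset xs" using sub F by (metis diff_single_trivial subset_eq_diff_conv add_mset_add_single)
      moreover from this have "y \<in> set xs" using yM by (metis mset_subset_eqD set_mset_mset)
      ultimately show ?thesis using that[of y] yM x by (meson diff_subset_eq_self subset_mset.order_trans)
    qed
    let ?m = "size (M - {#y#})"
    have m: "size M = Suc ?m" using y(1) by (metis size_Suc_Diff1)
    have "?m \<le> length xs" using size_mset_mono[OF y(3)] by simp
    then have "tail_sum (xs @ [x]) (length (xs @ [x]) - size M) = tail_sum xs (length xs - ?m) + x"
      unfolding m by (simp add: tail_sum_def)
    also have "\<dots> \<le> sum_mset (M - {#y#}) + y" using snoc.IH[OF sorted y(3)] y(2) by simp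
    also have "\<dots> = sum_mset M" using y(1) by (metis add.commute insert_DiffM sum_mset.add_mset)
    finally show ?thesis .
  qed
qed

text \<open>Exchanges the order of summation: a leaf of depth \<open>l\<close> is counted once for
  each \<open>k < l\<close>.\<close>

lemma tree_cost_by_levels:
  "(\<And>x. x \<in> set xs \<Longrightarrow> length (fst x) \<le> h) \<Longrightarrow>
    tree_cost xs = (\<Sum>k<h. sum_list (map snd (filter (\<lambda>x. \<not> length (fst x) \<le> k) xs)))"
proof (induction xs)
  case Nil
  then show ?case by (simp add: tree_cost_def)
next
  case (Cons x xs)
  obtain v w where x: "x = (v, w)" by fastforce
  have v: "length v \<le> h" using Cons.prems[of x] x by simp
  have "sum_list (map snd (filter (\<lambda>x. \<not> length (fst x) \<le> k) (x # xs))) =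
    (if k < length v then w else 0) + sum_list (map snd (filter (\<lambda>x. \<not> length (fst x) \<le> k) xs))" for k
    using x by simp
  moreover have "(\<Sum>k<h. if k < length v then w else 0) = real (length v) * w"
  proof -
    have "{..<h} \<inter> {k. k < length v} = {..<length v}" using v by auto
    then show ?thesis by (simp add: sum.If_cases)
  qed
  moreover have "tree_cost (x # xs) = real (length v) * w + tree_cost xs"
    by (simp add: x tree_cost_def)
  ultimately show ?case using Cons by (simp only: sum.distrib) simp
qed

text \<open>The witness is the sequence of level counts of \<open>t\<close> itself. That a single
  profile satisfies both inequalities is what makes the lexicographic comparison possible.\<close>

theorem profile_lower_bound:
  assumes "sorted_wrt (\<ge>) sw" "mset (map snd (codewords t)) = mset sw" "length sw \<ge> 2"
  shows "\<exists>cs. profile (length sw) 1 1 cs \<and> profile_cost sw 1 1 cs \<le> tree_cost (codewords t) \<and>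
    popcounts cs \<le> sleaves (shrink t)"
proof -
  let ?cs = "map (leaves_at t) [1..<Suc (height t)]"
  have len: "length (codewords t) = length sw" using assms(2) by (metis length_map size_mset)
  \<comment> \<open>With at least two weights the root is an inner node, which gives the start state
    \<open>J = 1\<close>, \<open>I = 1\<close>.\<close>
  have i0: "inner_at t 0 = 1" using len assms(3) by (cases t) auto
  have "profile (length sw) 1 1 ?cs" using profile_of_levels[of 0 t] i0 len by simp
  moreover have "profile_cost sw 1 1 ?cs \<le> tree_cost (codewords t)"
  proof -
    have "profile_cost sw 1 1 ?cs = (\<Sum>k<height t. tail_sum sw (\<Sum>e\<le>k. leaves_at t e))"
      using profile_cost_of_levels[of 0 t sw] i0 by (simp add: atLeast0LessThan)
    also have "\<dots> \<le> (\<Sum>k<height t. sum_list (map snd (filter (\<lambda>x. \<not> length (fst x) \<le> k) (codewords t))))"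
    proof (rule sum_mono)
      fix k
      let ?M = "mset (map snd (filter (\<lambda>x. \<not> length (fst x) \<le> k) (codewords t)))"
      have "?M \<subseteq># mset sw"
        unfolding assms(2)[symmetric] by (simp add: image_mset_subseteq_mono)
      then have "tail_sum sw (length sw - size ?M) \<le> sum_mset ?M"
        by (rule tail_sum_le_submultiset[OF assms(1)])
      moreover have "length sw - size ?M = (\<Sum>e\<le>k. leaves_at t e)"
        unfolding leaves_upto_eq len[symmetric] size_mset length_map
        using sum_length_filter_compl[of "\<lambda>x. length (fst x) \<le> k" "codewords t"] by linarith
      ultimately show "tail_sum sw (\<Sum>e\<le>k. leaves_at t e) \<le>
        sum_list (map snd (filter (\<lambda>x. \<not> length (fst x) \<le> k) (codewords t)))"
        by (simp only: sum_mset_sum_list)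
    qed
    also have "\<dots> = tree_cost (codewords t)"
      using tree_cost_by_levels[of "codewords t" "height t"] length_codeword_le by simp
    finally show ?thesis .
  qed
  moreover have "popcounts ?cs \<le> sleaves (shrink t)"
  proof -
    have "leaves_at t 0 = 0" using nodes_at_0[of t] i0 by simp
    then have "popcounts ?cs = (\<Sum>d<Suc (height t). popcount (leaves_at t d))"
      unfolding popcounts_def sum.lessThan_Suc_shift
      by (simp add: interv_sum_list_conv_sum_set_nat comp_def sum.shift_bounds_Suc_ivl atLeast0LessThan
          del: upt_Suc sum.op_ivl_Suc)
    also have "\<dots> \<le> sleaves (shrink t)" by (rule popcount_le_sleaves)
    finally show ?thesis .
  qed
  ultimately show ?thesis by blast
qed

section \<open>Lexicographic optima of profiles and their recurrence\<close>

definition lex_le :: "real \<Rightarrow> nat \<Rightarrow> real \<Rightarrow> nat \<Rightarrow> bool" where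
  "lex_le a j b k \<longleftrightarrow> a < b \<or> a = b \<and> j \<le> k"

lemma lex_le_refl: "lex_le a j a j"
  by (simp add: lex_le_def)

lemma lex_le_trans: "lex_le a j b k \<Longrightarrow> lex_le b k c l \<Longrightarrow> lex_le a j c l"
  by (auto simp: lex_le_def)

definition optimal_profile :: "real list \<Rightarrow> nat \<Rightarrow> nat \<Rightarrow> nat list \<Rightarrow> bool" where
  "optimal_profile sw J I cs \<longleftrightarrow> profile (length sw) J I cs \<and>
     (\<forall>cs'. profile (length sw) J I cs' \<longrightarrow>
        lex_le (profile_cost sw J I cs) (popcounts cs) (profile_cost sw J I cs') (popcounts cs'))"

lemma optimal_profile_0 [simp]: "optimal_profile sw J 0 cs \<longleftrightarrow> cs = [] \<and> J + 1 = length sw"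
proof -
  have "profile (length sw) J 0 cs' \<longleftrightarrow> cs' = [] \<and> J + 1 = length sw" for cs'
    by (cases cs') auto
  note p0 = this
  show ?thesis unfolding optimal_profile_def p0 using lex_le_refl by blast
qed

text \<open>The values \<open>y\<close> for which the state \<open>(J + y, y)\<close> can still be
  completed: without inner nodes on the next level the tree must be finished, and otherwise the
  number of inner nodes must not exceed \<open>n - 1\<close>.\<close>

definition successor :: "nat \<Rightarrow> nat \<Rightarrow> nat \<Rightarrow> bool" where
  "successor n J y \<longleftrightarrow> (if y = 0 then J + 1 = n else J + y < n)"

lemma profile_successor: "profile n J I cs \<Longrightarrow> I \<le> J \<Longrightarrow> J < n \<and> (I = 0 \<longrightarrow> J + 1 = n)"
  by (induction n J I cs rule: profile.induct) auto

text \<open>Bellman's principle. The existence assumption is used to compare an arbitrary competitor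
  first with an optimal continuation of its own next state, and only then with the chosen
  one.\<close>

lemma optimal_profile_Cons:
  assumes "0 < I" "y \<le> 2 * I" "optimal_profile sw (J + y) y cs"
    and best: "\<And>y' cs'. y' \<le> 2 * I \<Longrightarrow> successor (length sw) J y' \<Longrightarrow> 
      optimal_profile sw (J + y') y' cs' \<Longrightarrow> 
      lex_le (profile_cost sw (J + y) y cs) (popcounts cs + popcount (2 * I - y))
        (profile_cost sw (J + y') y' cs') (popcounts cs' + popcount (2 * I - y'))"
    and ex: "\<And>y'. successor (length sw) J y' \<Longrightarrow> \<exists>cs'. optimal_profile sw (J + y') y' cs'"
  shows "optimal_profile sw J I ((2 * I - y) # cs)"
  unfolding optimal_profile_def
proof (intro conjI allI impI)
  have e: "2 * I - (2 * I - y) = y" using assms(2) by simp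
  show "profile (length sw) J I ((2 * I - y) # cs)"
    using assms(1,3) e by (simp add: optimal_profile_def)
  fix ds assume "profile (length sw) J I ds"
  then obtain c cs' where ds: "ds = c # cs'" and c: "c \<le> 2 * I"
    and p: "profile (length sw) (J + (2 * I - c)) (2 * I - c) cs'"
    using assms(1) by (cases ds) auto
  let ?y' = "2 * I - c"
  have succ: "successor (length sw) J ?y'" using profile_successor[OF p] by (auto simp: successor_def)
  obtain cs'' where o: "optimal_profile sw (J + ?y') ?y' cs''" using ex[OF succ] by blast
  have 1: "lex_le (profile_cost sw (J + y) y cs) (popcounts cs + popcount (2 * I - y))
        (profile_cost sw (J + ?y') ?y' cs'') (popcounts cs'' + popcount (2 * I - ?y'))"
    by (rule best[OF _ succ o]) simp
  have 2: "lex_le (profile_cost sw (J + ?y') ?y' cs'') (popcounts cs'')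
     (profile_cost sw (J + ?y') ?y' cs') (popcounts cs')"
    using o p by (simp add: optimal_profile_def)
  have c': "2 * I - ?y' = c" using c by simp
  show "lex_le (profile_cost sw J I ((2 * I - y) # cs)) (popcounts ((2 * I - y) # cs))
           (profile_cost sw J I ds) (popcounts ds)"
    using 1 2 unfolding ds by (auto simp: e c' lex_le_def)
qed

text \<open>The table records only the next choice, so reading it off may follow a different optimal
  tail than the one whose existence justified the entry. Any optimal tail is as good as
  another.\<close>

lemma optimal_profile_cong:
  assumes "optimal_profile sw J I (c # cs)" "optimal_profile sw (J + (2 * I - c)) (2 * I - c) cs'"
  shows "optimal_profile sw J I (c # cs')"
proof -
  let ?J = "J + (2 * I - c)" and ?I = "2 * I - c"
  have p: "0 < I" "c \<le> 2 * I" "profile (length sw) ?J ?I cs"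
    using assms(1) by (auto simp: optimal_profile_def)
  have "lex_le (profile_cost sw ?J ?I cs') (popcounts cs') (profile_cost sw ?J ?I cs) (popcounts cs)"
    using assms(2) p(3) unfolding optimal_profile_def by blast
  then have "lex_le (profile_cost sw J I (c # cs')) (popcounts (c # cs'))
      (profile_cost sw J I (c # cs)) (popcounts (c # cs))"
    unfolding profile_cost.simps popcounts_simps lex_le_def by linarith
  moreover have "lex_le (profile_cost sw J I (c # cs)) (popcounts (c # cs)) (profile_cost sw J I ds) (popcounts ds)"
    if "profile (length sw) J I ds" for ds
    using assms(1) that unfolding optimal_profile_def by blast
  moreover have "profile (length sw) J I (c # cs')"
    using assms(2) p unfolding optimal_profile_def profile.simps by blast
  ultimately show ?thesis unfolding optimal_profile_def using lex_le_trans by blast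
qed

lemma optimal_profile_unique:
  assumes "optimal_profile sw J I cs" "optimal_profile sw J I cs'"
  shows "profile_cost sw J I cs = profile_cost sw J I cs'" "popcounts cs = popcounts cs'"
  using assms by (force simp: optimal_profile_def lex_le_def)+

text \<open>After \<open>b\<close> rounds the table entry for \<open>y\<close> is the lexicographically best value among the
  successors \<open>x\<close> with \<open>y - x < 2 ^ b\<close>; the count 0 marks the absence of such a successor.\<close>

definition conv_entry ::
  "(nat \<Rightarrow> bool) \<Rightarrow> (nat \<Rightarrow> real) \<Rightarrow> (nat \<Rightarrow> nat) \<Rightarrow> nat \<Rightarrow> nat \<Rightarrow> real \<Rightarrow> nat \<Rightarrow> nat \<Rightarrow> bool" where
  "conv_entry S f m b y a k x \<longleftrightarrow>
     (if k = 0 then (\<forall>x'\<le>y. S x' \<longrightarrow> \<not> y - x' < 2 ^ b)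
      else S x \<and> x \<le> y \<and> y - x < 2 ^ b \<and> a = f x \<and> k = m x + popcount (y - x) \<and>
        (\<forall>x'\<le>y. S x' \<longrightarrow> y - x' < 2 ^ b \<longrightarrow> lex_le a k (f x') (m x' + popcount (y - x'))))"

section \<open>Rounds of the bitwise convolution\<close>

lemma conv_entry_0:
  assumes "\<And>x. S x \<Longrightarrow> m x > 0"
  shows "conv_entry S f m 0 y (f y) (if S y then m y else 0) y"
  using assms[of y] by (auto simp: conv_entry_def lex_le_def)

text \<open>Below \<open>2 ^ b\<close> every candidate already lies in the old window, so round
  \<open>b\<close> has nothing to do there.\<close>

lemma conv_entry_small:
  assumes "conv_entry S f m b y a k x" "y < 2 ^ b"
  shows "conv_entry S f m (Suc b) y a k x"
proof -
  have "y - x' < 2 ^ b \<and> y - x' < 2 ^ Suc b" for x'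
    unfolding power_Suc using assms(2) by linarith
  then show ?thesis using assms(1) unfolding conv_entry_def by auto
qed

text \<open>Candidates in the enlarged window either lie in the old one or have bit \<open>b\<close>
  set in their distance to \<open>y\<close>; the latter are the candidates seen from
  \<open>y - 2 ^ b\<close>, each with one more bit to pay. The condition is phrased with strict
  comparisons, the only ones the machine has for weights.\<close>

lemma conv_entry_Suc:
  assumes 1: "conv_entry S f m b y a k x" and 2: "conv_entry S f m b (y - 2 ^ b) a' k' x'"
    and y: "2 ^ b \<le> y"
  shows "if k' \<noteq> 0 \<and> (k = 0 \<or> a' < a \<or> \<not> a < a' \<and> k' + 1 < k)
    then conv_entry S f m (Suc b) y a' (k' + 1) x' else conv_entry S f m (Suc b) y a k x"
proof -
  \<comment> \<open>Beyond the old window bit \<open>b\<close> of the distance is set; clearing it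
    gives the distance from \<open>y - 2 ^ b\<close>.\<close>
  have far: "popcount (y - z) = popcount (y - 2 ^ b - z) + 1 \<and> z \<le> y - 2 ^ b \<and> y - 2 ^ b - z < 2 ^ b" 
    if "\<not> y - z < 2 ^ b" "y - z < 2 ^ Suc b" "z \<le> y" for z
  proof -
    have "y - z = (y - 2 ^ b - z) + 2 ^ b" using that y by simp
    moreover have "y - 2 ^ b - z < 2 ^ b" using that y by simp
    ultimately show ?thesis using popcount_add_power2[of "y - 2 ^ b - z" b] that y by simp
  qed
  have far': "y - z < 2 ^ Suc b \<and> popcount (y - z) = popcount (y - 2 ^ b - z) + 1 \<and> z \<le> y"
    if "y - 2 ^ b - z < 2 ^ b" "z \<le> y - 2 ^ b" for z
  proof -
    have e: "y - z = (y - 2 ^ b - z) + 2 ^ b" using that y by simp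
    then have "popcount (y - z) = popcount (y - 2 ^ b - z) + 1" using popcount_add_power2[OF that(1)] by simp
    then show ?thesis using that e unfolding power_Suc by linarith
  qed
  have near: "y - z < 2 ^ Suc b" if "y - z < 2 ^ b" for z using that by simp
  show ?thesis
  proof (cases "k' = 0")
    case True
    then have no: "\<forall>z\<le>y - 2 ^ b. S z \<longrightarrow> \<not> y - 2 ^ b - z < 2 ^ b" using 2 by (simp add: conv_entry_def)
    have "y - z < 2 ^ b" if "S z" "z \<le> y" "y - z < 2 ^ Suc b" for z
      using no far[OF _ that(3,2)] that(1) by blast
    then have "conv_entry S f m (Suc b) y a k x"
      using 1 near unfolding conv_entry_def by (auto split: if_splits)
    then show ?thesis using True by simp
  next
    case k': False
    then have c2: "S x'" "x' \<le> y - 2 ^ b" "y - 2 ^ b - x' < 2 ^ b" "a' = f x'" "k' = m x' + popcount (y - 2 ^ b - x')"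
      "\<And>z. z \<le> y - 2 ^ b \<Longrightarrow> S z \<Longrightarrow> y - 2 ^ b - z < 2 ^ b \<Longrightarrow> lex_le a' k' (f z) (m z + popcount (y - 2 ^ b - z))"
      using 2 by (auto simp: conv_entry_def)
    have f2: "y - x' < 2 ^ Suc b" "popcount (y - x') = popcount (y - 2 ^ b - x') + 1" "x' \<le> y" 
      using far'[OF c2(3,2)] by auto
    have l2: "lex_le a' (k' + 1) (f z) (m z + popcount (y - z))"
      if "z \<le> y" "S z" "y - z < 2 ^ Suc b" "\<not> y - z < 2 ^ b" for z
      using far[OF that(4,3,1)] c2(6)[of z] that(2) by (auto simp: lex_le_def)
    have new: "conv_entry S f m (Suc b) y a' (k' + 1) x'" 
      if near_le: "\<And>z. z \<le> y \<Longrightarrow> S z \<Longrightarrow> y - z < 2 ^ b \<Longrightarrow> lex_le a' (k' + 1) (f z) (m z + popcount (y - z))"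
    proof -
      have "lex_le a' (k' + 1) (f z) (m z + popcount (y - z))" 
        if "z \<le> y" "S z" "y - z < 2 ^ Suc b" for z
        using near_le[OF that(1,2)] l2[OF that] by blast
      then show ?thesis unfolding conv_entry_def using c2(1,4,5) f2 by simp
    qed
    show ?thesis
    proof (cases "k = 0")
      case True
      then have "\<not> y - z < 2 ^ b" if "z \<le> y" "S z" for z
        using 1 that by (simp add: conv_entry_def)
      then have "conv_entry S f m (Suc b) y a' (k' + 1) x'" using new by blast
      then show ?thesis using True k' by simp
    next
      case k: False
      then have c1: "S x" "x \<le> y" "y - x < 2 ^ b" "a = f x" "k = m x + popcount (y - x)"
        "\<And>z. z \<le> y \<Longrightarrow> S z \<Longrightarrow> y - z < 2 ^ b \<Longrightarrow> lex_le a k (f z) (m z + popcount (y - z))"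
        using 1 by (auto simp: conv_entry_def)
      show ?thesis
      proof (cases "a' < a \<or> \<not> a < a' \<and> k' + 1 < k")
        case True
        have "conv_entry S f m (Suc b) y a' (k' + 1) x'"
        proof (rule new)
          fix z assume "z \<le> y" "S z" "y - z < 2 ^ b"
          from c1(6)[OF this] show "lex_le a' (k' + 1) (f z) (m z + popcount (y - z))"
            using True by (auto simp: lex_le_def)
        qed
        then show ?thesis using True k' by auto
      next
        case F: False
        have "lex_le a k (f z) (m z + popcount (y - z))" if "z \<le> y" "S z" "y - z < 2 ^ Suc b" for z
        proof (cases "y - z < 2 ^ b")
          case True
          then show ?thesis using c1(6) that by blast
        next
          case False
          from l2[OF that False] show ?thesis using F by (auto simp: lex_le_def)
        qed
        then have "conv_entry S f m (Suc b) y a k x"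
          unfolding conv_entry_def if_not_P[OF k] using c1(1,2,4,5) near[OF c1(3)] by blast
        then show ?thesis using F k by auto
      qed
    qed
  qed
qed

text \<open>Follows from \<open>popcount c \<le> c\<close> and the number of leaves still to be
  placed; it keeps the stored counts linear in \<open>n\<close>, so that they fit into machine
  words.\<close>

lemma popcounts_le: "profile n J I cs \<Longrightarrow> popcounts cs + J + 1 \<le> n + 2 * I"
proof (induction n J I cs rule: profile.induct)
  case (2 n J I c cs)
  then show ?case using popcount_le[of c] by auto
qed simp

text \<open>The leaves of a tree with the given profile, as pairs of depth and weight, if heavier leaves
  come first.\<close>

fun placement :: "real list \<Rightarrow> nat \<Rightarrow> nat \<Rightarrow> nat list \<Rightarrow> (nat \<times> real) multiset" where
  "placement sw d i [] = {#}"
| "placement sw d i (c # cs) =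
     image_mset (Pair d) (mset (take c (drop i sw))) + placement sw (Suc d) (i + c) cs"

text \<open>Generalised over the depth \<open>d\<close> reached so far: all remaining weights have
  already paid \<open>d\<close>, and \<open>profile_cost\<close> accounts for the further
  levels.\<close>

lemma placement_cost:
  assumes "profile (length sw) J I cs" "2 * I \<le> J + 1" "i = J + 1 - 2 * I"
  shows "image_mset snd (placement sw (Suc d) i cs) = mset (drop i sw) \<and>
    (\<Sum>(d, w)\<in>#placement sw (Suc d) i cs. real d * w) =
      real d * tail_sum sw i + profile_cost sw J I cs"
  using assms
proof (induction cs arbitrary: J I i d)
  case Nil
  then show ?case by (simp add: tail_sum_def)
next
  case (Cons c cs)
  let ?I = "2 * I - c"
  let ?J = "J + ?I"
  have c: "c \<le> 2 * I" "profile (length sw) ?J ?I cs" using Cons.prems(1) by auto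
  have le: "2 * ?I \<le> ?J + 1"
  proof -
    have "?I + 2 * I \<le> J + 1 + ?I" using Cons.prems(2) by simp
    then show ?thesis by simp
  qed
  have i: "i + c = ?J + 1 - 2 * ?I" using c(1) Cons.prems(2,3) by simp
  have IH: "image_mset snd (placement sw (Suc (Suc d)) (i + c) cs) = mset (drop (i + c) sw)"
    "(\<Sum>(d, w)\<in>#placement sw (Suc (Suc d)) (i + c) cs. real d * w) =
      real (Suc d) * tail_sum sw (i + c) + profile_cost sw ?J ?I cs"
    using Cons.IH[OF c(2) le i, of "Suc d"] by auto
  have split: "drop i sw = take c (drop i sw) @ drop (i + c) sw"
    by (simp add: add.commute flip: drop_drop)
  have "image_mset snd (placement sw (Suc d) i (c # cs)) = mset (take c (drop i sw)) + mset (drop (i + c) sw)"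
    using IH(1) by (simp add: image_mset.compositionality comp_def)
  also have "\<dots> = mset (drop i sw)" by (metis split mset_append)
  finally have 1: "image_mset snd (placement sw (Suc d) i (c # cs)) = mset (drop i sw)" .
  have ts: "tail_sum sw i = sum_list (take c (drop i sw)) + tail_sum sw (i + c)"
    unfolding tail_sum_def by (subst split) simp
  have "(\<Sum>(d, w)\<in>#image_mset (Pair (Suc d)) (mset xs). real d * w) = real (Suc d) * sum_list xs" for xs
    by (induction xs) (auto simp: algebra_simps)
  then have "(\<Sum>(d, w)\<in>#placement sw (Suc d) i (c # cs). real d * w) =
    real (Suc d) * sum_list (take c (drop i sw)) + (real (Suc d) * tail_sum sw (i + c) + profile_cost sw ?J ?I cs)"
    using IH(2) by (simp only: placement.simps image_mset_union sum_mset.union)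
  also have "\<dots> = real (Suc d) * tail_sum sw i + profile_cost sw ?J ?I cs"
    unfolding ts by (simp add: algebra_simps)
  also have "\<dots> = real d * tail_sum sw i + profile_cost sw J I (c # cs)"
    using Cons.prems(3) by (simp add: algebra_simps)
  finally show ?case using 1 by blast
qed

text \<open>The form needed when a tree is assembled: level \<open>j\<close> owns the segment of
  sorted weights that starts after the leaves of smaller depth.\<close>

lemma placement_conv_sum:
  "placement sw d i cs = (\<Sum>j<length cs.
     image_mset (Pair (d + j)) (mset (take (cs ! j) (drop (i + sum_list (take j cs)) sw))))"
  by (induction cs arbitrary: d i)
    (simp_all add: sum.lessThan_Suc_shift add.assoc del: sum.lessThan_Suc)

text \<open>A tree that realises an optimal profile with a skeleton of at most
  \<open>popcounts cs\<close> leaves beats every tree \<open>t'\<close>, because \<open>t'\<close>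
  has a profile that is no worse than \<open>t'\<close> in either component.\<close>

theorem optimal_profile_tree:
  assumes "sorted_wrt (\<ge>) sw" "length sw \<ge> 2" "optimal_profile sw 1 1 cs"
    and "image_mset (apfst length) (mset (codewords t)) = placement sw 1 0 cs"
    and "sleaves (shrink t) \<le> popcounts cs"
    and "mset (map snd (codewords t')) = mset sw"
  shows "mset (map snd (codewords t)) = mset sw"
    "tree_cost (codewords t) < tree_cost (codewords t') \<or>
      tree_cost (codewords t) = tree_cost (codewords t') \<and> sleaves (shrink t) \<le> sleaves (shrink t')"
proof -
  have p: "profile (length sw) 1 1 cs" using assms(3) by (simp add: optimal_profile_def)
  have pl: "image_mset snd (placement sw 1 0 cs) = mset sw"
    "(\<Sum>(d, w)\<in>#placement sw 1 0 cs. real d * w) = profile_cost sw 1 1 cs"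
    using placement_cost[OF p, of 0 0] by auto
  show "mset (map snd (codewords t)) = mset sw"
    using pl(1) unfolding assms(4)[symmetric] by (simp add: image_mset.compositionality comp_def)
  have "tree_cost (codewords t) = (\<Sum>(d, w)\<in>#image_mset (apfst length) (mset (codewords t)). real d * w)"
    unfolding tree_cost_def sum_mset_sum_list[symmetric] mset_map
    by (simp add: image_mset.compositionality comp_def split_def)
  then have cost: "tree_cost (codewords t) = profile_cost sw 1 1 cs" unfolding assms(4) pl(2) .
  obtain cs' where "profile (length sw) 1 1 cs'" "profile_cost sw 1 1 cs' \<le> tree_cost (codewords t')"
    "popcounts cs' \<le> sleaves (shrink t')"
    using profile_lower_bound[OF assms(1,6,2)] by blast
  then show "tree_cost (codewords t) < tree_cost (codewords t') \<or>
      tree_cost (codewords t) = tree_cost (codewords t') \<and> sleaves (shrink t) \<le> sleaves (shrink t')"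
    using assms(3,5) unfolding cost optimal_profile_def lex_le_def by fastforce
qed

section \<open>Running programs\<close>

definition run :: "nat \<Rightarrow> com \<Rightarrow> state \<Rightarrow> nat \<Rightarrow> (state \<Rightarrow> bool) \<Rightarrow> bool" where
  "run B c s k Q \<longleftrightarrow> (\<exists>t s'. exec B c s t s' \<and> t \<le> k \<and> Q s')"

abbreviation seq (infixr ";;" 60) where "c ;; d \<equiv> Seq c d"

lemma run_mono: "run B c s k Q \<Longrightarrow> k \<le> k' \<Longrightarrow> (\<And>s'. Q s' \<Longrightarrow> Q' s') \<Longrightarrow> run B c s k' Q'"
  unfolding run_def by (meson le_trans)

lemma run_Seq:
  assumes "run B c s k Q" "\<And>s'. Q s' \<Longrightarrow> run B d s' k' R"
  shows "run B (c ;; d) s (k + k' + 1) R"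
proof -
  obtain t s' where 1: "exec B c s t s'" "t \<le> k" "Q s'" using assms(1) by (auto simp: run_def)
  obtain t' s'' where 2: "exec B d s' t' s''" "t' \<le> k'" "R s''"
    using assms(2)[OF 1(3)] by (auto simp: run_def)
  show ?thesis unfolding run_def
    using exec.Seq[OF 1(1) 2(1)] 1(2) 2(2,3) by (intro exI[of _ "t + t' + 1"] exI[of _ s'']) simp
qed

text \<open>The invariant carries the number of completed iterations, so the bound
  \<open>i < M\<close> yields termination and running time together.\<close>

lemma run_While:
  assumes init: "Inv 0 s"
    and fits: "\<And>i s. Inv i s \<Longrightarrow> bfits B s b"
    and step: "\<And>i s. Inv i s \<Longrightarrow> bval s b \<Longrightarrow> i < M \<and> run B c s k (Inv (Suc i))"
    and exit: "\<And>i s. Inv i s \<Longrightarrow> \<not> bval s b \<Longrightarrow> Q s"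
  shows "run B (While b c) s (M * (bcost b + k + 1) + bcost b + 1) Q"
proof -
  have "run B (While b c) s ((M - i) * (bcost b + k + 1) + bcost b + 1) Q" if "Inv i s" for i s
    using that
  proof (induction "M - i" arbitrary: i s rule: less_induct)
    case less
    show ?case
    proof (cases "bval s b")
      case False
      have e: "exec B (While b c) s (bcost b + 1) s" using fits[OF less.prems] False by (rule WhileFalse)
      show ?thesis unfolding run_def
        by (intro exI[of _ "bcost b + 1"] exI[of _ s] conjI e exit[OF less.prems False]) simp
    next
      case True
      have iM: "i < M" and r: "run B c s k (Inv (Suc i))" using step[OF less.prems True] by auto
      obtain t s' where 1: "exec B c s t s'" "t \<le> k" "Inv (Suc i) s'" using r by (auto simp: run_def)
      obtain t' s'' where 2: "exec B (While b c) s' t' s''" "Q s''"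
        and t': "t' \<le> (M - Suc i) * (bcost b + k + 1) + bcost b + 1"
        using less.hyps[of "Suc i" s'] 1(3) iM unfolding run_def by (meson diff_less_mono2 lessI)
      have "M - i = Suc (M - Suc i)" using iM by simp
      then have "bcost b + t + t' + 1 \<le> (M - i) * (bcost b + k + 1) + bcost b + 1"
        using t' 1(2) by simp
      then show ?thesis unfolding run_def
        using WhileTrue[OF fits[OF less.prems] True 1(1) 2(1)] 2(2) by blast
    qed
  qed
  from this[OF init] show ?thesis by simp
qed

text \<open>Weakest preconditions for loop-free code. Loops get \<open>False\<close> and are handled
  by \<open>run_While\<close>.\<close>

primrec wp :: "nat \<Rightarrow> com \<Rightarrow> (state \<Rightarrow> bool) \<Rightarrow> state \<Rightarrow> bool" where
  "wp B Skip Q s \<longleftrightarrow> Q s"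
| "wp B (Assign x e) Q s \<longleftrightarrow> ifits B s e \<and> Q (s\<lparr>ivar := (ivar s)(x := ival s e)\<rparr>)"
| "wp B (Store a i e) Q s \<longleftrightarrow> ifits B s i \<and> ifits B s e \<and>
     Q (s\<lparr>iarr := (iarr s)(a := (iarr s a)(ival s i := ival s e))\<rparr>)"
| "wp B (WStore a i e) Q s \<longleftrightarrow> ifits B s i \<and> wfits B s e \<and>
     Q (s\<lparr>warr := (warr s)(a := (warr s a)(ival s i := wval s e))\<rparr>)"
| "wp B (Seq c d) Q s \<longleftrightarrow> wp B c (wp B d Q) s"
| "wp B (Cond b c d) Q s \<longleftrightarrow> bfits B s b \<and> (if bval s b then wp B c Q s else wp B d Q s)"
| "wp B (While b c) Q s \<longleftrightarrow> False"

text \<open>The value for \<open>While\<close> is a placeholder that \<open>run_wp\<close> never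
  relies on, as \<open>wp\<close> of a loop is \<open>False\<close>.\<close>

primrec max_steps :: "com \<Rightarrow> nat" where
  "max_steps Skip = 1"
| "max_steps (Assign x e) = icost e + 1"
| "max_steps (Store a i e) = icost i + icost e + 1"
| "max_steps (WStore a i e) = icost i + wcost e + 1"
| "max_steps (Seq c d) = max_steps c + max_steps d + 1"
| "max_steps (Cond b c d) = bcost b + max (max_steps c) (max_steps d) + 1"
| "max_steps (While b c) = 0"

lemma run_wp: "wp B c Q s \<Longrightarrow> run B c s (max_steps c) Q"
proof (induction c arbitrary: Q s)
  case Skip
  then show ?case unfolding run_def using exec.Skip[of B s] by auto
next
  case (Assign x e)
  then show ?case unfolding run_def using exec.Assign by fastforce
next
  case (Store a i e)
  then show ?case unfolding run_def using exec.Store by fastforce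
next
  case (WStore a i e)
  then show ?case unfolding run_def using exec.WStore by fastforce
next
  case (Seq c d)
  have "run B c s (max_steps c) (wp B d Q)" using Seq by simp
  from run_Seq[OF this Seq.IH(2)] show ?case by simp
next
  case (Cond b c d)
  show ?case
  proof (cases "bval s b")
    case True
    then have f: "bfits B s b" and "wp B c Q s" using Cond.prems by auto
    from Cond.IH(1)[OF this(2)] obtain t s' where e: "exec B c s t s'" "t \<le> max_steps c" "Q s'"
      by (auto simp: run_def)
    show ?thesis unfolding run_def
      by (rule exI[of _ "bcost b + t + 1"], rule exI[of _ s'])
        (use exec.CondTrue[OF f True e(1)] e(2,3) in simp)
  next
    case False
    then have f: "bfits B s b" and "wp B d Q s" using Cond.prems by auto
    from Cond.IH(2)[OF this(2)] obtain t s' where e: "exec B d s t s'" "t \<le> max_steps d" "Q s'"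
      by (auto simp: run_def)
    show ?thesis unfolding run_def
      by (rule exI[of _ "bcost b + t + 1"], rule exI[of _ s'])
        (use exec.CondFalse[OF f False e(1)] e(2,3) in simp)
  qed
qed simp

lemma run_wpI: "wp B c Q s \<Longrightarrow> max_steps c \<le> k \<Longrightarrow> run B c s k Q"
  using run_wp run_mono by blast

lemma run_loop:
  assumes init: "wp B d (Inv 0) s"
    and loop: "\<And>i s. Inv i s \<Longrightarrow> bfits B s b"
      "\<And>i s. Inv i s \<Longrightarrow> bval s b \<Longrightarrow> i < M \<and> run B c s k (Inv (Suc i))"
      "\<And>i s. Inv i s \<Longrightarrow> \<not> bval s b \<Longrightarrow> Q s"
    and time: "M * (bcost b + k + 1) + bcost b + max_steps d + 2 \<le> K"
  shows "run B (d ;; While b c) s K Q"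
proof -
  have "run B (d ;; While b c) s (max_steps d + (M * (bcost b + k + 1) + bcost b + 1) + 1) Q"
    by (rule run_Seq[OF run_wp[OF init]]) (rule run_While, assumption, (rule loop, assumption+)+)
  then show ?thesis by (rule run_mono) (use time in simp_all)
qed

text \<open>One name may denote an integer variable, an integer array and a weight array; a write to
  any of them puts the name into the set, and \<open>agree_off\<close> likewise speaks about all
  three.\<close>

primrec writes :: "com \<Rightarrow> vname set" where
  "writes Skip = {}"
| "writes (Assign x e) = {x}"
| "writes (Store a i e) = {a}"
| "writes (WStore a i e) = {a}"
| "writes (Seq c d) = writes c \<union> writes d"
| "writes (Cond b c d) = writes c \<union> writes d"
| "writes (While b c) = writes c"

definition agree_off :: "vname set \<Rightarrow> state \<Rightarrow> state \<Rightarrow> bool" where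
  "agree_off X s s' \<longleftrightarrow>
     (\<forall>x. x \<notin> X \<longrightarrow> ivar s' x = ivar s x \<and> iarr s' x = iarr s x \<and> warr s' x = warr s x)"

lemma exec_agree_off: "exec B c s t s' \<Longrightarrow> agree_off (writes c) s s'"
  by (induction rule: exec.induct) (auto simp: agree_off_def)

lemma run_frame: "run B c s k Q \<Longrightarrow> run B c s k (\<lambda>s'. Q s' \<and> agree_off (writes c) s s')"
  unfolding run_def using exec_agree_off by blast

abbreviation V :: "vname \<Rightarrow> iexp" where "V \<equiv> Var"

section \<open>Sorting the weights and summing suffixes\<close>

lemma mset_map_swap:
  assumes "i < n" "j < n"
  shows "mset (map (f(i := f j, j := f i)) [0..<n]) = mset (map f [0..<n])"
proof -
  have "map (f(i := f j, j := f i)) [0..<n] =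
    (map f [0..<n])[i := map f [0..<n] ! j, j := map f [0..<n] ! i]"
    using assms by (intro nth_equalityI) (auto simp: nth_list_update)
  then show ?thesis using mset_swap[of j "map f [0..<n]" i] assms by simp
qed

text \<open>A comparison step of exchange sort into decreasing order, whose quadratic time stays
  within the target. The cell \<open>tmp\<close> serves as a scratch variable, since weights live
  only in arrays.\<close>

definition sort_step :: com where
  "sort_step =
     Cond (WLess (WCell ''w'' (V ''i'')) (WCell ''w'' (V ''j'')))
       (WStore ''tmp'' (Num 0) (WCell ''w'' (V ''i'')) ;;
        WStore ''w'' (V ''i'') (WCell ''w'' (V ''j'')) ;;
        WStore ''w'' (V ''j'') (WCell ''tmp'' (Num 0)))
       Skip ;;
     Assign ''j'' (Plus (V ''j'') (Num 1))"

definition sort_pass :: com where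
  "sort_pass =
     (Assign ''j'' (Plus (V ''i'') (Num 1)) ;;
      While (ILess (V ''j'') (V ''n'')) sort_step) ;;
     Assign ''i'' (Plus (V ''i'') (Num 1))"

definition sort_weights :: com where
  "sort_weights =
     Assign ''i'' (Num 0) ;;
     While (ILess (V ''i'') (V ''n'')) sort_pass"

definition weights_are :: "state \<Rightarrow> real list \<Rightarrow> bool" where
  "weights_are s sw \<longleftrightarrow> ivar s ''n'' = length sw \<and> (\<forall>k<length sw. warr s ''w'' k = sw ! k)"

lemma run_sort_weights:
  assumes w: "weights_are s ws" and B: "B \<ge> length ws + 1"
  shows "run B sort_weights s (30 * (length ws + 1) * (length ws + 1))
    (\<lambda>s'. \<exists>sw. weights_are s' sw \<and> mset sw = mset ws \<and> sorted_wrt (\<ge>) sw)"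
proof -
  let ?n = "length ws"
  \<comment> \<open>The positions before \<open>i\<close> are final: each dominates everything
    behind it.\<close>
  define good where "good = (\<lambda>i (f :: nat \<Rightarrow> real). mset (map f [0..<?n]) = mset ws \<and>
    (\<forall>p q. p < i \<longrightarrow> p < q \<longrightarrow> q < ?n \<longrightarrow> f p \<ge> f q))"
  define Inv where "Inv = (\<lambda>i (s :: state). ivar s ''n'' = ?n \<and> ivar s ''i'' = i \<and> i \<le> ?n \<and> good i (warr s ''w''))"
  define Inv' where "Inv' = (\<lambda>i m (s :: state). ivar s ''n'' = ?n \<and> ivar s ''i'' = i \<and> i < ?n \<and>
    ivar s ''j'' = i + 1 + m \<and> i + 1 + m \<le> ?n \<and> good i (warr s ''w'') \<and>
    (\<forall>q. i < q \<longrightarrow> q < i + 1 + m \<longrightarrow> warr s ''w'' i \<ge> warr s ''w'' q))"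
  \<comment> \<open>One iteration costs 29 steps: 3 for the test, at most 25 for the body and 1 for
    the loop.\<close>
  have inner: "run B (Assign ''j'' (Plus (V ''i'') (Num 1)) ;;
      While (ILess (V ''j'') (V ''n'')) sort_step) s (?n * 29 + 10) (Inv' i (?n - i - 1))"
    if I: "Inv i s" and i: "i < ?n" for i s
  proof (rule run_loop[where Inv = "Inv' i" and M = ?n and k = "max_steps sort_step"])
    show "wp B (Assign ''j'' (Plus (V ''i'') (Num 1))) (Inv' i 0) s"
      using I i B unfolding Inv_def Inv'_def by simp
  next
    fix m s assume "Inv' i m s"
    then show "bfits B s (ILess (V ''j'') (V ''n''))" using B by (simp add: Inv'_def)
  next
    fix m s assume I: "Inv' i m s" and b: "bval s (ILess (V ''j'') (V ''n''))"
    let ?f = "warr s ''w''" and ?j = "i + 1 + m"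
    have j: "?j < ?n" using I b by (simp add: Inv'_def)
    have sw: "good i (?f(i := ?f ?j, ?j := ?f i))" if "good i ?f"
    proof -
      have "mset (map (?f(i := ?f ?j, ?j := ?f i)) [0..<?n]) = mset ws"
        using mset_map_swap[of i ?n ?j ?f] that j by (simp add: good_def)
      moreover have "?f p \<ge> ?f q" if "p < i" "p < q" "q < ?n" for p q
        using that \<open>good i ?f\<close> by (simp add: good_def)
      ultimately show ?thesis using j unfolding good_def by auto
    qed
    have "wp B sort_step (Inv' i (Suc m)) s"
    proof (cases "?f i < ?f ?j")
      case True
      then show ?thesis using I sw j B unfolding Inv'_def sort_step_def
        by (auto simp: less_Suc_eq)
    next
      case False
      then show ?thesis using I j B unfolding Inv'_def sort_step_def
        by (auto simp: less_Suc_eq)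
    qed
    then show "m < ?n \<and> run B sort_step s (max_steps sort_step) (Inv' i (Suc m))"
      using j run_wp by auto
  next
    fix m s assume I: "Inv' i m s" and b: "\<not> bval s (ILess (V ''j'') (V ''n''))"
    then have "m = ?n - i - 1" by (auto simp: Inv'_def)
    then show "Inv' i (?n - i - 1) s" using I by simp
  qed (simp add: sort_step_def)
  have outer: "run B sort_pass s (?n * 29 + 15) (Inv (Suc i))" if "Inv i s" "i < ?n" for i s
  proof -
    have "run B sort_pass s ((?n * 29 + 10) + 4 + 1) (Inv (Suc i))"
      unfolding sort_pass_def
    proof (rule run_Seq[OF inner[OF that]])
      fix s assume I: "Inv' i (?n - i - 1) s"
      then have "i < ?n" by (simp add: Inv'_def)
      then have e: "i + 1 + (?n - i - 1) = ?n" by simp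
      have "good i (warr s ''w'')" "\<forall>q. i < q \<longrightarrow> q < ?n \<longrightarrow> warr s ''w'' i \<ge> warr s ''w'' q"
        using I unfolding Inv'_def e by blast+
      then have "good (Suc i) (warr s ''w'')"
        unfolding good_def by (auto simp: less_Suc_eq)
      then have "wp B (Assign ''i'' (Plus (V ''i'') (Num 1))) (Inv (Suc i)) s"
        using I B unfolding Inv_def Inv'_def by simp
      then show "run B (Assign ''i'' (Plus (V ''i'') (Num 1))) s 4 (Inv (Suc i))"
        by (rule run_wpI) simp
    qed
    then show ?thesis by (rule run_mono) simp_all
  qed
  show ?thesis
    unfolding sort_weights_def
  proof (rule run_loop[where Inv = Inv and M = ?n and k = "?n * 29 + 15"])
    have "map (warr s ''w'') [0..<?n] = ws" using w by (intro nth_equalityI) (auto simp: weights_are_def)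
    then have "good 0 (warr s ''w'')" by (simp add: good_def del: mset_map)
    then show "wp B (Assign ''i'' (Num 0)) (Inv 0) s"
      using w by (simp add: Inv_def weights_are_def)
  next
    fix i s assume "Inv i s"
    then show "bfits B s (ILess (V ''i'') (V ''n''))" using B by (simp add: Inv_def)
  next
    fix i s assume I: "Inv i s" and "bval s (ILess (V ''i'') (V ''n''))"
    then have "i < ?n" by (simp add: Inv_def)
    with outer[OF I this] show "i < ?n \<and> run B sort_pass s (?n * 29 + 15) (Inv (Suc i))" by blast
  next
    fix i s assume I: "Inv i s" and "\<not> bval s (ILess (V ''i'') (V ''n''))"
    then have g: "good ?n (warr s ''w'')" and n: "ivar s ''n'' = ?n" by (auto simp: Inv_def)
    let ?sw = "map (warr s ''w'') [0..<?n]"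
    have "weights_are s ?sw" using n by (simp add: weights_are_def)
    moreover have "mset ?sw = mset ws" using g by (simp add: good_def)
    moreover have "sorted_wrt (\<ge>) ?sw" using g unfolding sorted_wrt_iff_nth_less by (simp add: good_def)
    ultimately show "\<exists>sw. weights_are s sw \<and> mset sw = mset ws \<and> sorted_wrt (\<ge>) sw" by blast
  qed (simp add: algebra_simps)
qed

text \<open>The cell \<open>sfx\<close> at index \<open>n\<close> is never written; its initial 0 is
  the empty tail sum on which the recurrence starts.\<close>

definition suffix_sums :: com where
  "suffix_sums =
     Assign ''i'' (V ''n'') ;;
     While (ILess (Num 0) (V ''i''))
       (Assign ''i'' (Minus (V ''i'') (Num 1)) ;;
        WStore ''sfx'' (V ''i'')
          (WPlus (WCell ''w'' (V ''i'')) (WCell ''sfx'' (Plus (V ''i'') (Num 1)))))"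

definition sums_are :: "state \<Rightarrow> real list \<Rightarrow> bool" where
  "sums_are s sw \<longleftrightarrow> (\<forall>k\<le>length sw. warr s ''sfx'' k = tail_sum sw k)"

lemma run_suffix_sums:
  assumes w: "weights_are s sw" and z: "warr s ''sfx'' = (\<lambda>_. 0)" and B: "B \<ge> length sw + 1"
  shows "run B suffix_sums s (30 * (length sw + 1)) (\<lambda>s. weights_are s sw \<and> sums_are s sw)"
proof -
  let ?n = "length sw" and ?b = "ILess (Num 0) (V ''i'')"
  let ?c = "Assign ''i'' (Minus (V ''i'') (Num 1)) ;;
        WStore ''sfx'' (V ''i'')
          (WPlus (WCell ''w'' (V ''i'')) (WCell ''sfx'' (Plus (V ''i'') (Num 1))))"
  define Inv where "Inv = (\<lambda>m (s :: state). weights_are s sw \<and> ivar s ''i'' + m = ?n \<and>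
    (\<forall>k. ivar s ''i'' \<le> k \<longrightarrow> k \<le> ?n \<longrightarrow> warr s ''sfx'' k = tail_sum sw k))"
  show ?thesis
    unfolding suffix_sums_def
  proof (rule run_loop[where Inv = Inv and M = "?n" and k = "max_steps ?c"])
    show "wp B (Assign ''i'' (V ''n'')) (Inv 0) s"
      using w z B by (simp add: Inv_def weights_are_def tail_sum_def)
  next
    fix i s assume "Inv i s"
    then show "bfits B s ?b" using B by (simp add: Inv_def)
  next
    fix i s assume I: "Inv i s" and b: "bval s ?b"
    let ?i = "ivar s ''i'' - 1"
    have i: "?i < ?n" "Suc ?i = ivar s ''i''" using I b by (auto simp: Inv_def)
    have "tail_sum sw ?i = sw ! ?i + tail_sum sw (Suc ?i)"
      unfolding tail_sum_def by (subst Cons_nth_drop_Suc[OF i(1), symmetric]) simp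
    moreover have "warr s ''sfx'' k = tail_sum sw k" if "?i \<le> k" "k \<noteq> ?i" "k \<le> ?n" for k
      using I i that by (simp add: Inv_def)
    moreover have "warr s ''sfx'' (ivar s ''i'') = tail_sum sw (Suc ?i)"
      using I i by (simp add: Inv_def)
    moreover have "Suc (?n - Suc 0) = ?n" using i by linarith
    ultimately have "wp B ?c (Inv (Suc i)) s"
      using I b B i unfolding Inv_def weights_are_def by simp
    from run_wp[OF this] show "i < ?n \<and> run B ?c s (max_steps ?c) (Inv (Suc i))"
      using I b by (simp add: Inv_def)
  next
    fix i s assume "Inv i s" "\<not> bval s ?b"
    then show "weights_are s sw \<and> sums_are s sw" by (simp add: Inv_def sums_are_def)
  qed (simp)
qed

section \<open>Filling the tables\<close>

text \<open>The entry for \<open>(J, I)\<close> consists of the optimal cost, the optimal popcount sum plus 1 (as 0 marks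
  missing values), and the number of inner nodes on the next level in an optimal solution.\<close>

definition cell :: "real list \<Rightarrow> (nat \<Rightarrow> real) \<Rightarrow> (nat \<Rightarrow> nat) \<Rightarrow> (nat \<Rightarrow> nat) \<Rightarrow> nat \<Rightarrow> nat \<Rightarrow> bool" where
  "cell sw F K C J I \<longleftrightarrow> (let q = J * length sw + I in C q \<le> 2 * I \<and>
     (\<exists>cs. optimal_profile sw J I ((2 * I - C q) # cs) \<and>
       F q = profile_cost sw J I ((2 * I - C q) # cs) \<and> K q = popcounts ((2 * I - C q) # cs) + 1))"

text \<open>The range \<open>I \<le> J\<close> includes states with \<open>2 * I > J + 1\<close>,
  which no tree reaches. There the truncated difference \<open>J + 1 - 2 * I\<close> is 0 in the
  program as well as in \<open>profile_cost\<close>, so the same recurrence applies.\<close>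

definition rows :: "real list \<Rightarrow> (nat \<Rightarrow> real) \<Rightarrow> (nat \<Rightarrow> nat) \<Rightarrow> (nat \<Rightarrow> nat) \<Rightarrow> nat \<Rightarrow> bool" where
  "rows sw F K C J0 \<longleftrightarrow>
     (\<forall>J I. J0 \<le> J \<longrightarrow> J < length sw \<longrightarrow> 1 \<le> I \<longrightarrow> I \<le> J \<longrightarrow> cell sw F K C J I)"

text \<open>The case \<open>y = 0\<close> is the finished tree, for which the table has no entry:
  cost 0 and, in \<open>next_count\<close>, popcount sum 0 stored as 1.\<close>

definition next_cost :: "nat \<Rightarrow> nat \<Rightarrow> (nat \<Rightarrow> real) \<Rightarrow> nat \<Rightarrow> real" where
  "next_cost n J F y = (if y = 0 then 0 else F ((J + y) * n + y))"

definition next_count :: "nat \<Rightarrow> nat \<Rightarrow> (nat \<Rightarrow> nat) \<Rightarrow> nat \<Rightarrow> nat" where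
  "next_count n J K y = (if y = 0 then 1 else K ((J + y) * n + y))"

lemma rows_successor:
  assumes "rows sw F K C (Suc J)" "successor (length sw) J y"
  shows "\<exists>cs. optimal_profile sw (J + y) y cs \<and>
    next_cost (length sw) J F y = profile_cost sw (J + y) y cs \<and>
    next_count (length sw) J K y = popcounts cs + 1"
proof (cases "y = 0")
  case True
  then show ?thesis using assms(2)
    by (intro exI[of _ "[]"]) (simp add: successor_def next_cost_def next_count_def)
next
  case False
  then have "cell sw F K C (J + y) y"
    using assms unfolding rows_def successor_def by simp
  then show ?thesis
    unfolding cell_def next_cost_def next_count_def Let_def if_not_P[OF False] by blast
qed

lemma next_count_bounds:
  assumes "rows sw F K C (Suc J)" "successor (length sw) J y"
  shows "0 < next_count (length sw) J K y" "next_count (length sw) J K y \<le> 3 * length sw + 1"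
proof -
  obtain cs where cs: "optimal_profile sw (J + y) y cs" "next_count (length sw) J K y = popcounts cs + 1"
    using rows_successor[OF assms] by blast
  then have "popcounts cs + (J + y) + 1 \<le> length sw + 2 * y"
    using popcounts_le[of "length sw" "J + y" y cs] by (simp add: optimal_profile_def)
  moreover have "J + y < length sw" using assms(2) by (auto simp: successor_def split: if_splits)
  ultimately show "0 < next_count (length sw) J K y" "next_count (length sw) J K y \<le> 3 * length sw + 1"
    unfolding cs(2) by auto
qed

text \<open>Once \<open>2 * I < 2 ^ b\<close>, the window contains every candidate
  \<open>x \<le> 2 * I\<close>, so the entry at \<open>2 * I\<close> is the minimum over all
  successors and \<open>optimal_profile_Cons\<close> applies.\<close>

lemma cell_of_conv_entry:
  assumes r: "rows sw F K C (Suc J)"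
    and c: "conv_entry (successor (length sw) J) (next_cost (length sw) J F)
      (next_count (length sw) J K) b (2 * I) a k x"
    and I: "2 * I < 2 ^ b" "1 \<le> I" "J < length sw"
  shows "x \<le> 2 * I \<and> (\<exists>cs. optimal_profile sw J I ((2 * I - x) # cs) \<and>
    tail_sum sw (J + 1 - 2 * I) + a = profile_cost sw J I ((2 * I - x) # cs) \<and>
    k = popcounts ((2 * I - x) # cs) + 1)"
proof -
  let ?S = "successor (length sw) J"
  let ?f = "next_cost (length sw) J F" and ?m = "next_count (length sw) J K"
  have near: "2 * I - z < 2 ^ b" for z using I(1) by linarith
  \<comment> \<open>A successor exists: finish the tree if \<open>J + 1 = n\<close>, otherwise
    continue with one inner node. Hence the entry is not marked as missing.\<close>
  have "\<exists>z\<le>2 * I. ?S z"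
  proof (cases "J + 1 = length sw")
    case True
    then show ?thesis by (intro exI[of _ 0]) (simp add: successor_def)
  next
    case False
    then show ?thesis using I(2,3) by (intro exI[of _ 1]) (simp add: successor_def)
  qed
  note ex = this
  have k: "k \<noteq> 0"
  proof
    assume "k = 0"
    then have "\<forall>z\<le>2 * I. ?S z \<longrightarrow> \<not> 2 * I - z < 2 ^ b"
      using c unfolding conv_entry_def by (simp only: if_True simp_thms)
    then show False using near ex by blast
  qed
  then have x: "?S x" "x \<le> 2 * I" "a = ?f x" "k = ?m x + popcount (2 * I - x)"
    and best: "\<And>z. z \<le> 2 * I \<Longrightarrow> ?S z \<Longrightarrow> lex_le a k (?f z) (?m z + popcount (2 * I - z))"
    using c near unfolding conv_entry_def if_not_P[OF k] by blast+
  obtain cs where cs: "optimal_profile sw (J + x) x cs" "?f x = profile_cost sw (J + x) x cs"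
    "?m x = popcounts cs + 1"
    using rows_successor[OF r x(1)] by blast
  have "optimal_profile sw J I ((2 * I - x) # cs)"
  proof (rule optimal_profile_Cons[OF _ x(2) cs(1)])
    fix y' cs'
    assume y': "y' \<le> 2 * I" "?S y'" "optimal_profile sw (J + y') y' cs'"
    obtain cs'' where cs'': "optimal_profile sw (J + y') y' cs''" "?f y' = profile_cost sw (J + y') y' cs''"
      "?m y' = popcounts cs'' + 1"
      using rows_successor[OF r y'(2)] by blast
    show "lex_le (profile_cost sw (J + x) x cs) (popcounts cs + popcount (2 * I - x))
        (profile_cost sw (J + y') y' cs') (popcounts cs' + popcount (2 * I - y'))"
      using best[OF y'(1,2)] optimal_profile_unique[OF cs''(1) y'(3)]
      unfolding x(3,4) cs(2,3) cs''(2,3) lex_le_def by linarith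
  qed (use I(2) rows_successor[OF r] in auto)
  moreover have "tail_sum sw (J + 1 - 2 * I) + a = profile_cost sw J I ((2 * I - x) # cs)"
    using x(2,3) cs(2) by simp
  moreover have "k = popcounts ((2 * I - x) # cs) + 1" using x(4) cs(3) by simp
  ultimately show ?thesis using x(2) by blast
qed

section \<open>One row of the table: initialisation, rounds, storing\<close>

lemma conv_entry_bound:
  assumes "conv_entry S f m b y a k x" "\<And>x. S x \<Longrightarrow> m x \<le> M"
  shows "k \<le> M + y"
proof (cases "k = 0")
  case False
  then have "S x" "k = m x + popcount (y - x)" using assms(1) by (auto simp: conv_entry_def)
  then show ?thesis using assms(2)[of x] popcount_le[of "y - x"] by linarith
qed simp

text \<open>The exclusive bound \<open>2 * n + 1\<close> on the index \<open>y\<close>; a row is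
  read at the indices \<open>2 * I\<close> with \<open>I \<le> J < n\<close>.\<close>

abbreviation lim :: iexp where "lim \<equiv> Plus (V ''n'') (Plus (V ''n'') (Num 1))"

abbreviation entry :: "iexp \<Rightarrow> iexp \<Rightarrow> iexp" where
  "entry e f \<equiv> Plus (Times e (V ''n'')) f"

text \<open>The language has no weight literals; the weight 0 of the finished tree is taken from
  \<open>sfx\<close> at index \<open>n\<close>, the empty tail sum.\<close>

definition init_step :: com where
  "init_step =
     Cond (BAnd (ILess (Num 0) (V ''y'')) (ILess (Plus (V ''J'') (V ''y'')) (V ''n'')))
       (WStore ''gw'' (V ''y'') (WCell ''fw'' (entry (Plus (V ''J'') (V ''y'')) (V ''y''))) ;;
        Store ''gk'' (V ''y'') (Cell ''fk'' (entry (Plus (V ''J'') (V ''y'')) (V ''y''))))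
       (Cond (BAnd (IEq (V ''y'') (Num 0)) (IEq (Plus (V ''J'') (Num 1)) (V ''n'')))
         (WStore ''gw'' (V ''y'') (WCell ''sfx'' (V ''n'')) ;;
          Store ''gk'' (V ''y'') (Num 1))
         (Store ''gk'' (V ''y'') (Num 0))) ;;
     Store ''gc'' (V ''y'') (V ''y'') ;;
     Assign ''y'' (Plus (V ''y'') (Num 1))"

text \<open>What stays fixed during the convolution for row \<open>J\<close>: the input data and the
  three tables with the rows computed before.\<close>

definition keep :: "real list \<Rightarrow> nat \<Rightarrow> (nat \<Rightarrow> real) \<Rightarrow> (nat \<Rightarrow> nat) \<Rightarrow> (nat \<Rightarrow> nat) \<Rightarrow> state \<Rightarrow> bool" where
  "keep sw J F K C s \<longleftrightarrow> weights_are s sw \<and> sums_are s sw \<and> ivar s ''J'' = J \<and>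
     warr s ''fw'' = F \<and> iarr s ''fk'' = K \<and> iarr s ''fc'' = C"

lemmas keep_defs = keep_def weights_are_def sums_are_def

definition table :: "real list \<Rightarrow> nat \<Rightarrow> (nat \<Rightarrow> real) \<Rightarrow> (nat \<Rightarrow> nat) \<Rightarrow> nat \<Rightarrow> state \<Rightarrow> nat \<Rightarrow> bool" where
  "table sw J F K b s y \<longleftrightarrow>
     conv_entry (successor (length sw) J) (next_cost (length sw) J F) (next_count (length sw) J K) b y
       (warr s ''gw'' y) (iarr s ''gk'' y) (iarr s ''gc'' y)"

text \<open>Bounds the table indices, which are the quadratic quantities the word size has to
  accommodate.\<close>

lemma table_index_less: "a < n \<Longrightarrow> b < n \<Longrightarrow> a * n + b < n * (n :: nat)"
proof -
  assume a: "a < n" "b < n"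
  then have "a * n + b < Suc a * n" by simp
  also have "\<dots> \<le> n * n" using a by (intro mult_right_mono) auto
  finally show ?thesis .
qed

context
  fixes sw :: "real list" and B J :: nat and F K C
  assumes B: "length sw * length sw + 20 * length sw + 20 \<le> B"
    and rows: "rows sw F K C (Suc J)" and J: "1 \<le> J" "J < length sw"
begin

lemma run_init:
  assumes "keep sw J F K C s"
  shows "run B (Assign ''y'' (Num 0) ;; While (ILess (V ''y'') lim) init_step) s
    (120 * length sw + 90) (\<lambda>s. keep sw J F K C s \<and> (\<forall>y\<le>2 * length sw. table sw J F K 0 s y))"
proof -
  let ?n = "length sw" and ?b = "ILess (V ''y'') lim"
  define Inv where "Inv = (\<lambda>m (s :: state). keep sw J F K C s \<and> ivar s ''y'' = m \<and> m \<le> 2 * ?n + 1 \<and>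
    (\<forall>y<m. table sw J F K 0 s y))"
  show ?thesis
  proof (rule run_loop[where Inv = Inv and M = "(2 * ?n + 1)" and k = "max_steps init_step"])
    show "wp B (Assign ''y'' (Num 0)) (Inv 0) s"
      using assms by (simp add: Inv_def keep_defs)
  next
    fix m s assume "Inv m s"
    then show "bfits B s ?b" using B by (simp add: Inv_def keep_def weights_are_def)
  next
    fix m s assume I: "Inv m s" and b: "bval s ?b"
    note step_defs = Inv_def init_step_def keep_defs table_def
    have m: "m < 2 * ?n + 1" using I b by (simp add: Inv_def keep_def weights_are_def)
    have e: "conv_entry (successor ?n J) (next_cost ?n J F) (next_count ?n J K) 0 m
      (next_cost ?n J F m) (if successor ?n J m then next_count ?n J K m else 0) m"
      by (rule conv_entry_0) (rule next_count_bounds(1)[OF rows])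
    have e': "conv_entry (successor ?n J) (next_cost ?n J F) (next_count ?n J K) 0 m a 0 m"
      if "\<not> successor ?n J m" for a using that by (auto simp: conv_entry_def)
    consider "0 < m" "J + m < ?n" | "m = 0" "J + 1 = ?n" | "\<not> (0 < m \<and> J + m < ?n)" "\<not> (m = 0 \<and> J + 1 = ?n)"
      by blast
    then have "wp B init_step (Inv (Suc m)) s"
    proof cases
      case 1
      then have S: "successor ?n J m" by (simp add: successor_def)
      have "K ((J + m) * ?n + m) \<le> 3 * ?n + 1"
        using next_count_bounds(2)[OF rows S] 1 by (simp add: next_count_def)
      moreover have "(J + m) * ?n + m < ?n * ?n" using 1 by (intro table_index_less) auto
      moreover have "(J + m) * ?n \<le> (J + m) * ?n + m" by simp
      moreover have "conv_entry (successor ?n J) (next_cost ?n J F) (next_count ?n J K) 0 m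
          (F ((J + m) * ?n + m)) (K ((J + m) * ?n + m)) m"
        using e S 1 by (simp add: next_cost_def next_count_def)
      ultimately show ?thesis using I B m 1
        unfolding step_defs by (simp add: less_Suc_eq)
    next
      case 2
      then have S: "successor ?n J 0" by (simp add: successor_def)
      have "conv_entry (successor ?n J) (next_cost ?n J F) (next_count ?n J K) 0 0 0 (Suc 0) 0"
        using e S 2 by (simp add: next_cost_def next_count_def)
      moreover have "tail_sum sw ?n = 0" by (simp add: tail_sum_def)
      ultimately show ?thesis using I B m 2
        unfolding step_defs by simp
    next
      case 3
      then have "\<not> successor ?n J m" by (auto simp: successor_def split: if_splits)
      note e3 = e'[OF this]
      show ?thesis
      proof (cases "m = 0")
        case True
        then have "J + 1 \<noteq> ?n" using 3 by simp
        then show ?thesis using True e3 I B m J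
          unfolding step_defs by simp
      next
        case False
        then have "\<not> J + m < ?n" using 3 by simp
        then show ?thesis using False e3 I B m J
          unfolding step_defs by (simp add: All_less_Suc)
      qed
    qed
    from run_wp[OF this] m
    show "m < 2 * ?n + 1 \<and> run B init_step s (max_steps init_step) (Inv (Suc m))" by blast
  next
    fix m s assume "Inv m s" "\<not> bval s ?b"
    then show "keep sw J F K C s \<and> (\<forall>y\<le>2 * ?n. table sw J F K 0 s y)"
      by (simp add: Inv_def keep_def weights_are_def)
  qed (simp add: init_step_def)
qed

end

text \<open>The condition of \<open>conv_entry_Suc\<close>, rewritten with negation and conjunction
  because the language has no disjunction.\<close>

definition improves :: bexp where
  "improves =
     BAnd (BNot (IEq (Cell ''gk'' (Minus (V ''y'') (V ''p''))) (Num 0)))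
       (BNot (BAnd (BNot (IEq (Cell ''gk'' (V ''y'')) (Num 0)))
         (BAnd (BNot (WLess (WCell ''gw'' (Minus (V ''y'') (V ''p''))) (WCell ''gw'' (V ''y''))))
           (BNot (BAnd (BNot (WLess (WCell ''gw'' (V ''y'')) (WCell ''gw'' (Minus (V ''y'') (V ''p'')))))
             (ILess (Plus (Cell ''gk'' (Minus (V ''y'') (V ''p''))) (Num 1)) (Cell ''gk'' (V ''y''))))))))"

text \<open>The index \<open>y\<close> runs downwards from \<open>2 * n\<close>, so entry
  \<open>y - p\<close> has not yet been updated in this round when it is read, and one table
  suffices. The last index treated is \<open>y = p\<close>, below which no source at distance at
  least \<open>p\<close> exists.\<close>

definition conv_step :: com where
  "conv_step =
     Assign ''y'' (Minus (V ''y'') (Num 1)) ;;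
     Cond improves
       (WStore ''gw'' (V ''y'') (WCell ''gw'' (Minus (V ''y'') (V ''p''))) ;;
        Store ''gc'' (V ''y'') (Cell ''gc'' (Minus (V ''y'') (V ''p''))) ;;
        Store ''gk'' (V ''y'') (Plus (Cell ''gk'' (Minus (V ''y'') (V ''p''))) (Num 1)))
       Skip"

lemma conv_entry_choice_le:
  "conv_entry S f m b y a k x \<Longrightarrow> k \<noteq> 0 \<Longrightarrow> x \<le> y"
  by (simp add: conv_entry_def)

context
  fixes sw :: "real list" and B J :: nat and F K C
  assumes B: "length sw * length sw + 20 * length sw + 20 \<le> B"
    and rows: "rows sw F K C (Suc J)" and J: "1 \<le> J" "J < length sw"
begin

lemma table_bound: "table sw J F K b s y \<Longrightarrow> iarr s ''gk'' y \<le> 3 * length sw + 1 + y"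
  unfolding table_def by (rule conv_entry_bound, assumption) (rule next_count_bounds(2)[OF rows])

lemma run_conv_round:
  assumes k0: "keep sw J F K C s" and t0: "\<forall>y\<le>2 * length sw. table sw J F K b s y"
    and p0: "ivar s ''p'' = 2 ^ b" "2 ^ b \<le> 2 * length sw"
  shows "run B (Assign ''y'' lim ;; While (ILess (V ''p'') (V ''y'')) conv_step) s
    (200 * length sw + 150) (\<lambda>s. keep sw J F K C s \<and> ivar s ''p'' = 2 ^ b \<and>
      (\<forall>y\<le>2 * length sw. table sw J F K (Suc b) s y))"
proof -
  let ?n = "length sw" and ?b = "ILess (V ''p'') (V ''y'')"
  \<comment> \<open>Entries from the current index upwards belong to round \<open>Suc b\<close>, the
    others still to round \<open>b\<close>.\<close>
  define Inv where "Inv = (\<lambda>m (s :: state). keep sw J F K C s \<and> ivar s ''p'' = 2 ^ b \<and>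
    ivar s ''y'' + m = 2 * ?n + 1 \<and> 2 ^ b \<le> ivar s ''y'' \<and>
    (\<forall>y\<le>2 * ?n. table sw J F K (if y < ivar s ''y'' then b else Suc b) s y))"
  let ?Q = "\<lambda>s. keep sw J F K C s \<and> ivar s ''p'' = 2 ^ b \<and> (\<forall>y\<le>2 * ?n. table sw J F K (Suc b) s y)"
  have pos: "(1 :: nat) \<le> 2 ^ b" by simp
  show ?thesis
  proof (rule run_loop[where Inv = Inv and M = "(2 * ?n + 1)" and k = "max_steps conv_step"])
    show "wp B (Assign ''y'' lim) (Inv 0) s"
      using assms B by (simp add: Inv_def keep_defs table_def)
  next
    fix m s assume "Inv m s"
    then show "bfits B s ?b" using B p0 by (simp add: Inv_def keep_def weights_are_def)
  next
    fix m s assume I: "Inv m s" and b: "bval s ?b"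
    define y where "y = ivar s ''y'' - 1"
    have y: "ivar s ''y'' = Suc y" "2 ^ b \<le> y" "y + Suc m = 2 * ?n + 1" "y \<le> 2 * ?n"
      using I b by (auto simp: Inv_def y_def)
    let ?z = "y - 2 ^ b"
    have z: "?z < y" "?z \<le> 2 * ?n" using y pos by linarith+
    have p: "ivar s ''p'' = 2 ^ b" using I by (simp add: Inv_def)
    have ty: "table sw J F K b s y" and tz: "table sw J F K b s ?z"
    proof -
      have t: "table sw J F K (if k < Suc y then b else Suc b) s k" if "k \<le> 2 * ?n" for k
        using I that unfolding Inv_def y(1) by blast
      show "table sw J F K b s y" using t[OF y(4)] by simp
      show "table sw J F K b s ?z" using t[OF z(2)] z(1) by simp
    qed
    let ?a = "warr s ''gw'' y" and ?k = "iarr s ''gk'' y" and ?x = "iarr s ''gc'' y"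
    let ?a' = "warr s ''gw'' ?z" and ?k' = "iarr s ''gk'' ?z" and ?x' = "iarr s ''gc'' ?z"
    let ?ce = "conv_entry (successor ?n J) (next_cost ?n J F) (next_count ?n J K) (Suc b) y"
    let ?c = "?k' \<noteq> 0 \<and> (?k = 0 \<or> ?a' < ?a \<or> \<not> ?a < ?a' \<and> ?k' + 1 < ?k)"
    have upd: "if ?c then ?ce ?a' (?k' + 1) ?x' else ?ce ?a ?k ?x"
      using conv_entry_Suc[OF ty[unfolded table_def] tz[unfolded table_def] y(2)] .
    have bounds: "?k \<le> 5 * ?n + 1" "?k' \<le> 5 * ?n + 1"
      using table_bound[OF ty] table_bound[OF tz] y(4) z(2) by auto
    have old: "table sw J F K (if k < y then b else Suc b) s k" if "k \<le> 2 * ?n" "k \<noteq> y" for k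
    proof -
      have "table sw J F K (if k < Suc y then b else Suc b) s k"
        using I that unfolding Inv_def y(1) by blast
      then show ?thesis using that by (cases "k < y") auto
    qed
    have kp: "keep sw J F K C s" using I by (simp add: Inv_def)
    let ?s = "s\<lparr>ivar := (ivar s)(''y'' := y)\<rparr>"
    have fits: "bfits B ?s improves" and val: "bval ?s improves \<longleftrightarrow> ?c"
      using p y z bounds B by (auto simp: improves_def)
    have "wp B conv_step (Inv (Suc m)) s"
    proof (cases ?c)
      case True
      then have v: "bval ?s improves" using val by blast
      have new: "?ce ?a' (Suc ?k') ?x'" using upd True by simp
      have "?x' \<le> ?z" using conv_entry_choice_le tz[unfolded table_def] True by blast
      then show ?thesis using v fits new old kp p y z bounds B p0
        unfolding Inv_def conv_step_def keep_defs table_def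
        by simp
    next
      case False
      then have v: "\<not> bval ?s improves" using val by blast
      have "table sw J F K (Suc b) s y" using upd False unfolding table_def by argo
      then have "table sw J F K (if k < y then b else Suc b) s k" if "k \<le> 2 * ?n" for k
        using old[OF that] by (cases "k = y") auto
      then show ?thesis using v fits kp p y z bounds B p0
        unfolding Inv_def conv_step_def keep_defs table_def
        by simp
    qed
    from run_wp[OF this] y(3) 
    show "m < 2 * ?n + 1 \<and> run B conv_step s (max_steps conv_step) (Inv (Suc m))" by auto
  next
    fix m s assume I: "Inv m s" and nb: "\<not> bval s ?b"
    then have y: "ivar s ''y'' = 2 ^ b" by (simp add: Inv_def)
    have "table sw J F K (Suc b) s k" if "k \<le> 2 * ?n" for k
    proof (cases "k < 2 ^ b")
      case True
      \<comment> \<open>These entries were not visited, but for indices below \<open>2 ^ b\<close>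
        both rounds have the same candidates.\<close>
      have "table sw J F K (if k < 2 ^ b then b else Suc b) s k"
        using I that unfolding Inv_def y by blast
      then have "table sw J F K b s k" using True by simp
      then show ?thesis unfolding table_def using True by (rule conv_entry_small)
    next
      case False
      have "table sw J F K (if k < 2 ^ b then b else Suc b) s k"
        using I that unfolding Inv_def y by blast
      then show ?thesis using False by simp
    qed
    then show "?Q s" using I by (simp add: Inv_def)
  qed (simp add: conv_step_def improves_def)
qed

end

definition conv_rounds :: com where
  "conv_rounds =
     Assign ''p'' (Num 1) ;;
     While (ILess (V ''p'') lim)
       ((Assign ''y'' lim ;; While (ILess (V ''p'') (V ''y'')) conv_step) ;;
        Assign ''p'' (Plus (V ''p'') (V ''p'')))"

definition store_step :: com where
  "store_step =
     WStore ''fw'' (entry (V ''J'') (V ''I''))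
       (WPlus (WCell ''sfx'' (Minus (Plus (V ''J'') (Num 1)) (Plus (V ''I'') (V ''I''))))
         (WCell ''gw'' (Plus (V ''I'') (V ''I'')))) ;;
     Store ''fk'' (entry (V ''J'') (V ''I'')) (Cell ''gk'' (Plus (V ''I'') (V ''I''))) ;;
     Store ''fc'' (entry (V ''J'') (V ''I'')) (Cell ''gc'' (Plus (V ''I'') (V ''I''))) ;;
     Assign ''I'' (Plus (V ''I'') (Num 1))"

definition dp_row :: com where
  "dp_row =
     (Assign ''y'' (Num 0) ;; While (ILess (V ''y'') lim) init_step) ;;
     conv_rounds ;;
     Assign ''I'' (Num 1) ;; While (ILess (V ''I'') (Plus (V ''J'') (Num 1))) store_step"

definition dp_ok :: "real list \<Rightarrow> nat \<Rightarrow> state \<Rightarrow> bool" where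
  "dp_ok sw J s \<longleftrightarrow> weights_are s sw \<and> sums_are s sw \<and> ivar s ''J'' = J \<and>
     rows sw (warr s ''fw'') (iarr s ''fk'') (iarr s ''fc'') J"

context
  fixes sw :: "real list" and B J L :: nat and F K C
  assumes B: "length sw * length sw + 20 * length sw + 20 \<le> B"
    and rows: "rows sw F K C (Suc J)" and J: "1 \<le> J" "J < length sw"
    and L: "2 * length sw + 1 \<le> 2 ^ L"
begin

lemma run_conv_rounds:
  assumes k0: "keep sw J F K C s" and t0: "\<forall>y\<le>2 * length sw. table sw J F K 0 s y"
  shows "run B conv_rounds s (L * (200 * length sw + 170) + 20)
    (\<lambda>s. keep sw J F K C s \<and>
      (\<exists>b. 2 * length sw < 2 ^ b \<and> (\<forall>y\<le>2 * length sw. table sw J F K b s y)))"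
proof -
  let ?n = "length sw" and ?b = "ILess (V ''p'') lim"
  let ?c = "(Assign ''y'' lim ;; While (ILess (V ''p'') (V ''y'')) conv_step) ;;
        Assign ''p'' (Plus (V ''p'') (V ''p''))"
  let ?k = "(200 * ?n + 150) + 4 + 1"
  let ?Q = "\<lambda>s. keep sw J F K C s \<and> (\<exists>b. 2 * ?n < 2 ^ b \<and> (\<forall>y\<le>2 * ?n. table sw J F K b s y))"
  \<comment> \<open>The bound \<open>4 * n\<close> keeps \<open>p\<close> within the word size: it
    is doubled only while at most \<open>2 * n\<close>.\<close>
  define Inv where "Inv = (\<lambda>b (s :: state). keep sw J F K C s \<and> ivar s ''p'' = 2 ^ b \<and>
    2 ^ b \<le> 4 * ?n \<and> (\<forall>y\<le>2 * ?n. table sw J F K b s y))"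
  show ?thesis
    unfolding conv_rounds_def
  proof (rule run_loop[where Inv = Inv and M = "L" and k = "?k"])
    show "wp B (Assign ''p'' (Num 1)) (Inv 0) s"
      using assms J B by (simp add: Inv_def keep_defs table_def)
  next
    fix b s assume "Inv b s"
    then show "bfits B s ?b" using B by (simp add: Inv_def keep_def weights_are_def)
  next
    fix b s assume I: "Inv b s" and bv: "bval s ?b"
    have p: "(2 :: nat) ^ b \<le> 2 * ?n" using I bv by (simp add: Inv_def keep_def weights_are_def)
    then have "(2 :: nat) ^ b < 2 ^ L" using L by linarith
    then have "b < L" by (rule power_less_imp_less_exp[rotated]) simp
    moreover have "run B ?c s ?k (Inv (Suc b))"
    proof (rule run_Seq)
      show "run B (Assign ''y'' lim ;; While (ILess (V ''p'') (V ''y'')) conv_step) s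
        (200 * ?n + 150) (\<lambda>s. keep sw J F K C s \<and> ivar s ''p'' = 2 ^ b \<and>
          (\<forall>y\<le>2 * ?n. table sw J F K (Suc b) s y))"
        using I p by (intro run_conv_round[OF B rows J]) (simp_all add: Inv_def)
    next
      fix s assume "keep sw J F K C s \<and> ivar s ''p'' = 2 ^ b \<and>
          (\<forall>y\<le>2 * ?n. table sw J F K (Suc b) s y)"
      then have "wp B (Assign ''p'' (Plus (V ''p'') (V ''p''))) (Inv (Suc b)) s"
        using p B by (simp add: Inv_def keep_defs table_def)
      then show "run B (Assign ''p'' (Plus (V ''p'') (V ''p''))) s 4 (Inv (Suc b))"
        by (rule run_wpI) simp
    qed
    ultimately show "b < L \<and> run B ?c s ?k (Inv (Suc b))" ..
  next
    fix b s assume I: "Inv b s" and bv: "\<not> bval s ?b"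
    then have "2 * ?n < 2 ^ b" by (simp add: Inv_def keep_def weights_are_def)
    then show "?Q s" using I unfolding Inv_def by blast
  qed (simp add: algebra_simps)
qed

lemma run_store:
  assumes k0: "keep sw J F K C s" and t0: "\<forall>y\<le>2 * length sw. table sw J F K b s y"
    and b: "2 * length sw < 2 ^ b"
  shows "run B (Assign ''I'' (Num 1) ;; While (ILess (V ''I'') (Plus (V ''J'') (Num 1))) store_step) s
    (70 * length sw + 60) (dp_ok sw J)"
proof -
  let ?n = "length sw" and ?b = "ILess (V ''I'') (Plus (V ''J'') (Num 1))"
  \<comment> \<open>The later rows are preserved by index: row \<open>J\<close> is stored at
    \<open>J * n + I\<close> with \<open>I \<le> J < n\<close>, which is below
    \<open>(J + 1) * n\<close>.\<close>
  define Inv where "Inv = (\<lambda>m (s :: state). weights_are s sw \<and> sums_are s sw \<and>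
    ivar s ''J'' = J \<and> ivar s ''I'' = m + 1 \<and> m \<le> J \<and>
    (\<forall>y\<le>2 * ?n. table sw J F K b s y) \<and>
    (\<forall>q\<ge>(J + 1) * ?n. warr s ''fw'' q = F q \<and> iarr s ''fk'' q = K q \<and> iarr s ''fc'' q = C q) \<and>
    (\<forall>I. 1 \<le> I \<longrightarrow> I \<le> m \<longrightarrow> cell sw (warr s ''fw'') (iarr s ''fk'') (iarr s ''fc'') J I))"
  show ?thesis
  proof (rule run_loop[where Inv = Inv and M = "?n" and k = "max_steps store_step"])
    show "wp B (Assign ''I'' (Num 1)) (Inv 0) s"
      using assms B by (simp add: Inv_def keep_defs table_def)
  next
    fix m s assume "Inv m s"
    then show "bfits B s ?b" using B J by (simp add: Inv_def)
  next
    fix m s assume I: "Inv m s" and bv: "bval s ?b"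
    have m: "Suc m \<le> J" using I bv by (simp add: Inv_def)
    let ?I = "Suc m" and ?q = "J * ?n + Suc m"
    have q: "?q < ?n * ?n" "?q < (J + 1) * ?n" using m J table_index_less[of J ?n "Suc m"] by auto
    have q': "J * ?n \<le> ?n * ?n" using q(1) by linarith
    have t: "table sw J F K b s (2 * ?I)" using I m J unfolding Inv_def by simp
    let ?a = "warr s ''gw'' (2 * ?I)" and ?k = "iarr s ''gk'' (2 * ?I)" and ?x = "iarr s ''gc'' (2 * ?I)"
    have "2 * ?I \<le> 2 * ?n" using m J by simp
    then have "2 * ?I < 2 ^ b" using b by (rule le_less_trans)
    from cell_of_conv_entry[OF rows t[unfolded table_def] this _ J(2)]
    have x: "?x \<le> 2 * ?I" and ex: "\<exists>cs. optimal_profile sw J ?I ((2 * ?I - ?x) # cs) \<and>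
      tail_sum sw (J + 1 - 2 * ?I) + ?a = profile_cost sw J ?I ((2 * ?I - ?x) # cs) \<and>
      ?k = popcounts ((2 * ?I - ?x) # cs) + 1" by auto
    have kb: "?k \<le> 5 * ?n + 1"
      by (rule le_trans[OF table_bound[OF B rows J t]]) (use m J in simp)
    let ?fw = "(warr s ''fw'')(?q := tail_sum sw (J + 1 - 2 * ?I) + ?a)"
      and ?fk = "(iarr s ''fk'')(?q := ?k)" and ?fc = "(iarr s ''fc'')(?q := ?x)"
    have new: "cell sw ?fw ?fk ?fc J ?I"
      unfolding cell_def Let_def fun_upd_same using x ex by blast
    have "cell sw ?fw ?fk ?fc J I'" if "1 \<le> I'" "I' \<le> Suc m" for I'
    proof (cases "I' = Suc m")
      case True
      then show ?thesis using new by simp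
    next
      case False
      then have "cell sw (warr s ''fw'') (iarr s ''fk'') (iarr s ''fc'') J I'"
        using I that by (simp add: Inv_def)
      then show ?thesis using False unfolding cell_def by simp
    qed
    moreover have "?fw q = F q \<and> ?fk q = K q \<and> ?fc q = C q" if "(J + 1) * ?n \<le> q" for q
    proof -
      have "q \<noteq> ?q" using that q(2) by linarith
      moreover have "warr s ''fw'' q = F q \<and> iarr s ''fk'' q = K q \<and> iarr s ''fc'' q = C q"
        using I that unfolding Inv_def by blast
      ultimately show ?thesis by simp
    qed
    ultimately have post: "Inv (Suc m) (s\<lparr>warr := (warr s)(''fw'' := ?fw),
        iarr := (iarr s)(''fk'' := ?fk, ''fc'' := ?fc), ivar := (ivar s)(''I'' := Suc (Suc m))\<rparr>)"
      using I m by (simp add: Inv_def weights_are_def sums_are_def table_def)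
    have sfx: "warr s ''sfx'' (J + 1 - 2 * ?I) = tail_sum sw (J + 1 - 2 * ?I)"
      using I J unfolding Inv_def sums_are_def by simp
    have i: "ivar s ''I'' = Suc m" "ivar s ''J'' = J" "ivar s ''n'' = ?n"
      using I by (simp_all add: Inv_def weights_are_def)
    have "wp B store_step (Inv (Suc m)) s"
      using post sfx i q q' B m J kb x unfolding store_step_def
      by (simp add: mult_2)
    from run_wp[OF this] m J
    show "m < ?n \<and> run B store_step s (max_steps store_step) (Inv (Suc m))" by simp
  next
    fix m s assume I: "Inv m s" and bv: "\<not> bval s ?b"
    then have m: "m = J" by (simp add: Inv_def)
    have "cell sw (warr s ''fw'') (iarr s ''fk'') (iarr s ''fc'') J' I'"
      if "J \<le> J'" "J' < ?n" "1 \<le> I'" "I' \<le> J'" for J' I'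
    proof (cases "J' = J")
      case True
      then show ?thesis using I m that by (simp add: Inv_def)
    next
      case False
      then have c: "cell sw F K C J' I'" using rows that unfolding rows_def by simp
      have "(J + 1) * ?n \<le> J' * ?n" using False that by (intro mult_right_mono) auto
      then have "(J + 1) * ?n \<le> J' * ?n + I'" by linarith
      then have "warr s ''fw'' (J' * ?n + I') = F (J' * ?n + I')"
        "iarr s ''fk'' (J' * ?n + I') = K (J' * ?n + I')"
        "iarr s ''fc'' (J' * ?n + I') = C (J' * ?n + I')"
        using I unfolding Inv_def by blast+
      then show ?thesis using c unfolding cell_def by simp
    qed
    then show "dp_ok sw J s" using I unfolding Inv_def dp_ok_def rows_def by blast
  qed (simp add: store_step_def)
qed

lemma run_dp_row:
  assumes "keep sw J F K C s"
  shows "run B dp_row s ((L + 1) * (200 * length sw + 180)) (dp_ok sw J)"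
proof -
  have "run B dp_row s ((120 * length sw + 90) + ((L * (200 * length sw + 170) + 20)
      + (70 * length sw + 60) + 1) + 1) (dp_ok sw J)"
    unfolding dp_row_def
    by (rule run_Seq[OF run_init[OF B rows J assms]], elim conjE,
        rule run_Seq[OF run_conv_rounds], assumption+, elim conjE exE) (rule run_store)
  then show ?thesis by (rule run_mono) (simp_all add: algebra_simps)
qed

end

text \<open>Row \<open>J\<close> refers only to rows \<open>J + x\<close> with \<open>x > 0\<close>
  and to the finished tree, so rows are computed for \<open>J = n - 1\<close> down to 1.\<close>

definition dp :: com where
  "dp =
     Assign ''J'' (V ''n'') ;;
     While (ILess (Num 1) (V ''J''))
       (Assign ''J'' (Minus (V ''J'') (Num 1)) ;; dp_row)"

lemma run_dp:
  assumes B: "length sw * length sw + 20 * length sw + 20 \<le> B"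
    and L: "2 * length sw + 1 \<le> 2 ^ L" and n: "1 \<le> length sw"
    and w: "weights_are s sw" "sums_are s sw"
  shows "run B dp s (length sw * ((L + 1) * (200 * length sw + 200)) + 10) (dp_ok sw 1)"
proof -
  let ?n = "length sw" and ?b = "ILess (Num 1) (V ''J'')"
  let ?c = "Assign ''J'' (Minus (V ''J'') (Num 1)) ;; dp_row"
  let ?k = "4 + (L + 1) * (200 * ?n + 180) + 1"
  define Inv where "Inv = (\<lambda>m s. \<exists>J. dp_ok sw J s \<and> J + m = ?n \<and> 1 \<le> J)"
  show ?thesis
    unfolding dp_def
  proof (rule run_loop[where Inv = Inv and M = "?n" and k = "?k"])
    \<comment> \<open>No \<open>J\<close> satisfies \<open>n \<le> J < n\<close>, so arbitrary table
      contents are a valid start.\<close>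
    have "rows sw F K C ?n" for F K C by (simp add: rows_def)
    then show "wp B (Assign ''J'' (V ''n'')) (Inv 0) s"
      using w B n by (simp add: Inv_def dp_ok_def weights_are_def sums_are_def)
  next
    fix m s assume "Inv m s"
    then show "bfits B s ?b" using B by (auto simp: Inv_def dp_ok_def)
  next
    fix m s assume "Inv m s" and bv: "bval s ?b"
    then obtain J where I: "dp_ok sw J s" "J + m = ?n" by (auto simp: Inv_def)
    have J: "1 < J" using bv I(1) by (simp add: dp_ok_def)
    define J' where "J' = J - 1"
    have J': "J = Suc J'" "1 \<le> J'" "J' < ?n" using J I(2) by (auto simp: J'_def)
    let ?F = "warr s ''fw''" and ?K = "iarr s ''fk''" and ?C = "iarr s ''fc''"
    have r: "rows sw ?F ?K ?C (Suc J')" using I(1) J'(1) by (simp add: dp_ok_def)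
    have "run B ?c s ?k (dp_ok sw J')"
    proof (rule run_Seq)
      have "wp B (Assign ''J'' (Minus (V ''J'') (Num 1))) (keep sw J' ?F ?K ?C) s"
        using I(1) J' B by (simp add: dp_ok_def keep_defs)
      then show "run B (Assign ''J'' (Minus (V ''J'') (Num 1))) s 4 (keep sw J' ?F ?K ?C)"
        by (rule run_wpI) simp
    qed (rule run_dp_row[OF B r J'(2,3) L])
    then have "run B ?c s ?k (Inv (Suc m))"
    proof (rule run_mono)
      fix s' assume "dp_ok sw J' s'"
      then show "Inv (Suc m) s'" using I(2) J' unfolding Inv_def by auto
    qed simp
    then show "m < ?n \<and> run B ?c s ?k (Inv (Suc m))" using I(2) J by simp
  next
    fix m s assume "Inv m s" and bv: "\<not> bval s ?b"
    then obtain J where I: "dp_ok sw J s" "1 \<le> J" by (auto simp: Inv_def)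
    then have "J = 1" using bv by (simp add: dp_ok_def)
    then show "dp_ok sw 1 s" using I by simp
  qed (simp add: algebra_simps)
qed

section \<open>Recovering optimal level counts from the table\<close>

definition read_off_step :: com where
  "read_off_step =
     Assign ''c'' (Cell ''fc'' (entry (V ''J'') (V ''I''))) ;;
     Assign ''h'' (Plus (V ''h'') (Num 1)) ;;
     Store ''r'' (V ''h'') (Minus (Plus (V ''I'') (V ''I'')) (V ''c'')) ;;
     Store ''o'' (V ''h'') (Minus (Plus (V ''J'') (Num 1)) (Plus (V ''I'') (V ''I''))) ;;
     Assign ''J'' (Plus (V ''J'') (V ''c'')) ;;
     Assign ''I'' (V ''c'')"

definition read_off :: com where
  "read_off =
     (Assign ''h'' (Num 0) ;;
      Assign ''J'' (Num 1) ;;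
      Cond (IEq (V ''n'') (Num 1))
        (Assign ''I'' (Num 0) ;; Store ''r'' (Num 0) (Num 1))
        (Assign ''I'' (Num 1))) ;;
     While (ILess (Num 0) (V ''I'')) read_off_step"

text \<open>\<open>ns\<close> lists the numbers of leaves of depth \<open>0, \<dots>, h\<close>; the weights of the leaves of depth \<open>d\<close> start
  at index \<open>o d\<close> of the sorted weights.\<close>

definition levels_are :: "state \<Rightarrow> nat list \<Rightarrow> bool" where
  "levels_are s ns \<longleftrightarrow> ivar s ''h'' + 1 = length ns \<and>
     (\<forall>d<length ns. iarr s ''r'' d = ns ! d \<and> iarr s ''o'' d = sum_list (take d ns))"

text \<open>The bound on \<open>length ns\<close> keeps the number of levels linear in
  \<open>n\<close>, which limits the loops that build the tree.\<close>

definition optimal_levels :: "real list \<Rightarrow> nat list \<Rightarrow> bool" where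
  "optimal_levels sw ns \<longleftrightarrow> length ns \<le> length sw \<and>
     (if length sw = 1 then ns = [1] else \<exists>cs. ns = 0 # cs \<and> optimal_profile sw 1 1 cs)"

text \<open>With the first count fixed, all competitors are shifted by the same cost and the same
  popcount, so the comparison carries over to the tails.\<close>

lemma optimal_profile_tail:
  assumes "optimal_profile sw J I (c # cs)"
  shows "optimal_profile sw (J + (2 * I - c)) (2 * I - c) cs"
  unfolding optimal_profile_def
proof (intro conjI allI impI)
  let ?I = "2 * I - c"
  let ?J = "J + ?I"
  have p: "0 < I" "c \<le> 2 * I" "profile (length sw) ?J ?I cs"
    using assms unfolding optimal_profile_def profile.simps by blast+
  show "profile (length sw) ?J ?I cs" by (rule p(3))
  fix ds assume "profile (length sw) ?J ?I ds"
  then have "profile (length sw) J I (c # ds)" using p by simp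
  then have "lex_le (profile_cost sw J I (c # cs)) (popcounts (c # cs))
      (profile_cost sw J I (c # ds)) (popcounts (c # ds))"
    using assms unfolding optimal_profile_def by blast
  then show "lex_le (profile_cost sw ?J ?I cs) (popcounts cs) (profile_cost sw ?J ?I ds) (popcounts ds)"
    unfolding profile_cost.simps popcounts_simps lex_le_def by linarith
qed

lemma run_read_off:
  assumes B: "length sw * length sw + 20 * length sw + 20 \<le> B" and n: "1 \<le> length sw"
    and dp: "dp_ok sw 1 s"
    and z: "iarr s ''r'' = (\<lambda>_. 0)" "iarr s ''o'' = (\<lambda>_. 0)"
  shows "run B read_off s (50 * length sw + 50)
    (\<lambda>s. weights_are s sw \<and> (\<exists>ns. levels_are s ns \<and> optimal_levels sw ns))"
proof -
  let ?n = "length sw" and ?b = "ILess (Num 0) (V ''I'')"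
  let ?init = "Assign ''h'' (Num 0) ;; Assign ''J'' (Num 1) ;;
     Cond (IEq (V ''n'') (Num 1))
       (Assign ''I'' (Num 0) ;; Store ''r'' (Num 0) (Num 1))
       (Assign ''I'' (Num 1))"
  let ?Q = "\<lambda>s. weights_are s sw \<and> (\<exists>ns. levels_are s ns \<and> optimal_levels sw ns)"
  \<comment> \<open>\<open>ps\<close> holds the counts read so far; every optimal continuation from
    the current state completes it to an optimum. Each level with inner nodes adds at least one to
    \<open>J\<close>, and this bounds the number \<open>m\<close> of iterations; the final step to
    \<open>I = 0\<close> adds none, whence the extra 1.\<close>
  define part where "part = (\<lambda>m J I ns. if ?n = 1 then I = 0 \<and> ns = [1]
     else \<exists>ps cs. ns = 0 # ps \<and> optimal_profile sw J I cs \<and> J < ?n \<and>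
       m + 1 \<le> J + (if I = 0 then 1 else 0) \<and> sum_list ps + 2 * I = J + 1 \<and>
       (\<forall>cs. optimal_profile sw J I cs \<longrightarrow> optimal_profile sw 1 1 (ps @ cs)))"
  define Inv where "Inv = (\<lambda>m (s :: state). \<exists>J I ns. weights_are s sw \<and>
    rows sw (warr s ''fw'') (iarr s ''fk'') (iarr s ''fc'') 1 \<and>
    ivar s ''J'' = J \<and> ivar s ''I'' = I \<and> m + 1 = length ns \<and> levels_are s ns \<and> part m J I ns)"
  show ?thesis
    unfolding read_off_def
  proof (rule run_loop[where Inv = Inv and M = "?n" and k = "max_steps read_off_step"])
    show "wp B ?init (Inv 0) s"
    proof (cases "?n = 1")
      case True
      then have "Inv 0 (s\<lparr>ivar := (ivar s)(''h'' := 0, ''J'' := 1, ''I'' := 0),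
        iarr := (iarr s)(''r'' := (iarr s ''r'')(0 := 1))\<rparr>)"
        using dp z by (simp add: Inv_def part_def dp_ok_def weights_are_def levels_are_def)
      then show ?thesis using True B dp by (simp add: dp_ok_def weights_are_def)
    next
      case False
      then have n2: "1 < ?n" using n by simp
      then have "cell sw (warr s ''fw'') (iarr s ''fk'') (iarr s ''fc'') 1 1"
        using dp by (simp add: dp_ok_def rows_def)
      then obtain cs where cs: "optimal_profile sw 1 1 cs" unfolding cell_def Let_def by blast
      have alt: "part 0 1 1 [0]"
        unfolding part_def if_not_P[OF False]
        by (rule exI[of _ "[]"], rule exI[of _ cs]) (use cs n2 in simp)
      have "Inv 0 (s\<lparr>ivar := (ivar s)(''h'' := 0, ''J'' := 1, ''I'' := 1)\<rparr>)"
        unfolding Inv_def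
        by (rule exI[of _ 1], rule exI[of _ 1], rule exI[of _ "[0]"], intro conjI)
          (use dp z False alt in \<open>simp_all add: dp_ok_def weights_are_def levels_are_def\<close>)
      then show ?thesis using False B dp by (simp add: dp_ok_def weights_are_def)
    qed
  next
    fix m s assume "Inv m s"
    then obtain J ns where "part m J (ivar s ''I'') ns" unfolding Inv_def by blast
    then have "ivar s ''I'' \<le> ?n" unfolding part_def by (auto split: if_splits)
    then show "bfits B s ?b" using B by simp
  next
    fix m s assume "Inv m s" and bv: "bval s ?b"
    then obtain J I ns where I: "weights_are s sw"
      "rows sw (warr s ''fw'') (iarr s ''fk'') (iarr s ''fc'') 1"
      "ivar s ''J'' = J" "ivar s ''I'' = I" "m + 1 = length ns" "levels_are s ns"
      and alt: "part m J I ns"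
      unfolding Inv_def by blast
    have Ip: "0 < I" using bv I(4) by simp
    then have n1: "?n \<noteq> 1" using alt by (auto simp: part_def)
    then obtain ps where ps: "ns = 0 # ps" "J < ?n" "m + 1 \<le> J" "sum_list ps + 2 * I = J + 1"
      and opt: "\<And>cs. optimal_profile sw J I cs \<Longrightarrow> optimal_profile sw 1 1 (ps @ cs)"
      using alt Ip by (auto simp: part_def)
    let ?q = "J * ?n + I"
    define x where "x = iarr s ''fc'' ?q"
    have IJ: "I \<le> J" using ps(4) Ip by linarith
    have "cell sw (warr s ''fw'') (iarr s ''fk'') (iarr s ''fc'') J I"
      using I(2) ps(2) Ip IJ unfolding rows_def by simp
    then obtain cs where x: "x \<le> 2 * I" and cs: "optimal_profile sw J I ((2 * I - x) # cs)"
      unfolding cell_def Let_def x_def by blast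
    have xx: "2 * I - (2 * I - x) = x" using x by simp
    have p: "profile ?n (J + x) x cs"
      using cs xx by (simp add: optimal_profile_def)
    \<comment> \<open>The entry certifies one optimal tail, but later lookups may take another;
      \<open>optimal_profile_cong\<close> admits all of them.\<close>
    have opt': "optimal_profile sw 1 1 ((ps @ [2 * I - x]) @ cs')"
      if "optimal_profile sw (J + x) x cs'" for cs'
      using opt[OF optimal_profile_cong[OF cs]] that xx by simp
    have ocs: "optimal_profile sw (J + x) x cs"
      by (rule optimal_profile_tail[OF cs, unfolded xx])
    have Jx: "J + x < ?n" using profile_successor[OF p] by simp
    let ?s = "s\<lparr>iarr := (iarr s)(''r'' := (iarr s ''r'')(Suc m := 2 * I - x),
          ''o'' := (iarr s ''o'')(Suc m := J + 1 - 2 * I)),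
        ivar := (ivar s)(''c'' := x, ''h'' := Suc m, ''J'' := J + x, ''I'' := x)\<rparr>"
    have h: "ivar s ''h'' = m" using I(5,6) by (simp add: levels_are_def)
    have lv: "levels_are ?s (ns @ [2 * I - x])"
    proof -
      have "sum_list ns = J + 1 - 2 * I" using ps(1,4) by simp
      then show ?thesis using I(5,6) unfolding levels_are_def
        by (auto simp: nth_append less_Suc_eq)
    qed
    have "Inv (Suc m) ?s"
      unfolding Inv_def
    proof (intro exI conjI)
      show "levels_are ?s (ns @ [2 * I - x])" by (rule lv)
      have "ns @ [2 * I - x] = 0 # (ps @ [2 * I - x])" using ps(1) by simp
      moreover have "Suc m + 1 \<le> (J + x) + (if x = 0 then 1 else 0)" using ps(3) by simp
      moreover have "sum_list (ps @ [2 * I - x]) + 2 * x = J + x + 1"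
        using ps(4) x by simp
      ultimately show "part (Suc m) (J + x) x (ns @ [2 * I - x])"
        unfolding part_def using n1 ocs Jx opt' by auto
    qed (use I in \<open>simp_all add: weights_are_def\<close>)
    moreover have "?q < ?n * ?n" "J * ?n \<le> ?q"
      using ps(2) IJ table_index_less[of J ?n I] by auto
    ultimately have "wp B read_off_step (Inv (Suc m)) s"
      using I(1,3,4) h x Jx ps(2,3) IJ B unfolding read_off_step_def weights_are_def
      by (simp add: x_def[symmetric] mult_2 fun_upd_twist)
    from run_wp[OF this] ps(2,3)
    show "m < ?n \<and> run B read_off_step s (max_steps read_off_step) (Inv (Suc m))" by simp
  next
    fix m s assume "Inv m s" and bv: "\<not> bval s ?b"
    then obtain J ns where I: "weights_are s sw" "m + 1 = length ns" "levels_are s ns"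
      and "part m J (ivar s ''I'') ns"
      unfolding Inv_def by blast
    then have alt: "part m J 0 ns" using bv by simp
    have "optimal_levels sw ns"
    proof (cases "?n = 1")
      case True
      then show ?thesis using alt by (simp add: part_def optimal_levels_def)
    next
      case False
      then obtain ps where ps: "ns = 0 # ps" "J + 1 = ?n" "m \<le> J"
        "\<And>cs. optimal_profile sw J 0 cs \<Longrightarrow> optimal_profile sw 1 1 (ps @ cs)"
        using alt by (auto simp: part_def)
      have "optimal_profile sw 1 1 ps" using ps(4)[of "[]"] ps(2) by simp
      moreover have "length ns \<le> ?n" using I(2) ps(2,3) by simp
      ultimately show ?thesis using False ps(1) by (simp add: optimal_levels_def)
    qed
    then show "?Q s" using I by blast
  qed (simp add: read_off_step_def)
qed

section \<open>Trees in memory\<close>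

primrec represents ::
  "(nat \<Rightarrow> nat) \<Rightarrow> (nat \<Rightarrow> nat) \<Rightarrow> (nat \<Rightarrow> real) \<Rightarrow> stree \<Rightarrow> nat \<Rightarrow> bool" where
  "represents l r a (SLf x) p \<longleftrightarrow>
     p \<noteq> 0 \<and> l p = 0 \<and> r p = 0 \<and> a p = (case x of None \<Rightarrow> 0 | Some w \<Rightarrow> w)"
| "represents l r a (SNd t u) p \<longleftrightarrow>
     p \<noteq> 0 \<and> a p = 0 \<and> represents l r a t (l p) \<and> represents l r a u (r p)"

primrec pointers :: "(nat \<Rightarrow> nat) \<Rightarrow> (nat \<Rightarrow> nat) \<Rightarrow> stree \<Rightarrow> nat \<Rightarrow> nat list" where
  "pointers l r (SLf x) p = [p]"
| "pointers l r (SNd t u) p = p # pointers l r t (l p) @ pointers l r u (r p)"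

lemma length_pointers: "length (pointers l r t p) + 1 = 2 * sleaves t"
proof (induction t arbitrary: p)
  case (SNd t u)
  show ?case using SNd(1)[of "l p"] SNd(2)[of "r p"] by simp
qed simp

lemma represents_cong:
  assumes "\<And>x. x \<in> set (pointers l r t p) \<Longrightarrow> l' x = l x \<and> r' x = r x \<and> a' x = a x"
  shows "pointers l' r' t p = pointers l r t p \<and> represents l' r' a' t p = represents l r a t p"
  using assms by (induction t arbitrary: p) auto

lemma follow_0: "follow s 0 v = 0"
  by (cases v) auto

text \<open>Distinct cells along the preorder list exclude sharing and so give injectivity; as 0 is
  absorbing for \<open>follow\<close>, every path that leaves the tree ends in 0.\<close>

lemma follow_snodes:
  assumes "represents (iarr s ''left'') (iarr s ''right'') (warr s ''label'') t p"
    "distinct (pointers (iarr s ''left'') (iarr s ''right'') t p)"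
  shows "(\<forall>v. follow s p v \<noteq> 0 \<longleftrightarrow> v \<in> snodes t) \<and> inj_on (follow s p) (snodes t) \<and>
    follow s p ` snodes t \<subseteq> set (pointers (iarr s ''left'') (iarr s ''right'') t p) \<and>
    (\<forall>v\<in>snodes t. warr s ''label'' (follow s p v) = (case slabel t v of None \<Rightarrow> 0 | Some w \<Rightarrow> w))"
  using assms
proof (induction t arbitrary: p)
  case (SLf x)
  have "follow s p v \<noteq> 0 \<longleftrightarrow> v \<in> snodes (SLf x)" for v
    using SLf by (cases v) (auto simp: follow_0)
  then show ?case using SLf by simp
next
  case (SNd t u)
  let ?l = "iarr s ''left''" and ?r = "iarr s ''right''"
  let ?P = "pointers ?l ?r t (?l p)" and ?R = "pointers ?l ?r u (?r p)"
  have p: "p \<noteq> 0" "warr s ''label'' p = 0" using SNd.prems by auto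
  have d: "p \<notin> set ?P" "p \<notin> set ?R" "set ?P \<inter> set ?R = {}" using SNd.prems(2) by auto
  have t: "\<forall>v. follow s (?l p) v \<noteq> 0 \<longleftrightarrow> v \<in> snodes t" "inj_on (follow s (?l p)) (snodes t)"
    "follow s (?l p) ` snodes t \<subseteq> set ?P"
    "\<forall>v\<in>snodes t. warr s ''label'' (follow s (?l p) v) = (case slabel t v of None \<Rightarrow> 0 | Some w \<Rightarrow> w)"
    using SNd.IH(1)[of "?l p"] SNd.prems by auto
  have u: "\<forall>v. follow s (?r p) v \<noteq> 0 \<longleftrightarrow> v \<in> snodes u" "inj_on (follow s (?r p)) (snodes u)"
    "follow s (?r p) ` snodes u \<subseteq> set ?R"
    "\<forall>v\<in>snodes u. warr s ''label'' (follow s (?r p) v) = (case slabel u v of None \<Rightarrow> 0 | Some w \<Rightarrow> w)"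
    using SNd.IH(2)[of "?r p"] SNd.prems by auto
  have f: "follow s p (b # v) = (if b then follow s (?r p) v else follow s (?l p) v)" for b v
    using p by simp
  have 1: "follow s p v \<noteq> 0 \<longleftrightarrow> v \<in> snodes (SNd t u)" for v
  proof (cases v)
    case Nil
    then show ?thesis using p by simp
  next
    case (Cons b w)
    then show ?thesis unfolding Cons f using t(1) u(1) by (cases b) (auto simp: image_iff)
  qed
  have inl: "follow s (?l p) v \<in> set ?P" if "v \<in> snodes t" for v using t(3) that by blast
  have inr: "follow s (?r p) v \<in> set ?R" if "v \<in> snodes u" for v using u(3) that by blast
  have 2: "follow s p ` snodes (SNd t u) \<subseteq> set (pointers ?l ?r (SNd t u) p)"
    using inl inr p by auto
  have 3: "warr s ''label'' (follow s p v) = (case slabel (SNd t u) v of None \<Rightarrow> 0 | Some w \<Rightarrow> w)"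
    if v: "v \<in> snodes (SNd t u)" for v
  proof (cases v)
    case Nil
    then show ?thesis using p by simp
  next
    case (Cons b w)
    then show ?thesis using v t(4) u(4) unfolding Cons f by (cases b) (auto simp: image_iff)
  qed
  have 4: "inj_on (follow s p) (snodes (SNd t u))"
  proof (rule inj_onI)
    fix v w assume v: "v \<in> snodes (SNd t u)" and w: "w \<in> snodes (SNd t u)" and e: "follow s p v = follow s p w"
    have c: "x = [] \<and> follow s p x = p \<or>
       (\<exists>y\<in>snodes t. x = False # y \<and> follow s p x = follow s (?l p) y) \<or>
       (\<exists>y\<in>snodes u. x = True # y \<and> follow s p x = follow s (?r p) y)"
      if "x \<in> snodes (SNd t u)" for x using that p by auto
    have it: "y = y'" if "y \<in> snodes t" "y' \<in> snodes t" "follow s (?l p) y = follow s (?l p) y'" for y y'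
      using t(2) that by (auto dest: inj_onD)
    have iu: "y = y'" if "y \<in> snodes u" "y' \<in> snodes u" "follow s (?r p) y = follow s (?r p) y'" for y y'
      using u(2) that by (auto dest: inj_onD)
    have tu: "follow s (?l p) y \<noteq> follow s (?r p) y'" if "y \<in> snodes t" "y' \<in> snodes u" for y y'
      using inl[OF that(1)] inr[OF that(2)] d(3) by (metis disjoint_iff)
    have pt: "follow s (?l p) y \<noteq> p" if "y \<in> snodes t" for y using inl[OF that] d(1) by metis
    have pu: "follow s (?r p) y \<noteq> p" if "y \<in> snodes u" for y using inr[OF that] d(2) by metis
    show "v = w" using c[OF v] c[OF w] e
      by (elim disjE bexE conjE; metis it iu tu pt pu)
  qed
  show ?case using 1 2 3 4 by blast
qed

lemma outputs_tree_represents: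
  assumes "represents (iarr s ''left'') (iarr s ''right'') (warr s ''label'') t (ivar s ''root'')"
    "distinct (pointers (iarr s ''left'') (iarr s ''right'') t (ivar s ''root''))"
  shows "outputs_tree s (snodes t, slabel t)"
  using follow_snodes[OF assms] unfolding outputs_tree_def by (simp add: Let_def)

definition forest_pointers :: "(nat \<Rightarrow> nat) \<Rightarrow> (nat \<Rightarrow> nat) \<Rightarrow> (ctree \<times> nat) list \<Rightarrow> nat list" where
  "forest_pointers l r G = concat (map (\<lambda>(t, p). pointers l r (shrink t) p) G)"

text \<open>The forest uses exactly the cells \<open>1, ..., q\<close>: distinct, within this range,
  and \<open>q\<close> in number. No cell is wasted, so the number of leaves bounds all pointers.
  Cells above \<open>q\<close> are still zero, hence a fresh cell already has the child pointers of
  a leaf.\<close>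

definition heap :: "(nat \<Rightarrow> nat) \<Rightarrow> (nat \<Rightarrow> nat) \<Rightarrow> (nat \<Rightarrow> real) \<Rightarrow> nat \<Rightarrow> (ctree \<times> nat) list \<Rightarrow> bool" where
  "heap l r a q G \<longleftrightarrow> (\<forall>(t, p)\<in>set G. represents l r a (shrink t) p) \<and>
     distinct (forest_pointers l r G) \<and> set (forest_pointers l r G) \<subseteq> {0<..q} \<and>
     length (forest_pointers l r G) = q \<and> (\<forall>x>q. l x = 0 \<and> r x = 0 \<and> a x = 0)"

lemma forest_pointers_simps [simp]:
  "forest_pointers l r [] = []"
  "forest_pointers l r ((t, p) # G) = pointers l r (shrink t) p @ forest_pointers l r G"
  "forest_pointers l r (G @ H) = forest_pointers l r G @ forest_pointers l r H"
  by (simp_all add: forest_pointers_def)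

lemma forest_pointers_cong:
  "(\<And>t p. (t, p) \<in> set G \<Longrightarrow> pointers l' r' (shrink t) p = pointers l r (shrink t) p) \<Longrightarrow>
    forest_pointers l' r' G = forest_pointers l r G"
  by (induction G) (auto simp: forest_pointers_def)

lemma heap_cong:
  assumes h: "heap l r a q G" and eq: "\<And>x. x \<noteq> Suc q \<Longrightarrow> l' x = l x \<and> r' x = r x \<and> a' x = a x"
  shows "forest_pointers l' r' G = forest_pointers l r G"
    "\<forall>(t, p)\<in>set G. represents l' r' a' (shrink t) p \<and>
       pointers l' r' (shrink t) p = pointers l r (shrink t) p"
proof -
  have *: "pointers l' r' (shrink t) p = pointers l r (shrink t) p \<and>
      represents l' r' a' (shrink t) p = represents l r a (shrink t) p" if tp: "(t, p) \<in> set G" for t p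
  proof (rule represents_cong)
    fix x assume "x \<in> set (pointers l r (shrink t) p)"
    then have "x \<in> set (forest_pointers l r G)" using tp by (auto simp: forest_pointers_def)
    then have "x \<noteq> Suc q" using h by (auto simp: heap_def)
    then show "l' x = l x \<and> r' x = r x \<and> a' x = a x" by (rule eq)
  qed
  show "\<forall>(t, p)\<in>set G. represents l' r' a' (shrink t) p \<and>
       pointers l' r' (shrink t) p = pointers l r (shrink t) p"
    using * h unfolding heap_def by blast
  show "forest_pointers l' r' G = forest_pointers l r G"
    by (rule forest_pointers_cong) (use * in blast)
qed

lemma heap_leaf:
  assumes h: "heap l r a q G" and t: "shrink t = SLf x" and w: "w = (case x of None \<Rightarrow> 0 | Some w \<Rightarrow> w)"
  shows "heap l r (a(Suc q := w)) (Suc q) (G @ [(t, Suc q)])"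
proof -
  note c = heap_cong[OF h, of l r "a(Suc q := w)", simplified]
  have fresh: "Suc q \<notin> set (forest_pointers l r G)" using h by (auto simp: heap_def)
  have "l (Suc q) = 0" "r (Suc q) = 0" using h by (auto simp: heap_def)
  then show ?thesis using h c fresh t w unfolding heap_def by auto
qed

text \<open>The new node belongs to the skeleton only because the joined tree is not balanced; a
  balanced one would have to collapse into a single cell.\<close>

lemma heap_node:
  assumes h: "heap l r a q (X @ (t, p) # (u, p') # Y)" and nb: "\<not> balanced (Nd t u)"
  shows "heap (l(Suc q := p)) (r(Suc q := p')) a (Suc q) (X @ (Nd t u, Suc q) # Y)"
proof -
  let ?l = "l(Suc q := p)" and ?r = "r(Suc q := p')" and ?G = "X @ (t, p) # (u, p') # Y"
  note c = heap_cong[OF h, of ?l ?r a]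
  have shr: "shrink (Nd t u) = SNd (shrink t) (shrink u)" using nb by simp
  have fp: "forest_pointers ?l ?r ?G = forest_pointers l r ?G"
    by (rule c(1)) simp
  have rp: "\<forall>(t, p)\<in>set ?G. represents ?l ?r a (shrink t) p \<and>
       pointers ?l ?r (shrink t) p = pointers l r (shrink t) p"
    by (rule c(2)) simp
  have X: "forest_pointers ?l ?r X = forest_pointers l r X"
    "forest_pointers ?l ?r Y = forest_pointers l r Y"
    using rp by (auto intro!: forest_pointers_cong)
  have fresh: "Suc q \<notin> set (forest_pointers l r ?G)" using h by (auto simp: heap_def)
  have a0: "a (Suc q) = 0" using h by (auto simp: heap_def)
  have tu: "represents ?l ?r a (shrink t) p" "represents ?l ?r a (shrink u) p'"
    "pointers ?l ?r (shrink t) p = pointers l r (shrink t) p"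
    "pointers ?l ?r (shrink u) p' = pointers l r (shrink u) p'" using rp by auto
  let ?H = "X @ (Nd t u, Suc q) # Y"
  let ?P = "forest_pointers l r X" and ?R = "pointers l r (shrink t) p @ pointers l r (shrink u) p' @
    forest_pointers l r Y"
  have old: "forest_pointers l r ?G = ?P @ ?R" by simp
  have new: "forest_pointers ?l ?r ?H = ?P @ Suc q # ?R"
    using tu X by (simp add: shr del: shrink.simps)
  have d: "distinct (?P @ ?R)" "set (?P @ ?R) \<subseteq> {0<..q}" "length (?P @ ?R) = q"
    "\<forall>x>q. l x = 0 \<and> r x = 0 \<and> a x = 0"
    using h unfolding heap_def old by blast+
  show ?thesis unfolding heap_def new
  proof (intro conjI)
    have "represents ?l ?r a (shrink (Nd t u)) (Suc q)" unfolding shr using tu a0 by simp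
    then show "\<forall>(t, p)\<in>set ?H. represents ?l ?r a (shrink t) p" using rp by auto
    show "distinct (?P @ Suc q # ?R)" using d(1) fresh[unfolded old] by auto
    show "set (?P @ Suc q # ?R) \<subseteq> {0<..Suc q}" using d(2) by force
    show "length (?P @ Suc q # ?R) = Suc q" using d(3) by simp
    show "\<forall>x>Suc q. ?l x = 0 \<and> ?r x = 0 \<and> a x = 0" using d(4) by simp
  qed
qed

section \<open>Perfect trees and forests with roots of equal depth\<close>

primrec complete_tree :: "nat \<Rightarrow> real list \<Rightarrow> ctree" where
  "complete_tree 0 us = Lf (hd us)"
| "complete_tree (Suc k) us = Nd (complete_tree k (take (2 ^ k) us)) (complete_tree k (drop (2 ^ k) us))"

lemma balanced_complete_tree [simp]: "balanced (complete_tree k us) \<and> height (complete_tree k us) = k"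
  by (induction k arbitrary: us) auto

text \<open>Complete trees occur only in the proof: in memory each of them is a single leaf cell,
  labelled only if its height is 0.\<close>

lemma shrink_complete_tree: "shrink (complete_tree k us) = SLf (if k = 0 then Some (hd us) else None)"
  by (cases k) auto

definition depths :: "nat \<Rightarrow> ctree \<Rightarrow> (nat \<times> real) multiset" where
  "depths e t = image_mset (apfst (\<lambda>v. e + length v)) (mset (codewords t))"

lemma depths_Lf: "depths e (Lf w) = {#(e, w)#}"
  by (simp add: depths_def)

lemma depths_Nd: "depths e (Nd t u) = depths (Suc e) t + depths (Suc e) u"
  by (simp add: depths_def image_mset.compositionality comp_def apfst_def map_prod_def split_def)

lemma depths_complete_tree:
  "length us = 2 ^ k \<Longrightarrow> depths e (complete_tree k us) = image_mset (Pair (e + k)) (mset us)"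
proof (induction k arbitrary: us e)
  case 0
  then obtain w where "us = [w]" by (auto simp: length_Suc_conv)
  then show ?case by (simp add: depths_Lf)
next
  case (Suc k)
  have "mset us = mset (take (2 ^ k) us) + mset (drop (2 ^ k) us)"
    by (metis append_take_drop_id mset_append)
  then show ?case using Suc by (simp add: depths_Nd)
qed

definition forest_depths :: "nat \<Rightarrow> (ctree \<times> nat) list \<Rightarrow> (nat \<times> real) multiset" where
  "forest_depths e G = (\<Sum>(t, p)\<leftarrow>G. depths e t)"

definition forest_leaves :: "(ctree \<times> nat) list \<Rightarrow> nat" where
  "forest_leaves G = (\<Sum>(t, p)\<leftarrow>G. sleaves (shrink t))"

text \<open>Ensures that pairing up the trees of a forest commutes with shrinking them.\<close>

definition unmergeable :: "(ctree \<times> nat) list \<Rightarrow> bool" where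
  "unmergeable G \<longleftrightarrow> sorted_wrt (\<lambda>(t, p) (u, p'). \<not> balanced (Nd t u)) G"

text \<open>Each shrunk tree is full and has one node less than twice its number of leaves.\<close>

lemma length_forest_pointers: "length (forest_pointers l r G) + length G = 2 * forest_leaves G"
proof (induction G)
  case (Cons x G)
  obtain t p where "x = (t, p)" by fastforce
  then show ?case using Cons length_pointers[of l r "shrink t" p] by (simp add: forest_leaves_def)
qed (simp add: forest_leaves_def)

lemma heap_bound: "heap l r a q G \<Longrightarrow> q + length G = 2 * forest_leaves G"
  using length_forest_pointers[of l r G] by (simp add: heap_def)

text \<open>Joins entries \<open>2 * i\<close> and \<open>2 * i + 1\<close> into entry
  \<open>i\<close> of the same array. This is safe in place, since entry \<open>i\<close> is written
  after the two have been read and later steps read only larger indices.\<close>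

definition pair_step :: com where
  "pair_step =
     Assign ''q'' (Plus (V ''q'') (Num 1)) ;;
     Store ''left'' (V ''q'') (Cell ''st'' (Plus (V ''i'') (V ''i''))) ;;
     Store ''right'' (V ''q'') (Cell ''st'' (Plus (Plus (V ''i'') (V ''i'')) (Num 1))) ;;
     Store ''st'' (V ''i'') (V ''q'') ;;
     Assign ''i'' (Plus (V ''i'') (Num 1))"

definition pair_up :: com where
  "pair_up =
     (Assign ''i'' (Num 0) ;; Assign ''k'' (Div (V ''k'') (Num 2))) ;;
     While (ILess (V ''i'') (V ''k'')) pair_step"

text \<open>Bit \<open>d - e\<close> of the number of leaves of depth \<open>d\<close> decides
  whether a perfect tree with these leaves has its root at depth \<open>e\<close>. That bit is the
  parity of \<open>r d\<close>, which is halved whenever the level \<open>e\<close> moves up. For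
  \<open>d = e\<close> the tree is a single leaf and takes the first weight of its level, at index
  \<open>o d\<close>, since no weight of that level has been used before.\<close>

definition emit_step :: com where
  "emit_step =
     Cond (IEq (Minus (Cell ''r'' (V ''d'')) (Times (Num 2) (Div (Cell ''r'' (V ''d'')) (Num 2)))) (Num 1))
       (Assign ''q'' (Plus (V ''q'') (Num 1)) ;;
        Store ''st'' (V ''k'') (V ''q'') ;;
        Assign ''k'' (Plus (V ''k'') (Num 1)) ;;
        Cond (IEq (V ''d'') (V ''e''))
          (WStore ''label'' (V ''q'') (WCell ''w'' (Cell ''o'' (V ''d''))))
          Skip)
       Skip ;;
     Store ''r'' (V ''d'') (Div (Cell ''r'' (V ''d'')) (Num 2)) ;;
     Assign ''d'' (Plus (V ''d'') (Num 1))"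

definition emit :: com where
  "emit =
     Assign ''d'' (V ''e'') ;;
     While (ILess (V ''d'') (Plus (V ''h'') (Num 1))) emit_step"

abbreviation state_heap :: "state \<Rightarrow> nat \<Rightarrow> (ctree \<times> nat) list \<Rightarrow> bool" where
  "state_heap s \<equiv> heap (iarr s ''left'') (iarr s ''right'') (warr s ''label'')"

definition forest_state :: "state \<Rightarrow> (ctree \<times> nat) list \<Rightarrow> bool" where
  "forest_state s G \<longleftrightarrow> state_heap s (ivar s ''q'') G \<and> ivar s ''k'' = length G \<and>
     (\<forall>i<length G. iarr s ''st'' i = snd (G ! i))"

lemma root_in_pointers: "p \<in> set (pointers l r t p)"
  by (cases t) auto

lemma run_pair_up:
  assumes B: "20 * m + 20 \<le> B"
    and st: "forest_state s G" and um: "unmergeable G"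
    and ev: "even (length G)" and bound: "forest_leaves G \<le> m"
  shows "run B pair_up s (40 * m + 40) (\<lambda>s'. \<exists>H. forest_state s' H \<and>
    length H + length H = length G \<and> (\<forall>x\<in>set H. \<not> balanced (fst x)) \<and>
    forest_depths e H = forest_depths (Suc e) G \<and> forest_leaves H = forest_leaves G)"
proof -
  obtain k where k: "length G = 2 * k" using ev by (auto elim: evenE)
  let ?b = "ILess (V ''i'') (V ''k'')"
  let ?init = "Assign ''i'' (Num 0) ;; Assign ''k'' (Div (V ''k'') (Num 2))"
  \<comment> \<open>\<open>X\<close> are the joined trees, stored from index 0; \<open>Y\<close> are
    the remaining ones, stored from index \<open>2 * i\<close>, with roots one level deeper.\<close>
  define Inv where "Inv = (\<lambda>i (s :: state). \<exists>q X Y.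
    state_heap s q (X @ Y) \<and> ivar s ''q'' = q \<and> ivar s ''i'' = i \<and> ivar s ''k'' = k \<and>
    length X = i \<and> length Y + 2 * i = 2 * k \<and>
    (\<forall>j<length X. iarr s ''st'' j = snd (X ! j)) \<and>
    (\<forall>j<length Y. iarr s ''st'' (2 * i + j) = snd (Y ! j)) \<and>
    (\<forall>x\<in>set X. \<not> balanced (fst x)) \<and> unmergeable Y \<and>
    forest_depths e X + forest_depths (Suc e) Y = forest_depths (Suc e) G \<and>
    forest_leaves (X @ Y) = forest_leaves G)"
  have pos: "length G' \<le> forest_leaves G'" for G' :: "(ctree \<times> nat) list"
    unfolding forest_leaves_def
  proof (induction G')
    case (Cons x G')
    then show ?case using sleaves_pos[of "shrink (fst x)"] by (auto simp: split_def)
  qed simp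
  have km: "2 * k \<le> m" using pos[of G] k bound by simp
  show ?thesis
    unfolding pair_up_def
  proof (rule run_loop[where Inv = Inv and M = "m" and k = "max_steps pair_step"])
    have "Inv 0 (s\<lparr>ivar := (ivar s)(''i'' := 0, ''k'' := k)\<rparr>)"
      unfolding Inv_def
      by (rule exI[of _ "ivar s ''q''"], rule exI[of _ "[]"], rule exI[of _ G], intro conjI)
        (use st um k in \<open>simp_all add: forest_state_def forest_depths_def\<close>)
    then show "wp B ?init (Inv 0) s" using st k km B by (simp add: forest_state_def)
  next
    fix i s1 assume "Inv i s1"
    then have "ivar s1 ''i'' = i" "ivar s1 ''k'' = k" "2 * i \<le> 2 * k" unfolding Inv_def by auto
    then show "bfits B s1 ?b" using km B by simp
  next
    fix i s1 assume I: "Inv i s1" and bv: "bval s1 ?b"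
    then obtain q' X Y where hp: "state_heap s1 q' (X @ Y)"
      and v: "ivar s1 ''q'' = q'" "ivar s1 ''i'' = i" "ivar s1 ''k'' = k"
      and len: "length X = i" "length Y + 2 * i = 2 * k"
      and sX: "\<forall>j<length X. iarr s1 ''st'' j = snd (X ! j)"
      and sY: "\<forall>j<length Y. iarr s1 ''st'' (2 * i + j) = snd (Y ! j)"
      and nb: "\<forall>x\<in>set X. \<not> balanced (fst x)" and um: "unmergeable Y"
      and dp: "forest_depths e X + forest_depths (Suc e) Y = forest_depths (Suc e) G"
      and fl: "forest_leaves (X @ Y) = forest_leaves G"
      unfolding Inv_def by (elim exE conjE) (rule that; assumption)
    have ik: "i < k" using bv v by simp
    then have "2 \<le> length Y" using len by simp
    then obtain t p u p' Z where Y: "Y = (t, p) # (u, p') # Z"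
      by (cases Y; cases "tl Y") auto
    have nbal: "\<not> balanced (Nd t u)" and um': "unmergeable Z"
      using um unfolding Y unmergeable_def by auto
    let ?X = "X @ [(Nd t u, Suc q')]"
    have hp': "heap ((iarr s1 ''left'')(Suc q' := p)) ((iarr s1 ''right'')(Suc q' := p')) (warr s1 ''label'')
       (Suc q') (?X @ Z)"
      using heap_node[OF hp[unfolded Y] nbal] by simp
    have st2: "iarr s1 ''st'' (2 * i) = p" "iarr s1 ''st'' (2 * i + 1) = p'"
      using sY[rule_format, of 0] sY[rule_format, of 1] unfolding Y by auto
    have fl': "forest_leaves (?X @ Z) = forest_leaves G"
    proof -
      have "sleaves (shrink (Nd t u)) = sleaves (shrink t) + sleaves (shrink u)"
        unfolding shrink.simps if_not_P[OF nbal] by simp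
      then show ?thesis using fl unfolding Y by (simp add: forest_leaves_def del: shrink.simps)
    qed
    have dp': "forest_depths e ?X + forest_depths (Suc e) Z = forest_depths (Suc e) G"
      using dp unfolding Y by (simp add: forest_depths_def depths_Nd add_ac)
    have qb: "Suc q' \<le> 2 * m" using heap_bound[OF hp'] fl' bound by simp
    have pb: "p \<le> q'" "p' \<le> q'"
    proof -
      have "p \<in> set (forest_pointers (iarr s1 ''left'') (iarr s1 ''right'') (X @ Y))"
        "p' \<in> set (forest_pointers (iarr s1 ''left'') (iarr s1 ''right'') (X @ Y))"
        unfolding Y by (auto simp: root_in_pointers)
      then show "p \<le> q'" "p' \<le> q'" using hp unfolding heap_def by auto
    qed
    let ?st = "(iarr s1 ''st'')(i := Suc q')"
    have sX': "\<forall>j<length ?X. ?st j = snd (?X ! j)"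
      using sX len(1) by (auto simp: nth_append less_Suc_eq)
    have sZ: "\<forall>j<length Z. ?st (2 * Suc i + j) = snd (Z ! j)"
    proof (intro allI impI)
      fix j assume "j < length Z"
      then have "iarr s1 ''st'' (2 * i + Suc (Suc j)) = snd (Z ! j)"
        using sY[rule_format, of "Suc (Suc j)"] unfolding Y by simp
      then show "?st (2 * Suc i + j) = snd (Z ! j)" by simp
    qed
    let ?s = "s1\<lparr>iarr := (iarr s1)(''left'' := (iarr s1 ''left'')(Suc q' := p),
       ''right'' := (iarr s1 ''right'')(Suc q' := p'), ''st'' := ?st),
       ivar := (ivar s1)(''q'' := Suc q', ''i'' := Suc i)\<rparr>"
    have "Inv (Suc i) ?s" unfolding Inv_def
    proof (rule exI[of _ "Suc q'"], rule exI[of _ ?X], rule exI[of _ Z], intro conjI)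
      show "length Z + 2 * Suc i = 2 * k" using len(2) unfolding Y by simp
      show "\<forall>j<length Z. iarr ?s ''st'' (2 * Suc i + j) = snd (Z ! j)" using sZ by simp
      show "\<forall>j<length ?X. iarr ?s ''st'' j = snd (?X ! j)" using sX' by simp
    qed (use hp' v len nb nbal um' dp' fl' in simp_all)
    then have "wp B pair_step (Inv (Suc i)) s1"
      using v st2 qb pb ik km B unfolding pair_step_def by (simp add: mult_2)
    from run_wp[OF this] ik km
    show "i < m \<and> run B pair_step s1 (max_steps pair_step) (Inv (Suc i))" by simp
  next
    fix i s1 assume I: "Inv i s1" and bv: "\<not> bval s1 ?b"
    obtain q' X Y where hp: "state_heap s1 q' (X @ Y)"
      and v: "ivar s1 ''q'' = q'" "ivar s1 ''i'' = i" "ivar s1 ''k'' = k"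
      and len: "length X = i" "length Y + 2 * i = 2 * k"
      and sX: "\<forall>j<length X. iarr s1 ''st'' j = snd (X ! j)"
      and nb: "\<forall>x\<in>set X. \<not> balanced (fst x)"
      and dp: "forest_depths e X + forest_depths (Suc e) Y = forest_depths (Suc e) G"
      and fl: "forest_leaves (X @ Y) = forest_leaves G"
      using I unfolding Inv_def by (elim exE conjE) (rule that; assumption)
    have "k \<le> i" using bv v by simp
    then have "i = k" "length Y = 0" using len by linarith+
    then have "i = k" "Y = []" by simp_all
    then show "\<exists>H. forest_state s1 H \<and> length H + length H = length G \<and>
      (\<forall>x\<in>set H. \<not> balanced (fst x)) \<and>
      forest_depths e H = forest_depths (Suc e) G \<and> forest_leaves H = forest_leaves G"
      using hp v len k sX nb dp fl
      by (intro exI[of _ X]) (simp add: forest_state_def forest_depths_def)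
  qed (simp add: pair_step_def)
qed

section \<open>Assembling the skeleton from level counts\<close>

fun levels :: "nat \<Rightarrow> nat list \<Rightarrow> bool" where
  "levels N [] \<longleftrightarrow> N = 0"
| "levels N (c # cs) \<longleftrightarrow> c \<le> N \<and> levels (2 * (N - c)) cs"

primrec node_count :: "nat \<Rightarrow> nat list \<Rightarrow> nat \<Rightarrow> nat" where
  "node_count N ns 0 = N"
| "node_count N ns (Suc e) = 2 * (node_count N ns e - ns ! e)"

lemma node_count_Cons: "node_count N (c # cs) (Suc e) = node_count (2 * (N - c)) cs e"
  by (induction e) auto

text \<open>Kraft's equality in terms of nodes per level: starting from one root, no level has more
  leaves than nodes, and no node remains below the last level.\<close>

lemma levels_node_count:
  "levels N ns \<Longrightarrow> (\<forall>e<length ns. ns ! e \<le> node_count N ns e) \<and> node_count N ns (length ns) = 0"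
proof (induction ns arbitrary: N)
  case (Cons c cs)
  then have IH: "\<forall>e<length cs. cs ! e \<le> node_count (2 * (N - c)) cs e"
    "node_count (2 * (N - c)) cs (length cs) = 0" by auto
  have "(c # cs) ! e \<le> node_count N (c # cs) e" if "e < length (c # cs)" for e
  proof (cases e)
    case 0
    then show ?thesis using Cons.prems by simp
  next
    case (Suc e')
    then show ?thesis using IH(1) that by (simp only: node_count_Cons) simp
  qed
  moreover have "node_count N (c # cs) (length (c # cs)) = 0"
    using IH(2) unfolding length_Cons node_count_Cons .
  ultimately show ?case by blast
qed simp

lemma profile_levels: "profile n J I cs \<Longrightarrow> levels (2 * I) cs \<and> sum_list cs + J + 1 = n + 2 * I"
  by (induction n J I cs rule: profile.induct) auto

lemma optimal_levels_facts:
  assumes "optimal_levels sw ns" "1 \<le> length sw"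
  shows "levels 1 ns" "sum_list ns = length sw" "popcounts ns \<le> length sw"
proof -
  have "levels 1 ns \<and> sum_list ns = length sw \<and> popcounts ns \<le> length sw"
  proof (cases "length sw = 1")
    case True
    then show ?thesis using assms by (simp add: optimal_levels_def)
  next
    case False
    then obtain cs where cs: "ns = 0 # cs" "profile (length sw) 1 1 cs"
      using assms unfolding optimal_levels_def optimal_profile_def by auto
    then show ?thesis using profile_levels[OF cs(2)] popcounts_le[OF cs(2)] by simp
  qed
  then show "levels 1 ns" "sum_list ns = length sw" "popcounts ns \<le> length sw" by auto
qed

text \<open>Before the trees of depth \<open>e\<close> with leaves of depth \<open>d\<close> are emitted: the forest \<open>G\<close> contains the
  trees of depth \<open>e\<close> found so far, and \<open>R j\<close> the weights of the leaves of depth \<open>j\<close> that are not yet in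
  the forest. They fill \<open>r j\<close> perfect trees, whose roots have depth \<open>e\<close> or, if \<open>j\<close> has been
  processed, depth \<open>e - 1\<close>.\<close>

definition build_inv :: "real list \<Rightarrow> nat list \<Rightarrow> nat \<Rightarrow> nat \<Rightarrow> (ctree \<times> nat) list \<Rightarrow>
    (nat \<Rightarrow> nat) \<Rightarrow> (nat \<Rightarrow> real list) \<Rightarrow> bool" where
  "build_inv sw ns e d G r R \<longleftrightarrow>
     forest_depths e G + (\<Sum>j<length ns. image_mset (Pair j) (mset (R j))) = placement sw 0 0 ns \<and>
     (\<forall>j<length ns. length (R j) =
        r j * (if j < e then 1 else if j < d then 2 ^ (Suc j - e) else 2 ^ (j - e))) \<and>
     (\<forall>j<length ns. j < e \<or> j = e \<and> d = e \<longrightarrow>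
        r j = ns ! j \<and> R j = take (ns ! j) (drop (sum_list (take j ns)) sw)) \<and>
     length G + (\<Sum>j=e..<d. 2 * r j) + (\<Sum>j=d..<length ns. r j) = node_count 1 ns e \<and>
     unmergeable G \<and>
     (\<forall>x\<in>set G. balanced (fst x) \<longrightarrow> e + height (fst x) < d) \<and>
     forest_leaves G + (\<Sum>j<length ns. popcount (r j)) = popcounts ns \<and>
     (\<forall>j<length ns. r j \<le> length sw)"

text \<open>Stated with additions on both sides, so that it serves naturals and multisets alike
  without subtraction.\<close>

lemma sum_fun_upd:
  fixes f :: "nat \<Rightarrow> 'a \<Rightarrow> 'b :: comm_monoid_add"
  assumes "d < n"
  shows "(\<Sum>j<n. f j ((r(d := v)) j)) + f d (r d) = (\<Sum>j<n. f j (r j)) + f d v"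
proof -
  have "(\<Sum>j<n. f j ((r(d := v)) j)) = f d v + (\<Sum>j\<in>{..<n} - {d}. f j ((r(d := v)) j))"
    using assms by (subst sum.remove[of _ d]) auto
  also have "(\<Sum>j\<in>{..<n} - {d}. f j ((r(d := v)) j)) = (\<Sum>j\<in>{..<n} - {d}. f j (r j))"
    by (rule sum.cong) auto
  finally have 1: "(\<Sum>j<n. f j ((r(d := v)) j)) = f d v + (\<Sum>j\<in>{..<n} - {d}. f j (r j))" .
  have 2: "(\<Sum>j<n. f j (r j)) = f d (r d) + (\<Sum>j\<in>{..<n} - {d}. f j (r j))"
    using assms by (subst sum.remove[of _ d]) auto
  show ?thesis unfolding 1 2 by (simp add: ac_simps)
qed

lemma build_inv_counts:
  assumes "e \<le> d" "d < n"
  shows "(\<Sum>j=e..<Suc d. 2 * (r(d := v)) j) = (\<Sum>j=e..<d. 2 * r j) + 2 * (v :: nat)"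
    "(\<Sum>j=Suc d..<n. (r(d := v)) j) + r d = (\<Sum>j=d..<n. r j)"
proof -
  have "(\<Sum>j=e..<d. 2 * (r(d := v)) j) = (\<Sum>j=e..<d. 2 * r j)" by (rule sum.cong) auto
  then show "(\<Sum>j=e..<Suc d. 2 * (r(d := v)) j) = (\<Sum>j=e..<d. 2 * r j) + 2 * v"
    using assms by simp
  have "(\<Sum>j=Suc d..<n. (r(d := v)) j) = (\<Sum>j=Suc d..<n. r j)" by (rule sum.cong) auto
  then show "(\<Sum>j=Suc d..<n. (r(d := v)) j) + r d = (\<Sum>j=d..<n. r j)"
    using assms by (simp add: sum.atLeast_Suc_lessThan[of d n])
qed

text \<open>Nothing is emitted: the \<open>r d\<close> perfect trees rooted at depth
  \<open>e\<close> are regarded as half as many, rooted one level higher. Halving an even number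
  preserves its \<open>popcount\<close>.\<close>

lemma build_inv_even:
  assumes inv: "build_inv sw ns e d G r R" and d: "e \<le> d" "d < length ns" and even: "even (r d)"
  shows "build_inv sw ns e (Suc d) G (r(d := r d div 2)) R"
proof -
  let ?r = "r(d := r d div 2)"
  have len: "length (R j) =
        ?r j * (if j < e then 1 else if j < Suc d then 2 ^ (Suc j - e) else 2 ^ (j - e))"
    if j: "j < length ns" for j
  proof (cases "j = d")
    case True
    have "length (R d) = r d * 2 ^ (d - e)" using inv d unfolding build_inv_def by auto
    also have "\<dots> = (r d div 2) * 2 ^ Suc (d - e)" using even by auto
    finally show ?thesis using True d by (simp add: Suc_diff_le)
  next
    case False
    have "length (R j) = r j * (if j < e then 1 else if j < d then 2 ^ (Suc j - e) else 2 ^ (j - e))"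
      using inv j unfolding build_inv_def by blast
    then show ?thesis using False by (auto simp: less_Suc_eq)
  qed
  have "(\<Sum>j<length ns. popcount (?r j)) = (\<Sum>j<length ns. popcount (r j))"
    using sum_fun_upd[OF d(2), of "\<lambda>_. popcount" r "r d div 2"] popcount_rec[of "r d"] even by simp
  moreover have "length G + (\<Sum>j=e..<Suc d. 2 * ?r j) + (\<Sum>j=Suc d..<length ns. ?r j) =
    length G + (\<Sum>j=e..<d. 2 * r j) + (\<Sum>j=d..<length ns. r j)"
    using build_inv_counts[OF d, of r "r d div 2"] even by simp
  moreover have "\<forall>j<length ns. ?r j \<le> length sw"
    using inv unfolding build_inv_def by (auto intro: le_trans[OF div_le_dividend])
  moreover have "\<forall>x\<in>set G. balanced (fst x) \<longrightarrow> e + height (fst x) < Suc d"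
    using inv unfolding build_inv_def by (meson less_SucI)
  ultimately show ?thesis using inv len d unfolding build_inv_def by simp
qed

text \<open>One perfect tree of height \<open>d - e\<close> is split off and the others are
  regrouped in pairs. All balanced trees already in the forest are lower, so the new one can be
  joined with none of them to a balanced tree. The forest gains one leaf and the remaining
  \<open>popcount\<close> loses one.\<close>

lemma build_inv_odd:
  assumes inv: "build_inv sw ns e d G r R" and d: "e \<le> d" "d < length ns" and odd: "odd (r d)"
  defines "u \<equiv> take (2 ^ (d - e)) (R d)"
  shows "build_inv sw ns e (Suc d) (G @ [(complete_tree (d - e) u, p)]) (r(d := r d div 2))
    (R(d := drop (2 ^ (d - e)) (R d)))"
    "d = e \<Longrightarrow> sum_list (take e ns) < length sw \<and> hd u = sw ! sum_list (take e ns)"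
proof -
  let ?r = "r(d := r d div 2)" and ?R = "R(d := drop (2 ^ (d - e)) (R d))"
  let ?t = "complete_tree (d - e) u"
  let ?G = "G @ [(?t, p)]"
  have lenR: "length (R d) = r d * 2 ^ (d - e)" using inv d unfolding build_inv_def by auto
  have r: "r d = Suc (2 * (r d div 2))" using odd by presburger
  have split: "length (R d) = 2 ^ (d - e) + (r d div 2) * 2 ^ Suc (d - e)"
    unfolding lenR by (subst r) simp
  have u: "length u = 2 ^ (d - e)" using split by (simp add: u_def)
  have "mset (R d) = mset u + mset (?R d)"
    unfolding u_def by (metis append_take_drop_id fun_upd_same mset_append)
  then have ms: "depths e ?t + image_mset (Pair d) (mset (?R d)) = image_mset (Pair d) (mset (R d))"
    using depths_complete_tree[OF u, of e] d(1) by simp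
  have "(\<Sum>j<length ns. image_mset (Pair j) (mset (?R j))) + image_mset (Pair d) (mset (R d)) =
    (\<Sum>j<length ns. image_mset (Pair j) (mset (R j))) + image_mset (Pair d) (mset (?R d))"
    using sum_fun_upd[OF d(2), of "\<lambda>j ys. image_mset (Pair j) (mset ys)" R] by simp
  then have "(\<Sum>j<length ns. image_mset (Pair j) (mset (?R j))) + depths e ?t =
    (\<Sum>j<length ns. image_mset (Pair j) (mset (R j)))"
    unfolding ms[symmetric] add.assoc[symmetric] by (simp only: add_right_cancel)
  then have 1: "forest_depths e ?G + (\<Sum>j<length ns. image_mset (Pair j) (mset (?R j))) =
    placement sw 0 0 ns"
  proof -
    assume S: "(\<Sum>j<length ns. image_mset (Pair j) (mset (?R j))) + depths e ?t =
      (\<Sum>j<length ns. image_mset (Pair j) (mset (R j)))"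
    have "forest_depths e ?G = forest_depths e G + depths e ?t" by (simp add: forest_depths_def)
    then have "forest_depths e ?G + (\<Sum>j<length ns. image_mset (Pair j) (mset (?R j))) =
      forest_depths e G + (\<Sum>j<length ns. image_mset (Pair j) (mset (R j)))"
      unfolding S[symmetric] by (simp only: ac_simps)
    also have "\<dots> = placement sw 0 0 ns" using inv unfolding build_inv_def by blast
    finally show ?thesis .
  qed
  have 2: "length (?R j) =
        ?r j * (if j < e then 1 else if j < Suc d then 2 ^ (Suc j - e) else 2 ^ (j - e))"
    if j: "j < length ns" for j
  proof (cases "j = d")
    case True
    then show ?thesis using split d by (simp add: Suc_diff_le)
  next
    case False
    have "length (R j) = r j * (if j < e then 1 else if j < d then 2 ^ (Suc j - e) else 2 ^ (j - e))"
      using inv j unfolding build_inv_def by blast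
    then show ?thesis using False by (auto simp: less_Suc_eq)
  qed
  have 4: "length ?G + (\<Sum>j=e..<Suc d. 2 * ?r j) + (\<Sum>j=Suc d..<length ns. ?r j) = node_count 1 ns e"
  proof -
    have "length G + (\<Sum>j=e..<d. 2 * r j) + (\<Sum>j=d..<length ns. r j) = node_count 1 ns e"
      using inv unfolding build_inv_def by blast
    then show ?thesis using build_inv_counts[OF d, of r "r d div 2"] r by simp
  qed
  have lt: "\<forall>x\<in>set G. balanced (fst x) \<longrightarrow> e + height (fst x) < d" and um: "unmergeable G"
    using inv unfolding build_inv_def by blast+
  have 5: "unmergeable ?G"
    unfolding unmergeable_def sorted_wrt_append
  proof (intro conjI ballI)
    show "sorted_wrt (\<lambda>(t, p) (u, p'). \<not> balanced (Nd t u)) G" using um by (simp add: unmergeable_def)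
    fix x y assume x: "x \<in> set G" and y: "y \<in> set [(?t, p)]"
    have "\<not> balanced (Nd (fst x) ?t)" using lt x d(1) by fastforce
    then show "(case x of (t, p) \<Rightarrow> \<lambda>(u, p'). \<not> balanced (Nd t u)) y"
      using y by (simp add: split_def)
  qed simp
  have 6: "\<forall>x\<in>set ?G. balanced (fst x) \<longrightarrow> e + height (fst x) < Suc d"
    using lt d(1) by (auto simp: less_SucI)
  have 7: "forest_leaves ?G + (\<Sum>j<length ns. popcount (?r j)) = popcounts ns"
  proof -
    have "forest_leaves G + (\<Sum>j<length ns. popcount (r j)) = popcounts ns" using inv unfolding build_inv_def by blast
    moreover have "(\<Sum>j<length ns. popcount (?r j)) + popcount (r d) = (\<Sum>j<length ns. popcount (r j)) + popcount (r d div 2)"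
      using sum_fun_upd[OF d(2), of "\<lambda>_. popcount" r "r d div 2"] by simp
    moreover have "popcount (r d) = 1 + popcount (r d div 2)" using popcount_rec[of "r d"] odd by (simp add: odd_iff_mod_2_eq_one)
    ultimately show ?thesis by (simp add: forest_leaves_def shrink_complete_tree)
  qed
  have 8: "\<forall>j<length ns. ?r j \<le> length sw"
    using inv unfolding build_inv_def by (auto intro: le_trans[OF div_le_dividend])
  have 3: "\<forall>j<length ns. j < e \<or> j = e \<and> Suc d = e \<longrightarrow>
        ?r j = ns ! j \<and> ?R j = take (ns ! j) (drop (sum_list (take j ns)) sw)"
    using inv d(1) unfolding build_inv_def by simp
  show "build_inv sw ns e (Suc d) ?G ?r ?R"
    unfolding build_inv_def using 1 2 3 4 5 6 7 8 by blast
  assume de: "d = e"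
  have Re: "R e = take (ns ! e) (drop (sum_list (take e ns)) sw)"
    using inv d de unfolding build_inv_def by blast
  have "u \<noteq> []" using u by auto
  then have "take (2 ^ (d - e)) (R d) \<noteq> []" unfolding u_def .
  then have "R e \<noteq> []" using de by auto
  then have "sum_list (take e ns) < length sw \<and> 0 < ns ! e" unfolding Re by auto
  moreover from this have "hd (R e) = sw ! sum_list (take e ns)"
    unfolding Re by (simp add: hd_drop_conv_nth)
  ultimately show "sum_list (take e ns) < length sw \<and> hd u = sw ! sum_list (take e ns)"
    unfolding u_def using de by (simp add: hd_take)
qed

text \<open>The nodes of depth \<open>e + 1\<close> are the children of the inner nodes of depth
  \<open>e\<close>, so their number is even; the pending perfect trees come in pairs on that level,
  hence the forest is even too. Joined trees are all imperfect, so the new forest is unmergeable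
  outright.\<close>

lemma build_inv_pair:
  assumes inv: "build_inv sw ns (Suc e) (length ns) G r R" and e: "e < length ns"
    and lv: "levels 1 ns"
  shows "even (length G)"
    "length H + length H = length G \<Longrightarrow> \<forall>x\<in>set H. \<not> balanced (fst x) \<Longrightarrow>
      forest_depths e H = forest_depths (Suc e) G \<Longrightarrow> forest_leaves H = forest_leaves G \<Longrightarrow>
      build_inv sw ns e e H r R"
proof -
  have le: "ns ! e \<le> node_count 1 ns e" using levels_node_count[OF lv] e by blast
  have cnt: "length G + 2 * (\<Sum>j=Suc e..<length ns. r j) = 2 * (node_count 1 ns e - ns ! e)"
    using inv unfolding build_inv_def by (simp add: sum_distrib_left)
  then show "even (length G)" by (metis even_add even_mult_iff dvd_refl)
  assume H: "length H + length H = length G" "\<forall>x\<in>set H. \<not> balanced (fst x)"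
    "forest_depths e H = forest_depths (Suc e) G" "forest_leaves H = forest_leaves G"
  have re: "r e = ns ! e" using inv e unfolding build_inv_def by simp
  have "(\<Sum>j=e..<length ns. r j) = ns ! e + (\<Sum>j=Suc e..<length ns. r j)"
    using re e by (simp add: sum.atLeast_Suc_lessThan)
  then have 4: "length H + (\<Sum>j=e..<e. 2 * r j) + (\<Sum>j=e..<length ns. r j) = node_count 1 ns e"
    using cnt H(1) le by simp
  have 5: "unmergeable H"
    using H(2) unfolding unmergeable_def by (induction H) auto
  have 2: "length (R j) = r j * (if j < e then 1 else if j < e then 2 ^ (Suc j - e) else 2 ^ (j - e))"
    if j: "j < length ns" for j
  proof -
    have "length (R j) = r j *
      (if j < Suc e then 1 else if j < length ns then 2 ^ (Suc j - Suc e) else 2 ^ (j - Suc e))"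
      using inv j unfolding build_inv_def by blast
    then show ?thesis using j by (auto simp: less_Suc_eq)
  qed
  have 3: "\<forall>j<length ns. j < e \<or> j = e \<and> e = e \<longrightarrow>
        r j = ns ! j \<and> R j = take (ns ! j) (drop (sum_list (take j ns)) sw)"
    using inv unfolding build_inv_def by (simp add: less_Suc_eq)
  have 6: "\<forall>x\<in>set H. balanced (fst x) \<longrightarrow> e + height (fst x) < e" using H(2) by blast
  have 1: "forest_depths e H + (\<Sum>j<length ns. image_mset (Pair j) (mset (R j))) = placement sw 0 0 ns"
    "forest_leaves H + (\<Sum>j<length ns. popcount (r j)) = popcounts ns" "\<forall>j<length ns. r j \<le> length sw"
    using inv unfolding build_inv_def H(3,4) by blast+
  show "build_inv sw ns e e H r R"
    unfolding build_inv_def using 1 2 3 4 5 6 by blast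
qed

text \<open>One level below the deepest leaves there are no nodes, the forest is empty, and every
  leaf still counts as a perfect tree of its own.\<close>

lemma build_inv_start:
  assumes lv: "levels 1 ns" and s: "sum_list ns = length sw"
    and r: "\<forall>j<length ns. r j = ns ! j"
  shows "build_inv sw ns (length ns) (length ns) [] r
    (\<lambda>j. take (ns ! j) (drop (sum_list (take j ns)) sw))"
proof -
  have le: "sum_list (take j ns) + ns ! j \<le> length sw" if "j < length ns" for j
  proof -
    have "sum_list ns = sum_list (take (Suc j) ns) + sum_list (drop (Suc j) ns)"
      by (metis append_take_drop_id sum_list_append)
    then show ?thesis using s that by (simp add: take_Suc_conv_app_nth)
  qed
  have "(\<Sum>j<length ns. popcount (r j)) = popcounts ns"
    unfolding popcounts_def using r by (simp add: sum_list_sum_nth atLeast0LessThan)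
  moreover have "\<forall>j<length ns. r j \<le> length sw" using r le by fastforce
  moreover have "\<forall>j<length ns. length (take (ns ! j) (drop (sum_list (take j ns)) sw)) = r j"
    using r le by (fastforce simp: min_def)
  ultimately show ?thesis
    using levels_node_count[OF lv] r unfolding build_inv_def
    by (simp add: forest_depths_def forest_leaves_def unmergeable_def placement_conv_sum)
qed

text \<open>There is only one node of depth 0, while every perfect tree still pending would account
  for two. Hence the forest is one tree and no weight is left over.\<close>

lemma build_inv_end:
  assumes inv: "build_inv sw ns 0 (length ns) G r R"
  shows "\<exists>t p. G = [(t, p)] \<and> depths 0 t = placement sw 0 0 ns \<and> sleaves (shrink t) = popcounts ns"
proof -
  have cnt: "length G + (\<Sum>j=0..<length ns. 2 * r j) = 1" using inv unfolding build_inv_def by simp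
  then have "length G + 2 * (\<Sum>j=0..<length ns. r j) = 1" by (simp add: sum_distrib_left)
  then have "(\<Sum>j=0..<length ns. r j) = 0" "length G = 1" by presburger+
  then have r0: "\<forall>j<length ns. r j = 0" by simp
  obtain t p where G: "G = [(t, p)]" using \<open>length G = 1\<close> by (cases G) auto
  have "\<forall>j<length ns. length (R j) =
        r j * (if j < 0 then 1 else if j < length ns then 2 ^ (Suc j - 0) else 2 ^ (j - 0))"
    using inv unfolding build_inv_def by blast
  then have R: "\<forall>j<length ns. R j = []" using r0 by simp
  have "forest_depths 0 G + (\<Sum>j<length ns. image_mset (Pair j) (mset (R j))) = placement sw 0 0 ns"
    "forest_leaves G + (\<Sum>j<length ns. popcount (r j)) = popcounts ns"
    using inv unfolding build_inv_def by blast+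
  then show ?thesis using G R r0 by (simp add: forest_depths_def forest_leaves_def)
qed

lemma depths_0: "depths 0 t = image_mset (apfst length) (mset (codewords t))"
  by (simp add: depths_def)

text \<open>The part of \<open>levels_are\<close> that survives the construction, which successively
  destroys \<open>r\<close>.\<close>

definition offsets_are :: "real list \<Rightarrow> nat list \<Rightarrow> state \<Rightarrow> bool" where
  "offsets_are sw ns s \<longleftrightarrow> weights_are s sw \<and> ivar s ''h'' + 1 = length ns \<and>
     (\<forall>d<length ns. iarr s ''o'' d = sum_list (take d ns))"

definition level_done :: "real list \<Rightarrow> nat list \<Rightarrow> nat \<Rightarrow> state \<Rightarrow> bool" where
  "level_done sw ns e s \<longleftrightarrow> offsets_are sw ns s \<and> ivar s ''e'' = e \<and>
     (\<exists>G R. forest_state s G \<and> build_inv sw ns e (length ns) G (iarr s ''r'') R)"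

definition build_inner :: com where
  "build_inner = Assign ''e'' (Minus (V ''e'') (Num 1)) ;; pair_up ;; emit"

definition build :: com where
  "build =
     (Assign ''e'' (Plus (V ''h'') (Num 1)) ;; Assign ''k'' (Num 0) ;; Assign ''q'' (Num 0)) ;;
     While (ILess (Num 0) (V ''e'')) build_inner ;;
     Assign ''root'' (Cell ''st'' (Num 0))"

context
  fixes sw :: "real list" and ns :: "nat list" and B :: nat
  assumes B: "20 * length sw + 20 \<le> B" and n: "1 \<le> length sw"
    and ns: "levels 1 ns" "sum_list ns = length sw" "popcounts ns \<le> length sw" "length ns \<le> length sw"
begin

lemma offset_le: "sum_list (take d ns) \<le> length sw"
proof -
  have "sum_list ns = sum_list (take d ns) + sum_list (drop d ns)"
    by (metis append_take_drop_id sum_list_append)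
  then show ?thesis using ns(2) by simp
qed

lemma run_emit:
  assumes o: "offsets_are sw ns s" and f: "forest_state s G" and e: "ivar s ''e'' = e" "e < length ns"
    and inv: "build_inv sw ns e e G (iarr s ''r'') R"
  shows "run B emit s (60 * length sw + 60)
    (level_done sw ns e)"
proof -
  let ?b = "ILess (V ''d'') (Plus (V ''h'') (Num 1))"
  define Inv where "Inv = (\<lambda>i (s :: state). offsets_are sw ns s \<and> ivar s ''e'' = e \<and>
    ivar s ''d'' = e + i \<and> e + i \<le> length ns \<and>
    (\<exists>G R. forest_state s G \<and> build_inv sw ns e (e + i) G (iarr s ''r'') R))"
  show ?thesis
    unfolding emit_def
  proof (rule run_loop[where Inv = Inv and M = "length sw" and k = "max_steps emit_step"])
    have "Inv 0 (s\<lparr>ivar := (ivar s)(''d'' := e)\<rparr>)"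
      unfolding Inv_def using o f e inv by (auto simp: offsets_are_def weights_are_def forest_state_def)
    then show "wp B (Assign ''d'' (V ''e'')) (Inv 0) s" using e B ns by simp
  next
    fix i s1 assume "Inv i s1"
    then show "bfits B s1 ?b" using B ns(4) by (simp add: Inv_def offsets_are_def)
  next
    fix i s1 assume I: "Inv i s1" and bv: "bval s1 ?b"
    then obtain G R where G: "forest_state s1 G" "build_inv sw ns e (e + i) G (iarr s1 ''r'') R"
      unfolding Inv_def by blast
    have o1: "offsets_are sw ns s1" "ivar s1 ''e'' = e" "ivar s1 ''d'' = e + i" using I by (auto simp: Inv_def)
    define d where "d = e + i"
    have d: "e \<le> d" "d < length ns" using bv o1 by (auto simp: d_def offsets_are_def)
    define r where "r = iarr s1 ''r''"
    define q where "q = ivar s1 ''q''"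
    have inv: "build_inv sw ns e d G r R" using G(2) by (simp add: d_def r_def)
    have hp: "state_heap s1 q G" and k: "ivar s1 ''k'' = length G"
      and st: "\<forall>i<length G. iarr s1 ''st'' i = snd (G ! i)"
      using G(1) by (auto simp: forest_state_def q_def)
    have rd: "r d \<le> length sw" using inv d(2) unfolding build_inv_def by blast
    have fl: "forest_leaves G \<le> length sw" using inv ns(3) unfolding build_inv_def by linarith
    then have qb: "q + length G \<le> 2 * length sw" using heap_bound[OF hp] by simp
    have od: "iarr s1 ''o'' d = sum_list (take d ns)" "sum_list (take d ns) \<le> length sw"
      using o1(1) d(2) offset_le by (auto simp: offsets_are_def)
    have parity: "r d - 2 * (r d div 2) = 1 \<longleftrightarrow> odd (r d)" by presburger
    have "2 * (r d div 2) \<le> length sw" using rd by linarith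
    note bnds = rd qb od(2) this d
    note v = o1(2) o1(3)[folded d_def] q_def[symmetric] k r_def[symmetric] od(1)
    have "wp B emit_step (Inv (Suc i)) s1"
    proof (cases "odd (r d)")
      case False
      let ?s = "s1\<lparr>iarr := (iarr s1)(''r'' := r(d := r d div 2)), ivar := (ivar s1)(''d'' := Suc d)\<rparr>"
      have "build_inv sw ns e (Suc d) G (r(d := r d div 2)) R"
        by (rule build_inv_even[OF inv d]) (use False in simp)
      then have "Inv (Suc i) ?s"
        unfolding Inv_def using o1 d G(1)
        by (auto simp: offsets_are_def weights_are_def forest_state_def d_def)
      then show ?thesis using v bnds B ns(4) parity False unfolding emit_step_def by simp
    next
      case True
      define u where "u = take (2 ^ (d - e)) (R d)"
      let ?t = "complete_tree (d - e) u"
      let ?G = "G @ [(?t, Suc q)]"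
      let ?R = "R(d := drop (2 ^ (d - e)) (R d))"
      have inv': "build_inv sw ns e (Suc d) ?G (r(d := r d div 2)) ?R"
        unfolding u_def by (rule build_inv_odd(1)[OF inv d True])
      have lab: "d = e \<Longrightarrow> warr s1 ''w'' (iarr s1 ''o'' d) = hd u"
        using build_inv_odd(2)[OF inv d True] o1(1) od(1) unfolding u_def
        by (simp add: offsets_are_def weights_are_def)
      define w where "w = (if d = e then hd u else 0)"
      have hp': "heap (iarr s1 ''left'') (iarr s1 ''right'') ((warr s1 ''label'')(Suc q := w)) (Suc q) ?G"
        by (rule heap_leaf[OF hp shrink_complete_tree]) (use d(1) in \<open>simp add: w_def\<close>)
      have st': "\<forall>i<length ?G. ((iarr s1 ''st'')(length G := Suc q)) i = snd (?G ! i)"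
        using st by (auto simp: nth_append less_Suc_eq)
      let ?i = "(iarr s1)(''st'' := (iarr s1 ''st'')(length G := Suc q), ''r'' := r(d := r d div 2))"
      let ?v = "(ivar s1)(''q'' := Suc q, ''k'' := Suc (length G), ''d'' := Suc d)"
      show ?thesis
      proof (cases "d = e")
        case de: True
        let ?s = "s1\<lparr>warr := (warr s1)(''label'' := (warr s1 ''label'')(Suc q := w)), iarr := ?i, ivar := ?v\<rparr>"
        have "forest_state ?s ?G" using hp' st' by (simp add: forest_state_def)
        then have "Inv (Suc i) ?s"
          unfolding Inv_def using o1 d inv'
          by (auto simp: offsets_are_def weights_are_def d_def)
        moreover have "warr s1 ''w'' (sum_list (take d ns)) = w" using lab de od(1) by (simp add: w_def)
        ultimately show ?thesis using v bnds B ns(4) parity True de unfolding emit_step_def by simp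
      next
        case de: False
        let ?s = "s1\<lparr>iarr := ?i, ivar := ?v\<rparr>"
        \<comment> \<open>A collapsed subtree gets no label; the fresh cell still holds 0, which
          encodes exactly that.\<close>
        have "(warr s1 ''label'')(Suc q := w) = warr s1 ''label''"
          using hp de by (auto simp: heap_def w_def)
        then have "forest_state ?s ?G" using hp' st' by (simp add: forest_state_def)
        then have "Inv (Suc i) ?s"
          unfolding Inv_def using o1 d inv'
          by (auto simp: offsets_are_def weights_are_def d_def)
        then show ?thesis using v bnds B ns(4) parity True de unfolding emit_step_def by simp
      qed
    qed
    from run_wp[OF this] d ns(4)
    show "i < length sw \<and> run B emit_step s1 (max_steps emit_step) (Inv (Suc i))" by (simp add: d_def)
  next
    fix i s1 assume I: "Inv i s1" and bv: "\<not> bval s1 ?b"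
    then have "e + i = length ns" by (auto simp: Inv_def offsets_are_def)
    then show "level_done sw ns e s1" using I unfolding Inv_def level_done_def by auto
  qed (simp add: emit_step_def)
qed

lemma run_build_inner:
  assumes ld: "level_done sw ns (Suc e) s" and el: "e < length ns"
  shows "run B build_inner s (100 * length sw + 110)
    (level_done sw ns e)"
proof -
  obtain G R where o: "offsets_are sw ns s" and f: "forest_state s G" and e: "ivar s ''e'' = Suc e" "e < length ns"
    and inv: "build_inv sw ns (Suc e) (length ns) G (iarr s ''r'') R"
    using ld el by (auto simp: level_done_def)
  let ?s = "s\<lparr>ivar := (ivar s)(''e'' := e)\<rparr>"
  have fl: "forest_leaves G \<le> length sw" using inv ns(3) unfolding build_inv_def by linarith
  have um: "unmergeable G" using inv unfolding build_inv_def by blast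
  have "run B build_inner s (4 + ((40 * length sw + 40) + (60 * length sw + 60) + 1) + 1) (level_done sw ns e)"
    unfolding build_inner_def
  proof (rule run_Seq)
    have "wp B (Assign ''e'' (Minus (V ''e'') (Num 1))) (\<lambda>s'. s' = ?s) s"
      using e B ns(4) by simp
    then show "run B (Assign ''e'' (Minus (V ''e'') (Num 1))) s 4 (\<lambda>s'. s' = ?s)"
      by (rule run_wpI) simp
  next
    fix s1 assume s1: "s1 = ?s"
    have f1: "forest_state s1 G" using f unfolding s1 by (simp add: forest_state_def)
    show "run B (pair_up ;; emit) s1 ((40 * length sw + 40) + (60 * length sw + 60) + 1) (level_done sw ns e)"
    proof (rule run_Seq[OF run_frame[OF run_pair_up[OF B f1 um build_inv_pair(1)[OF inv e(2) ns(1)] fl]]],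
        elim conjE exE)
      fix s2 H
      assume ag: "agree_off (writes pair_up) s1 s2"
        and H: "forest_state s2 H" "length H + length H = length G" "\<forall>x\<in>set H. \<not> balanced (fst x)"
          "forest_depths e H = forest_depths (Suc e) G" "forest_leaves H = forest_leaves G"
      note ag = ag[unfolded s1 pair_up_def pair_step_def, simplified]
      have o2: "offsets_are sw ns s2" using o ag by (simp add: offsets_are_def weights_are_def agree_off_def)
      have e2: "ivar s2 ''e'' = e" and r2: "iarr s2 ''r'' = iarr s ''r''"
        using ag by (simp_all add: agree_off_def)
      have "build_inv sw ns e e H (iarr s2 ''r'') R"
        unfolding r2 by (rule build_inv_pair(2)[OF inv e(2) ns(1) H(2-5)])
      then show "run B emit s2 (60 * length sw + 60) (level_done sw ns e)" by (rule run_emit[OF o2 H(1) e2 e(2)])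
    qed
  qed
  then show ?thesis by (rule run_mono) simp_all
qed

lemma run_build:
  assumes o: "offsets_are sw ns s" and r: "\<forall>d<length ns. iarr s ''r'' d = ns ! d"
    and z: "iarr s ''left'' = (\<lambda>_. 0)" "iarr s ''right'' = (\<lambda>_. 0)" "warr s ''label'' = (\<lambda>_. 0)"
  shows "run B build s (120 * (length sw + 1) * (length sw + 1))
    (\<lambda>s. \<exists>t. outputs_tree s (snodes (shrink t), slabel (shrink t)) \<and>
      image_mset (apfst length) (mset (codewords t)) = placement sw 0 0 ns \<and>
      sleaves (shrink t) = popcounts ns)"
proof -
  let ?b = "ILess (Num 0) (V ''e'')"
  let ?init = "Assign ''e'' (Plus (V ''h'') (Num 1)) ;; Assign ''k'' (Num 0) ;; Assign ''q'' (Num 0)"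
  let ?Q = "\<lambda>s. \<exists>t. outputs_tree s (snodes (shrink t), slabel (shrink t)) \<and>
      image_mset (apfst length) (mset (codewords t)) = placement sw 0 0 ns \<and>
      sleaves (shrink t) = popcounts ns"
  let ?k = "100 * length sw + 110"
  define Inv where "Inv = (\<lambda>i s. \<exists>e. level_done sw ns e s \<and> e + i = length ns)"
  have "run B build s (max_steps ?init + ((length sw * (bcost ?b + ?k + 1) + bcost ?b + 1) + 3 + 1) + 1) ?Q"
    unfolding build_def
  proof (rule run_Seq)
    let ?s = "s\<lparr>ivar := (ivar s)(''e'' := length ns, ''k'' := 0, ''q'' := 0)\<rparr>"
    have "build_inv sw ns (length ns) (length ns) [] (iarr s ''r'')
      (\<lambda>j. take (ns ! j) (drop (sum_list (take j ns)) sw))"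
      by (rule build_inv_start[OF ns(1,2) r])
    moreover have "forest_state ?s []" using z by (simp add: forest_state_def heap_def)
    moreover have "offsets_are sw ns ?s" using o by (simp add: offsets_are_def weights_are_def)
    ultimately have "Inv 0 ?s" unfolding Inv_def level_done_def by auto
    moreover have "ivar s ''h'' + 1 = length ns" using o by (simp add: offsets_are_def)
    ultimately have "wp B ?init (Inv 0) s" using B ns(4) by simp
    then show "run B ?init s (max_steps ?init) (Inv 0)" by (rule run_wp)
  next
    fix s0 assume "Inv 0 s0"
    then have "run B (While ?b build_inner) s0 (length sw * (bcost ?b + ?k + 1) + bcost ?b + 1)
      (level_done sw ns 0)"
    proof (rule run_While)
      fix i s1 assume "Inv i s1"
      then have "ivar s1 ''e'' \<le> length ns" by (auto simp: Inv_def level_done_def)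
      then show "bfits B s1 ?b" using B ns(4) by simp
    next
      fix i s1 assume "Inv i s1" and bv: "bval s1 ?b"
      then obtain e where I: "level_done sw ns e s1" "e + i = length ns"
        unfolding Inv_def by blast
      then obtain e' where e: "e = Suc e'" using bv by (cases e) (auto simp: level_done_def)
      have "run B build_inner s1 ?k (Inv (Suc i))"
        by (rule run_mono[OF run_build_inner[OF I(1)[unfolded e]]])
          (use I e in \<open>auto simp: Inv_def\<close>)
      then show "i < length sw \<and> run B build_inner s1 ?k (Inv (Suc i))" using I(2) e ns(4) by simp
    next
      fix i s1 assume "Inv i s1" and bv: "\<not> bval s1 ?b"
      then show "level_done sw ns 0 s1"
        unfolding Inv_def level_done_def by auto
    qed
    then show "run B (While ?b build_inner ;; Assign ''root'' (Cell ''st'' (Num 0))) s0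
      ((length sw * (bcost ?b + ?k + 1) + bcost ?b + 1) + 3 + 1) ?Q"
    proof (rule run_Seq)
      fix s1 assume "level_done sw ns 0 s1"
      then obtain G R where G: "forest_state s1 G" "build_inv sw ns 0 (length ns) G (iarr s1 ''r'') R"
        unfolding level_done_def by blast
      obtain t p where t: "G = [(t, p)]" "depths 0 t = placement sw 0 0 ns" "sleaves (shrink t) = popcounts ns"
        using build_inv_end[OF G(2)] by blast
      have hp: "state_heap s1 (ivar s1 ''q'') [(t, p)]" and p: "iarr s1 ''st'' 0 = p"
        using G(1) t(1) by (auto simp: forest_state_def)
      let ?s = "s1\<lparr>ivar := (ivar s1)(''root'' := p)\<rparr>"
      have "outputs_tree ?s (snodes (shrink t), slabel (shrink t))"
        by (rule outputs_tree_represents) (use hp in \<open>auto simp: heap_def\<close>)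
      then have Q: "?Q ?s" using t(2,3) depths_0 by metis
      have "set (pointers (iarr s1 ''left'') (iarr s1 ''right'') (shrink t) p) \<subseteq> {0<..ivar s1 ''q''}"
        using hp by (simp add: heap_def)
      from subsetD[OF this root_in_pointers] have "p \<le> ivar s1 ''q''" by simp
      moreover have "ivar s1 ''q'' + 1 = 2 * popcounts ns"
        using heap_bound[OF hp] t(3) by (simp add: forest_leaves_def)
      ultimately have "p \<le> B" using ns(3) B by linarith
      then have "wp B (Assign ''root'' (Cell ''st'' (Num 0))) ?Q s1" using Q p by simp
      then show "run B (Assign ''root'' (Cell ''st'' (Num 0))) s1 3 ?Q" by (rule run_wpI) simp
    qed
  qed
  then show ?thesis by (rule run_mono) (simp_all add: algebra_simps)
qed

end

section \<open>The algorithm\<close>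

definition skeleton_program :: com where
  "skeleton_program = sort_weights ;; suffix_sums ;; dp ;; read_off ;; build"

section \<open>Resource bounds\<close>

definition rounds :: "nat \<Rightarrow> nat" where
  "rounds n = nat \<lceil>log 2 (2 * real n + 1)\<rceil>"

lemma rounds: "2 * n + 1 \<le> 2 ^ rounds n"
proof -
  have "real (2 * n + 1) = 2 powr log 2 (2 * real n + 1)" by simp
  also have "\<dots> \<le> 2 powr real (rounds n)"
    unfolding rounds_def by (intro powr_mono) linarith+
  also have "\<dots> = real (2 ^ rounds n)" by (simp add: powr_realpow)
  finally show ?thesis by (simp only: of_nat_le_iff)
qed

text \<open>The dominating contribution comes from the convolution rounds, about
  \<open>200 * n\<close> steps each, with at most \<open>rounds n\<close> of them in each of fewer
  than \<open>n\<close> rows; 1000 absorbs the other phases.\<close>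

definition time_bound :: "nat \<Rightarrow> nat" where
  "time_bound n = 1000 * (n + 1) * (n + 1) * (rounds n + 1)"

text \<open>Quadratic because of the table indices \<open>J * n + I\<close>; the linear part covers
  counts, pointers and the doubled \<open>p\<close>.\<close>

definition word_bound :: "nat \<Rightarrow> nat" where
  "word_bound n = n * n + 20 * n + 20"

lemma time_bound_bigo: "(\<lambda>n. real (time_bound n)) \<in> O(\<lambda>n. (real n)\<^sup>2 * ln (real n))"
proof -
  have "(\<lambda>n. real (time_bound n)) \<in>
    O(\<lambda>n. 1000 * (real n + 1) * (real n + 1) * (log 2 (2 * real n + 1) + 2))"
  proof (rule bigoI[of _ 1], rule always_eventually, rule allI)
    fix n
    have l: "0 \<le> log 2 (2 * real n + 1)" by simp
    \<comment> \<open>Rounding the logarithm up adds at most 1.\<close>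
    then have "real (rounds n) + 1 \<le> log 2 (2 * real n + 1) + 2"
      unfolding rounds_def by linarith
    moreover have "real (time_bound n) = 1000 * (real n + 1) * (real n + 1) * (real (rounds n) + 1)"
      by (simp only: time_bound_def of_nat_mult of_nat_add of_nat_numeral of_nat_1)
    ultimately have "real (time_bound n) \<le>
      1000 * (real n + 1) * (real n + 1) * (log 2 (2 * real n + 1) + 2)"
      by (simp only:) (intro mult_left_mono, simp_all)
    then show "norm (real (time_bound n)) \<le>
      1 * norm (1000 * (real n + 1) * (real n + 1) * (log 2 (2 * real n + 1) + 2))"
      using l by simp
  qed
  also have "(\<lambda>n::nat. 1000 * (real n + 1) * (real n + 1) * (log 2 (2 * real n + 1) + 2)) \<in>
    O(\<lambda>n. (real n)\<^sup>2 * ln (real n))"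
    by real_asymp
  finally show ?thesis .
qed

lemma word_bound_bigo: "(\<lambda>n. real (word_bound n)) \<in> O(\<lambda>n. real n ^ 2)"
  unfolding word_bound_def by (simp, real_asymp)

lemma single_codeword:
  assumes "length (codewords t) = 1" shows "\<exists>w. t = Lf w"
proof (cases t)
  case (Nd l r)
  have "1 \<le> length (codewords t)" for t by (simp add: Suc_le_eq)
  from this[of l] this[of r] show ?thesis using assms Nd by simp
qed simp

text \<open>A single weight is treated apart: the only full tree is a leaf, and profiles start with
  an inner root.\<close>

lemma optimal_levels_tree:
  assumes ws: "ws \<noteq> []" "\<forall>w\<in>set ws. w > 0"
    and sw: "mset sw = mset ws" "sorted_wrt (\<ge>) sw"
    and ns: "optimal_levels sw ns"
    and t: "image_mset (apfst length) (mset (codewords t)) = placement sw 0 0 ns"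
      "sleaves (shrink t) = popcounts ns"
  shows "optimal_skeleton_tree ws (snodes (shrink t), slabel (shrink t))"
proof (cases "length sw = 1")
  case True
  then obtain x where x: "sw = [x]" by (auto simp: length_Suc_conv)
  have "ns = [1]" using ns True by (simp add: optimal_levels_def)
  then have pl: "placement sw 0 0 ns = {#(0, x)#}" by (simp add: x)
  then have "length (codewords t) = 1" using t(1) by (metis size_image_mset size_mset size_single)
  then obtain w where w: "t = Lf w" using single_codeword by blast
  then have "w = x" using t(1) pl by simp
  then have ms: "mset (map snd (codewords t)) = mset ws" using w sw(1) x by simp
  show ?thesis
  proof (rule optimal_skeleton_treeI[OF ws ms])
    fix t' assume "mset (map snd (codewords t')) = mset ws"
    then have "length (codewords t') = 1" using sw(1) True by (metis length_map size_mset)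
    then obtain w' where "t' = Lf w'" using single_codeword by blast
    then show "tree_cost (codewords t) < tree_cost (codewords t') \<or>
      tree_cost (codewords t) = tree_cost (codewords t') \<and> sleaves (shrink t) \<le> sleaves (shrink t')"
      using w by (simp add: tree_cost_def)
  qed
next
  case False
  have "sw \<noteq> []" using ws(1) sw(1) by auto
  then have n: "length sw \<ge> 2" using False by (cases sw) (auto simp: Suc_le_eq)
  obtain cs where cs: "ns = 0 # cs" "optimal_profile sw 1 1 cs"
    using ns False by (auto simp: optimal_levels_def)
  have pl: "image_mset (apfst length) (mset (codewords t)) = placement sw 1 0 cs"
    using t(1) by (simp add: cs(1))
  have sl: "sleaves (shrink t) \<le> popcounts cs" using t(2) cs(1) by simp
  note tree = optimal_profile_tree[OF sw(2) n cs(2) pl sl]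
  obtain t0 where t0: "mset (map snd (codewords t0)) = mset sw"
  proof -
    have "image_mset snd (placement sw 1 0 cs) = mset sw"
      using placement_cost[of sw 1 1 cs 0 0] cs(2) by (simp add: optimal_profile_def)
    then show ?thesis using that[of t] unfolding pl[symmetric]
      by (simp add: image_mset.compositionality comp_def)
  qed
  have ms: "mset (map snd (codewords t)) = mset ws" using tree(1)[OF t0] sw(1) by simp
  show ?thesis
    by (rule optimal_skeleton_treeI[OF ws ms]) (use tree(2) sw(1) in auto)
qed

text \<open>Carries the initial zeros of arrays through phases that do not write them:
  \<open>sfx\<close> at index \<open>n\<close>, the entries of depth 0 in \<open>r\<close> and
  \<open>o\<close>, and the fresh cells of the output tree.\<close>

definition blank :: "vname set \<Rightarrow> state \<Rightarrow> bool" where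
  "blank X s \<longleftrightarrow> (\<forall>x\<in>X. iarr s x = (\<lambda>_. 0) \<and> warr s x = (\<lambda>_. 0))"

lemma blank_agree_off: "blank X s \<Longrightarrow> agree_off W s s' \<Longrightarrow> X \<inter> W = {} \<Longrightarrow> blank X s'"
  unfolding blank_def agree_off_def by (metis disjoint_iff)

lemma run_skeleton_program:
  assumes ws: "ws \<noteq> []" "\<forall>w\<in>set ws. w > 0"
  shows "run (word_bound (length ws)) skeleton_program (input_state ws) (time_bound (length ws))
    (\<lambda>s. \<exists>S. outputs_tree s S \<and> optimal_skeleton_tree ws S)"
proof -
  let ?n = "length ws" and ?s = "input_state ws"
  let ?B = "word_bound ?n" and ?L = "rounds ?n"
  let ?Q = "\<lambda>s. \<exists>S. outputs_tree s S \<and> optimal_skeleton_tree ws S"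
  let ?out = "{''r'', ''o'', ''left'', ''right'', ''label''}"
  let ?t5 = "120 * (?n + 1) * (?n + 1)"
  let ?t4 = "(50 * ?n + 50) + ?t5 + 1"
  let ?t3 = "(?n * ((?L + 1) * (200 * ?n + 200)) + 10) + ?t4 + 1"
  let ?t2 = "30 * (?n + 1) + ?t3 + 1"
  have B: "?n * ?n + 20 * ?n + 20 \<le> ?B" by (simp add: word_bound_def)
  have n: "1 \<le> ?n" using ws(1) by (cases ws) auto
  have w0: "weights_are ?s ws" by (simp add: weights_are_def input_state_def)
  have z0: "blank (insert ''sfx'' ?out) ?s" by (simp add: blank_def input_state_def)
  have "run ?B skeleton_program ?s (30 * (?n + 1) * (?n + 1) + ?t2 + 1) ?Q"
    unfolding skeleton_program_def
  proof (rule run_Seq[OF run_frame[OF run_sort_weights[OF w0]]], use B in simp, elim conjE exE)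
    fix s1 sw
    assume ag1: "agree_off (writes sort_weights) ?s s1"
      and w1: "weights_are s1 sw" and sw: "mset sw = mset ws" "sorted_wrt (\<ge>) sw"
    have len: "length sw = ?n" using sw(1) by (metis size_mset)
    have z1: "blank (insert ''sfx'' ?out) s1"
      by (rule blank_agree_off[OF z0 ag1]) (simp add: sort_weights_def sort_pass_def sort_step_def)
    have sfx: "warr s1 ''sfx'' = (\<lambda>_. 0)" using z1 by (simp add: blank_def)
    show "run ?B (suffix_sums ;; dp ;; read_off ;; build) s1 ?t2 ?Q"
    proof (rule run_Seq[OF run_frame[OF run_suffix_sums[OF w1 sfx, unfolded len]]], use B in simp, elim conjE)
      fix s2 assume ag2: "agree_off (writes suffix_sums) s1 s2"
        and w2: "weights_are s2 sw" "sums_are s2 sw"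
      have z2: "blank ?out s2"
        by (rule blank_agree_off[OF _ ag2]) (use z1 in \<open>simp_all add: blank_def suffix_sums_def\<close>)
      show "run ?B (dp ;; read_off ;; build) s2 ?t3 ?Q"
      proof (rule run_Seq[OF run_frame[OF run_dp[OF _ _ _ w2, unfolded len, OF B rounds n]]], elim conjE)
        fix s3 assume ag3: "agree_off (writes dp) s2 s3" and dp: "dp_ok sw 1 s3"
        have z3: "blank ?out s3"
          by (rule blank_agree_off[OF z2 ag3]) (simp add: dp_def dp_row_def init_step_def
              conv_rounds_def conv_step_def store_step_def)
        then have ro: "iarr s3 ''r'' = (\<lambda>_. 0)" "iarr s3 ''o'' = (\<lambda>_. 0)" by (simp_all add: blank_def)
        show "run ?B (read_off ;; build) s3 ?t4 ?Q"
        proof (rule run_Seq[OF run_frame[OF run_read_off[OF _ _ dp ro, unfolded len, OF B n]]],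
            elim conjE exE)
          fix s4 ns assume ag4: "agree_off (writes read_off) s3 s4" and w4: "weights_are s4 sw"
            and ns: "levels_are s4 ns" "optimal_levels sw ns"
          have z4: "blank {''left'', ''right'', ''label''} s4"
            by (rule blank_agree_off[OF _ ag4])
              (use z3 in \<open>simp_all add: blank_def read_off_def read_off_step_def\<close>)
          note facts = optimal_levels_facts[OF ns(2)]
          have "offsets_are sw ns s4" using w4 ns(1) by (simp add: offsets_are_def levels_are_def)
          moreover have "\<forall>d<length ns. iarr s4 ''r'' d = ns ! d" using ns(1) by (simp add: levels_are_def)
          moreover have "length ns \<le> length sw" using ns(2) by (simp add: optimal_levels_def)
          ultimately show "run ?B build s4 ?t5 ?Q"
            by (intro run_mono[OF run_build[of sw _ ns]])
              (use n B len facts z4 optimal_levels_tree[OF ws sw ns(2)] in \<open>auto simp: blank_def\<close>)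
        qed
      qed
    qed
  qed
  then show ?thesis
    by (rule run_mono) (simp_all add: time_bound_def algebra_simps)
qed

theorem theorem2:
  "\<exists>(c :: com) (T :: nat \<Rightarrow> nat) (B :: nat \<Rightarrow> nat) (k :: nat).
     (\<lambda>n. real (T n)) \<in> O(\<lambda>n. (real n)\<^sup>2 * ln (real n)) \<and>
     (\<lambda>n. real (B n)) \<in> O(\<lambda>n. real n ^ k) \<and>
     (\<forall>ws :: real list. ws \<noteq> [] \<and> (\<forall>w\<in>set ws. w > 0) \<longrightarrow>
        (\<exists>t s S. exec (B (length ws)) c (input_state ws) t s \<and> t \<le> T (length ws) \<and>
           outputs_tree s S \<and> optimal_skeleton_tree ws S))"
proof (rule exI[of _ skeleton_program], rule exI[of _ time_bound], rule exI[of _ word_bound],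
    rule exI[of _ 2], intro conjI allI impI)
  show "(\<lambda>n. real (time_bound n)) \<in> O(\<lambda>n. (real n)\<^sup>2 * ln (real n))" by (rule time_bound_bigo)
  show "(\<lambda>n. real (word_bound n)) \<in> O(\<lambda>n. real n ^ 2)" by (rule word_bound_bigo)
  fix ws :: "real list"
  assume "ws \<noteq> [] \<and> (\<forall>w\<in>set ws. w > 0)"
  then show "\<exists>t s S. exec (word_bound (length ws)) skeleton_program (input_state ws) t s \<and>
      t \<le> time_bound (length ws) \<and> outputs_tree s S \<and> optimal_skeleton_tree ws S"
    using run_skeleton_program[of ws] unfolding run_def by blast
qed

end
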